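(* The $BV$ regularity of the source and target densities does not imply the $BV$ regularity of the transport density. That is, there exist an integer $d\ge 1$, a compact convex set $\Omega\subset\mathbb{R}^d$ with nonempty interior, and nonnegative functions $f^+,f^-\in BV(\Omega)$ with $\int_\Omega f^+\,\mathrm{d}x=\int_\Omega f^-\,\mathrm{d}x$, such that the transport density $\sigma$ between $f^+$ and $f^-$ does not belong to $BV(\Omega)$.
   Context: Let $\Omega\subset\mathbb{R}^d$ be compact and convex with nonempty interior; function spaces on $\Omega$ are understood on its interior. $BV$ denotes the space of functions of bounded variation. Let $f^\pm$ be nonnegative functions in $L^1(\Omega)$ of equal total mass, identified with the measures $f^\pm\,\mathrm{d}x$. An optimal transport plan (for the Monge–Kantorovich problem with Euclidean cost) is a nonnegative Borel measure $\lambda$ on $\Omega\times\Omega$ with first marginal $f^+$ and second marginal $f^-$ that minimizes $\int_{\Omega\times\Omega}|x-y|\,\mathrm{d}\lambda(x,y)$ among all nonnegative Borel measures with these marginals. The transport density $\sigma$ between $f^+$ and $f^-$ is the nonnegative measure on $\Omega$ defined by $$\langle\sigma,\varphi\rangle=\int_{\Omega\times\Omega}\mathrm{d}\lambda(x,y)\int_0^1\varphi((1-t)x+ty)\,|x-y|\,\mathrm{d}t\qquad\text{for all }\varphi\in C(\Omega).$$ It is a known fact that, since $f^\pm$ are absolutely continuous with respect to Lebesgue measure, $\sigma$ does not depend on the choice of the optimal plan $\lambda$ and is absolutely continuous with respect to Lebesgue measure; $\sigma$ is identified with its Lebesgue density. *)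

theory Defs
  imports "HOL-Analysis.Analysis"
begin

text \<open>
  The dimension is quantified inside the theorem, so it cannot be a type parameter.
  As in HOL-Analysis, \<^term>\<open>Euclidean_space d\<close> realises \<open>R^d\<close> as the set of all
  \<open>x :: nat \<Rightarrow> real\<close> with \<open>x i = 0\<close> for \<open>i \<ge> d\<close>.
  Its topology is induced by the product topology on \<^typ>\<open>nat \<Rightarrow> real\<close>
  (lemma \<open>Euclidean_space_eq_top_of_set\<close>), so that \<open>continuous_on\<close> and \<open>borel\<close> on that type
  restrict to the usual notions on subsets of \<open>R^d\<close>.
\<close>

abbreviation RR :: "nat \<Rightarrow> (nat \<Rightarrow> real) set" where
  "RR d \<equiv> topspace (Euclidean_space d)"

lemma Euclidean_space_eq_top_of_set: "Euclidean_space d = top_of_set (RR d)"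
  by (simp add: Euclidean_space_def euclidean_product_topology)

definition enorm :: "nat \<Rightarrow> (nat \<Rightarrow> real) \<Rightarrow> real" where
  "enorm d x = L2_set x {..<d}"

definition edist :: "nat \<Rightarrow> (nat \<Rightarrow> real) \<Rightarrow> (nat \<Rightarrow> real) \<Rightarrow> real" where
  "edist d x y = enorm d (\<lambda>i. x i - y i)"

definition seg_point :: "(nat \<Rightarrow> real) \<Rightarrow> (nat \<Rightarrow> real) \<Rightarrow> real \<Rightarrow> nat \<Rightarrow> real" where
  "seg_point x y t = (\<lambda>i. (1 - t) * x i + t * y i)"

definition convex_set :: "(nat \<Rightarrow> real) set \<Rightarrow> bool" where
  "convex_set S \<longleftrightarrow> (\<forall>x\<in>S. \<forall>y\<in>S. \<forall>t\<in>{0..1}. seg_point x y t \<in> S)"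

abbreviation int_of :: "nat \<Rightarrow> (nat \<Rightarrow> real) set \<Rightarrow> (nat \<Rightarrow> real) set" where
  "int_of d S \<equiv> Euclidean_space d interior_of S"

definition zero_ext :: "nat \<Rightarrow> (nat \<Rightarrow> real) \<Rightarrow> nat \<Rightarrow> real" where
  "zero_ext d x = (\<lambda>i. if i < d then x i else 0)"

text \<open>Lebesgue measure of \<open>R^d\<close>, as a Borel measure on \<^typ>\<open>nat \<Rightarrow> real\<close> concentrated on
  \<^term>\<open>RR d\<close>. (The product measure lives on functions that are \<open>undefined\<close>, not \<open>0\<close>,
  outside the index set.)\<close>

definition leb :: "nat \<Rightarrow> (nat \<Rightarrow> real) measure" where
  "leb d = distr (Pi\<^sub>M {..<d} (\<lambda>_. lborel)) borel (zero_ext d)"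

lemma zero_ext_measurable [measurable]:
  "zero_ext d \<in> (Pi\<^sub>M {..<d} (\<lambda>_. lborel)) \<rightarrow>\<^sub>M borel"
proof (rule measurable_coordinatewise_then_product)
  fix i
  show "(\<lambda>x. zero_ext d x i) \<in> borel_measurable (Pi\<^sub>M {..<d} (\<lambda>_. lborel))"
    by (cases "i < d") (simp_all add: zero_ext_def)
qed

definition partial_deriv :: "nat \<Rightarrow> ((nat \<Rightarrow> real) \<Rightarrow> real) \<Rightarrow> (nat \<Rightarrow> real) \<Rightarrow> real" where
  "partial_deriv i f x = deriv (\<lambda>s. f (x(i := s))) (x i)"

definition C1_fun :: "nat \<Rightarrow> ((nat \<Rightarrow> real) \<Rightarrow> real) \<Rightarrow> bool" where
  "C1_fun d f \<longleftrightarrow> continuous_on (RR d) f \<and>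
     (\<forall>i<d. (\<forall>x\<in>RR d. (\<lambda>s. f (x(i := s))) differentiable (at (x i))) \<and>
            continuous_on (RR d) (partial_deriv i f))"

text \<open>Vector fields \<open>\<phi> \<in> C\<^sub>c\<^sup>1(U; R^d)\<close> with \<open>|\<phi>| \<le> 1\<close>, and the variation of \<open>u\<close> in the open
  set \<open>U\<close>.\<close>

definition test_fields :: "nat \<Rightarrow> (nat \<Rightarrow> real) set \<Rightarrow> ((nat \<Rightarrow> real) \<Rightarrow> nat \<Rightarrow> real) set" where
  "test_fields d U = {\<phi>.
     (\<forall>j<d. C1_fun d (\<lambda>x. \<phi> x j)) \<and>
     (\<exists>K. compactin (Euclidean_space d) K \<and> K \<subseteq> U \<and> (\<forall>x\<in>RR d - K. \<forall>j<d. \<phi> x j = 0)) \<and>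
     (\<forall>x\<in>RR d. enorm d (\<phi> x) \<le> 1)}"

definition divergence :: "nat \<Rightarrow> ((nat \<Rightarrow> real) \<Rightarrow> nat \<Rightarrow> real) \<Rightarrow> (nat \<Rightarrow> real) \<Rightarrow> real" where
  "divergence d \<phi> x = (\<Sum>i<d. partial_deriv i (\<lambda>y. \<phi> y i) x)"

definition variation :: "nat \<Rightarrow> (nat \<Rightarrow> real) set \<Rightarrow> ((nat \<Rightarrow> real) \<Rightarrow> real) \<Rightarrow> ereal" where
  "variation d U u =
     (SUP \<phi>\<in>test_fields d U. ereal (LINT x:U|leb d. u x * divergence d \<phi> x))"

definition BV :: "nat \<Rightarrow> (nat \<Rightarrow> real) set \<Rightarrow> ((nat \<Rightarrow> real) \<Rightarrow> real) set" where
  "BV d \<Omega> = {u. set_integrable (leb d) (int_of d \<Omega>) u \<and> variation d (int_of d \<Omega>) u < \<infinity>}"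

text \<open>The measure \<open>f dx\<close> on \<open>\<Omega>\<close>. Functions on \<open>\<Omega>\<close> are understood on its interior, so their
  values on the boundary (a null set when \<open>\<Omega>\<close> is convex) are ignored.\<close>

definition fun_measure ::
  "nat \<Rightarrow> (nat \<Rightarrow> real) set \<Rightarrow> ((nat \<Rightarrow> real) \<Rightarrow> real) \<Rightarrow> (nat \<Rightarrow> real) measure" where
  "fun_measure d \<Omega> f =
     density (restrict_space (leb d) \<Omega>) (\<lambda>x. ennreal (f x) * indicator (int_of d \<Omega>) x)"

definition transport_plan ::
  "nat \<Rightarrow> (nat \<Rightarrow> real) set \<Rightarrow> ((nat \<Rightarrow> real) \<Rightarrow> real) \<Rightarrow> ((nat \<Rightarrow> real) \<Rightarrow> real)
    \<Rightarrow> ((nat \<Rightarrow> real) \<times> (nat \<Rightarrow> real)) measure \<Rightarrow> bool" where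
  "transport_plan d \<Omega> fp fm \<gamma> \<longleftrightarrow>
     sets \<gamma> = sets (restrict_space borel (\<Omega> \<times> \<Omega>)) \<and>
     distr \<gamma> (restrict_space borel \<Omega>) fst = fun_measure d \<Omega> fp \<and>
     distr \<gamma> (restrict_space borel \<Omega>) snd = fun_measure d \<Omega> fm"

definition transport_cost :: "nat \<Rightarrow> ((nat \<Rightarrow> real) \<times> (nat \<Rightarrow> real)) measure \<Rightarrow> ennreal" where
  "transport_cost d \<gamma> = (\<integral>\<^sup>+ (x, y). ennreal (edist d x y) \<partial>\<gamma>)"

definition optimal_plan ::
  "nat \<Rightarrow> (nat \<Rightarrow> real) set \<Rightarrow> ((nat \<Rightarrow> real) \<Rightarrow> real) \<Rightarrow> ((nat \<Rightarrow> real) \<Rightarrow> real)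
    \<Rightarrow> ((nat \<Rightarrow> real) \<times> (nat \<Rightarrow> real)) measure \<Rightarrow> bool" where
  "optimal_plan d \<Omega> fp fm \<gamma> \<longleftrightarrow>
     transport_plan d \<Omega> fp fm \<gamma> \<and>
     (\<forall>\<gamma>'. transport_plan d \<Omega> fp fm \<gamma>' \<longrightarrow> transport_cost d \<gamma> \<le> transport_cost d \<gamma>')"

definition transport_density_measure ::
  "nat \<Rightarrow> (nat \<Rightarrow> real) set \<Rightarrow> ((nat \<Rightarrow> real) \<Rightarrow> real) \<Rightarrow> ((nat \<Rightarrow> real) \<Rightarrow> real)
    \<Rightarrow> (nat \<Rightarrow> real) measure \<Rightarrow> bool" where
  "transport_density_measure d \<Omega> fp fm \<mu> \<longleftrightarrow>
     finite_measure \<mu> \<and> sets \<mu> = sets (restrict_space borel \<Omega>) \<and>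
     (\<exists>\<gamma>. optimal_plan d \<Omega> fp fm \<gamma> \<and>
       (\<forall>\<phi>. continuous_on \<Omega> \<phi> \<longrightarrow>
          (\<integral>z. \<phi> z \<partial>\<mu>) =
          (\<integral>(x, y). (LBINT t:{0..1}. \<phi> (seg_point x y t) * edist d x y) \<partial>\<gamma>)))"

text \<open>\<open>\<sigma>\<close> is a Lebesgue density of the transport density measure. Uniqueness (up to null sets)
  is not built in.\<close>

definition is_transport_density ::
  "nat \<Rightarrow> (nat \<Rightarrow> real) set \<Rightarrow> ((nat \<Rightarrow> real) \<Rightarrow> real) \<Rightarrow> ((nat \<Rightarrow> real) \<Rightarrow> real)
    \<Rightarrow> ((nat \<Rightarrow> real) \<Rightarrow> real) \<Rightarrow> bool" where
  "is_transport_density d \<Omega> fp fm \<sigma> \<longleftrightarrow>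
     set_integrable (leb d) (int_of d \<Omega>) \<sigma> \<and> (\<forall>x\<in>int_of d \<Omega>. 0 \<le> \<sigma> x) \<and>
     transport_density_measure d \<Omega> fp fm (fun_measure d \<Omega> \<sigma>)"

end

(* Idea. Put c = xi' >= 0 on (0,1] and consider the rays x = xi(k) + k y, y > 0. Their unit directions are
   the gradient of a convex potential, so moving mass along them is optimal, and the area element is
   (c(k) + y) dk dy. Take the source density 1 on a thin layer 0 < y < tau(k), containing the mass
   m(k) = tau c + tau^2/2 per unit of k, and a target density constant along each ray on 1 < y < 2.
   In between the transport density is sqrt(1 + k^2) m(k) / (c(k) + y). On the n-th pair of adjacent
   k-intervals let tau = e_n and c = e_n resp. 2 e_n. The total variation of the target is then of order
   sum e_n^2 (the source has interval slices), but the jump of the transport density across the n-th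
   interface is at least e_n^2 / (12 y) for e_n < y < 1, which integrates to about e_n^2 log (1 / e_n).
   Choose e_n with sum e_n^2 finite and sum e_n^2 log (1 / e_n) infinite. *)

theory Submission
  imports Defs
begin

text \<open>Within a pair only \<open>c\<close> alternates, not the layer height \<open>tau\<close>.
  Divergence of \<open>sum e_n^2 log (1 / e_n)\<close> forces \<open>sum e_n\<close> to diverge too;
  a layer height jumping up and down by a multiple of \<open>e_n\<close> would give the source layer
  sides of total length of order \<open>sum e_n\<close>, and the source would not be BV. A height
  that is monotone in \<open>k\<close> avoids this, because every horizontal and vertical slice of
  the layer is then an interval. The jump of the mass \<open>m\<close> inside a pair comes from
  \<open>c\<close> alone and is of order \<open>e_n^2\<close>. The target meets it only at heights
  between \<open>1\<close> and \<open>2\<close>, the transport density also at heights down to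
  \<open>e_n\<close>, where the factor \<open>1 / y\<close> amplifies it. A second obstacle is that
  the statement covers every density attached to any optimal plan. The potential forces almost every
  pair of an optimal plan onto a common ray, and the integral of a test function over such a segment
  is a difference of two values of one primitive. The total thus depends on the marginals only, so
  all optimal plans define the same functional.\<close>

definition pt :: "real \<Rightarrow> real \<Rightarrow> nat \<Rightarrow> real" where
  "pt x y = (\<lambda>i. if i = 0 then x else if i = 1 then y else 0)"

lemma pt_simps [simp]: "pt x y 0 = x" "pt x y (Suc 0) = y" "i \<ge> 2 \<Longrightarrow> pt x y i = 0"
  by (auto simp: pt_def)

lemma pt_upd [simp]: "(pt x y)(0 := s) = pt s y" "(pt x y)(Suc 0 := s) = pt x s"
  by (auto simp: pt_def fun_eq_iff)

lemma pt_eq_iff [simp]: "pt x y = pt x' y' \<longleftrightarrow> x = x' \<and> y = y'"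
  by (metis pt_simps(1,2))

lemma RR2_iff: "z \<in> RR 2 \<longleftrightarrow> z = pt (z 0) (z 1)"
  unfolding topspace_Euclidean_space pt_def fun_eq_iff
  by (auto simp: numeral_2_eq_2 not_less_eq_eq le_Suc_eq)

lemma pt_in_RR2 [simp]: "pt x y \<in> RR 2"
  by (simp add: topspace_Euclidean_space)

lemma continuous_on_pt [continuous_intros]:
  assumes "continuous_on S f" "continuous_on S g"
  shows "continuous_on S (\<lambda>x. pt (f x) (g x))"
proof (rule continuous_on_coordinatewise_then_product)
  fix i show "continuous_on S (\<lambda>x. pt (f x) (g x) i)"
    using assms by (cases "i = 0"; cases "i = 1") (auto simp: pt_def)
qed

lemma continuous_on_coord [continuous_intros]: "continuous_on S (\<lambda>z::nat \<Rightarrow> real. z i)"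
  by (rule continuous_on_subset[OF continuous_on_product_coordinates]) simp

lemma measurable_coord: "(\<lambda>z::nat \<Rightarrow> real. z i) \<in> borel_measurable borel"
  by (rule borel_measurable_continuous_onI) (rule continuous_on_coord)

text \<open>Named coordinates: the measurability prover cannot handle \<open>\<lambda>z. f (z 0)\<close>, where the
  variable is itself applied.\<close>

definition px :: "(nat \<Rightarrow> real) \<Rightarrow> real" where "px z = z 0"
definition py :: "(nat \<Rightarrow> real) \<Rightarrow> real" where "py z = z 1"

lemma px_meas [measurable]: "px \<in> borel_measurable borel"
  unfolding px_def by (rule measurable_coord)

lemma py_meas [measurable]: "py \<in> borel_measurable borel"
  unfolding py_def by (rule measurable_coord)

lemma px_pt [simp]: "px (pt x y) = x" and py_pt [simp]: "py (pt x y) = y"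
  by (simp_all add: px_def py_def)

lemma pred_le_real [measurable (raw)]:
  fixes f g :: "'a \<Rightarrow> real" assumes "f \<in> borel_measurable M" "g \<in> borel_measurable M"
  shows "Measurable.pred M (\<lambda>x. f x \<le> g x)"
  using borel_measurable_le[OF assms] by (simp add: pred_def)
lemma pred_less_real [measurable (raw)]:
  fixes f g :: "'a \<Rightarrow> real" assumes "f \<in> borel_measurable M" "g \<in> borel_measurable M"
  shows "Measurable.pred M (\<lambda>x. f x < g x)"
  using borel_measurable_less[OF assms] by (simp add: pred_def)

lemma measurable_pt [measurable]:
  assumes "f \<in> borel_measurable M" "g \<in> borel_measurable M"
  shows "(\<lambda>x. pt (f x) (g x)) \<in> borel_measurable M"
proof (rule measurable_coordinatewise_then_product)
  fix i show "(\<lambda>x. pt (f x) (g x) i) \<in> borel_measurable M"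
    using assms by (cases "i = 0"; cases "i = 1") (auto simp: pt_def)
qed

lemma RR2_borel [measurable]: "RR 2 \<in> sets borel"
proof -
  have "RR 2 = {z. z = pt (z 0) (z 1)}" using RR2_iff by blast
  also have "closed \<dots>" by (intro closed_Collect_eq continuous_intros continuous_on_id)
  finally show ?thesis by (rule borel_closed)
qed

section \<open>Integration over the plane in coordinates\<close>

lemma nn_integral_leb2:
  assumes [measurable]: "h \<in> borel_measurable borel"
  shows "(\<integral>\<^sup>+z. h z \<partial>leb 2) = (\<integral>\<^sup>+y. \<integral>\<^sup>+x. h (pt x y) \<partial>lborel \<partial>lborel)"
proof -
  interpret product_sigma_finite "\<lambda>i::nat. lborel :: real measure" by standard
  have two: "{..<2::nat} = insert 1 (insert 0 {})" by auto
  have "(\<integral>\<^sup>+z. h z \<partial>leb 2) = (\<integral>\<^sup>+w. h (zero_ext 2 w) \<partial>Pi\<^sub>M {..<2} (\<lambda>_. lborel))"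
    unfolding leb_def by (subst nn_integral_distr) auto
  also have "\<dots> = (\<integral>\<^sup>+y. \<integral>\<^sup>+w. h (zero_ext 2 (w(1 := y))) \<partial>Pi\<^sub>M {0::nat} (\<lambda>_. lborel) \<partial>lborel)"
  proof -
    have "(\<lambda>w. h (zero_ext 2 w)) \<in> borel_measurable (Pi\<^sub>M {..<2} (\<lambda>_. lborel))" by measurable
    then show ?thesis unfolding two by (subst product_nn_integral_insert_rev) auto
  qed
  also have "\<dots> = (\<integral>\<^sup>+y. \<integral>\<^sup>+w. h (pt (w 0) y) \<partial>Pi\<^sub>M {0::nat} (\<lambda>_. lborel) \<partial>lborel)"
  proof -
    have "zero_ext 2 (w(1 := y)) = pt (w 0) y" for w y
      by (auto simp: zero_ext_def pt_def fun_eq_iff)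
    then show ?thesis by simp
  qed
  also have "\<dots> = (\<integral>\<^sup>+y. \<integral>\<^sup>+x. h (pt x y) \<partial>lborel \<partial>lborel)"
    by (intro nn_integral_cong, subst product_nn_integral_singleton) simp_all
  finally show ?thesis .
qed

lemma sets_leb [simp, measurable_cong]: "sets (leb d) = sets borel"
  by (simp add: leb_def)

lemma space_leb [simp]: "space (leb d) = UNIV"
  by (simp add: leb_def)

text \<open>The swapped pair matches the order in \<open>nn_integral_leb2\<close>, with the height
  as outer variable: at fixed height the ray map below is a one-dimensional substitution. Fubini for
  signed integrands, in either order, follows from this pushforward.\<close>

lemma leb2_eq: "leb 2 = distr (lborel \<Otimes>\<^sub>M lborel) borel (\<lambda>p. pt (snd p) (fst p))" (is "_ = ?R")
proof (rule measure_eqI)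
  fix A assume "A \<in> sets (leb 2)"
  then have [measurable]: "A \<in> sets borel" by simp
  have "emeasure (leb 2) A = (\<integral>\<^sup>+z. indicator A z \<partial>leb 2)" by simp
  also have "\<dots> = (\<integral>\<^sup>+y. \<integral>\<^sup>+x. indicator A (pt x y) \<partial>lborel \<partial>lborel)"
    by (rule nn_integral_leb2) simp
  also have "\<dots> = (\<integral>\<^sup>+p. indicator A (pt (snd p) (fst p)) \<partial>(lborel \<Otimes>\<^sub>M lborel))"
    by (subst lborel.nn_integral_fst[symmetric]) auto
  also have "\<dots> = (\<integral>\<^sup>+z. indicator A z \<partial>?R)"
    by (subst nn_integral_distr) auto
  finally show "emeasure (leb 2) A = emeasure ?R A" by simp
qed simp

lemma integral_leb2:
  fixes h :: "(nat \<Rightarrow> real) \<Rightarrow> real"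
  assumes "integrable (leb 2) h"
  shows "(\<integral>z. h z \<partial>leb 2) = (\<integral>y. \<integral>x. h (pt x y) \<partial>lborel \<partial>lborel)"
    and "integrable lborel (\<lambda>y. \<integral>x. h (pt x y) \<partial>lborel)"
    and "AE y in lborel. integrable lborel (\<lambda>x. h (pt x y))"
proof -
  have [measurable]: "h \<in> borel_measurable borel" using assms by (auto dest: borel_measurable_integrable)
  have i: "integrable (lborel \<Otimes>\<^sub>M lborel) (\<lambda>(y,x). h (pt x y))"
    using assms unfolding leb2_eq by (subst (asm) integrable_distr_eq) (auto simp: case_prod_beta')
  show "integrable lborel (\<lambda>y. \<integral>x. h (pt x y) \<partial>lborel)"
    using lborel_pair.integrable_fst'[OF i] by simp
  show "AE y in lborel. integrable lborel (\<lambda>x. h (pt x y))"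
    using lborel_pair.AE_integrable_fst'[OF i] by simp
  show "(\<integral>z. h z \<partial>leb 2) = (\<integral>y. \<integral>x. h (pt x y) \<partial>lborel \<partial>lborel)"
    unfolding leb2_eq by (subst integral_distr) (use lborel_pair.integral_fst'[OF i] in \<open>auto simp: case_prod_beta'\<close>)
qed

lemma integral_leb2_swap:
  fixes h :: "(nat \<Rightarrow> real) \<Rightarrow> real"
  assumes "integrable (leb 2) h"
  shows "(\<integral>z. h z \<partial>leb 2) = (\<integral>x. \<integral>y. h (pt x y) \<partial>lborel \<partial>lborel)"
    and "integrable lborel (\<lambda>x. \<integral>y. h (pt x y) \<partial>lborel)"
    and "AE x in lborel. integrable lborel (\<lambda>y. h (pt x y))"
proof -
  have [measurable]: "h \<in> borel_measurable borel" using assms by (auto dest: borel_measurable_integrable)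
  have i: "integrable (lborel \<Otimes>\<^sub>M lborel) (\<lambda>(y,x). h (pt x y))"
    using assms unfolding leb2_eq by (subst (asm) integrable_distr_eq) (auto simp: case_prod_beta')
  show "integrable lborel (\<lambda>x. \<integral>y. h (pt x y) \<partial>lborel)"
    using lborel_pair.integrable_snd[OF i] by simp
  show "AE y in lborel. integrable lborel (\<lambda>x. h (pt y x))"
    using lborel_pair.AE_integrable_snd[OF i] by simp
  show "(\<integral>z. h z \<partial>leb 2) = (\<integral>x. \<integral>y. h (pt x y) \<partial>lborel \<partial>lborel)"
    using integral_leb2(1)[OF assms] lborel_pair.integral_snd[OF i] lborel_pair.integral_fst'[OF i] by simp
qed

section \<open>A square with room around all rays in use\<close>

definition Box :: "(nat \<Rightarrow> real) set" where
  "Box = {z \<in> RR 2. z 0 \<in> {-1..4} \<and> z 1 \<in> {-1..4}}"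

text \<open>The interior of \<open>Box\<close> is only sandwiched,
  \<open>Box0 \<subseteq> int_of 2 Box \<subseteq> Box\<close>, and never computed. The densities
  and test fields constructed below vanish on the plane outside \<open>Box0\<close>: rays with slope
  in \<open>{0..1}\<close> stay in \<open>0 \<le> x \<le> 5/2\<close> up to height
  \<open>2\<close>.\<close>

definition Box0 :: "(nat \<Rightarrow> real) set" where
  "Box0 = {z \<in> RR 2. z 0 \<in> {-1<..<4} \<and> z 1 \<in> {-1<..<4}}"

lemma pt_Box [simp]: "pt x y \<in> Box \<longleftrightarrow> x \<in> {-1..4} \<and> y \<in> {-1..4}"
  by (simp add: Box_def)

lemma pt_Box0 [simp]: "pt x y \<in> Box0 \<longleftrightarrow> x \<in> {-1<..<4} \<and> y \<in> {-1<..<4}"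
  by (simp add: Box0_def)

lemma compact_pt_rect: "compact {z \<in> RR 2. z 0 \<in> {a..b} \<and> z 1 \<in> {c..d}}"
proof -
  have eq: "{z \<in> RR 2. z 0 \<in> {a..b} \<and> z 1 \<in> {c..d}} = (\<lambda>p. pt (fst p) (snd p)) ` ({a..b} \<times> {c..d})" (is "?L = ?R")
  proof
    show "?L \<subseteq> ?R"
    proof
      fix z assume "z \<in> ?L"
      then have "z = pt (z 0) (z 1)" "(z 0, z 1) \<in> {a..b} \<times> {c..d}"
        using RR2_iff[of z] by blast+
      then show "z \<in> ?R" by (metis (no_types, lifting) fst_conv image_eqI snd_conv)
    qed
  qed auto
  show ?thesis unfolding eq
    by (intro compact_continuous_image continuous_intros compact_Times) auto
qed

lemma compact_Box: "compact Box"
  unfolding Box_def by (rule compact_pt_rect)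

lemma compactin_Euclidean_iff: "compactin (Euclidean_space d) S \<longleftrightarrow> compact S \<and> S \<subseteq> RR d"
  by (subst Euclidean_space_eq_top_of_set) (simp add: compactin_subtopology del: topspace_Euclidean_space)

lemma compactin_Box: "compactin (Euclidean_space 2) Box"
  unfolding compactin_Euclidean_iff using compact_Box by (auto simp: Box_def)

lemma convex_Box: "convex_set Box"
  unfolding convex_set_def
proof (intro ballI)
  fix x y and t :: real assume xy: "x \<in> Box" "y \<in> Box" and t: "t \<in> {0..1}"
  have c: "(1 - t) * a + t * b \<in> {-1..4}" if "a \<in> {-1..4}" "b \<in> {-1..4}" for a b :: real
    using convexD_alt[of "{-1..4::real}" a b t] that t by simp
  show "seg_point x y t \<in> Box"
    using xy c unfolding Box_def seg_point_def topspace_Euclidean_space by auto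
qed

lemma openin_Box0: "openin (Euclidean_space 2) Box0"
proof -
  have "open {z::nat\<Rightarrow>real. -1 < z 0 \<and> z 0 < 4 \<and> -1 < z 1 \<and> z 1 < 4}"
    by (intro open_Collect_conj open_Collect_less continuous_intros)
  moreover have "Box0 = RR 2 \<inter> {z::nat\<Rightarrow>real. -1 < z 0 \<and> z 0 < 4 \<and> -1 < z 1 \<and> z 1 < 4}"
    by (auto simp: Box0_def)
  ultimately show ?thesis by (subst Euclidean_space_eq_top_of_set) (auto simp only: openin_open)
qed

lemma Box0_int: "Box0 \<subseteq> int_of 2 Box"
  by (rule interior_of_maximal[OF _ openin_Box0]) (auto simp: Box0_def Box_def)

lemma int_Box_subset: "int_of 2 Box \<subseteq> Box"
  by (rule interior_of_subset)

lemma int_Box_nonempty: "int_of 2 Box \<noteq> {}"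
proof -
  have "pt 0 0 \<in> Box0" by simp
  then show ?thesis using Box0_int by blast
qed

lemma Box_sets [measurable]: "Box \<in> sets borel"
  using compact_Box by (rule borel_compact)

lemma int_Box_sets [measurable]: "int_of 2 Box \<in> sets borel"
proof -
  have "openin (top_of_set (RR 2)) (int_of 2 Box)"
    using openin_interior_of[of "Euclidean_space 2" Box] by (metis Euclidean_space_eq_top_of_set)
  then obtain T where "open T" "int_of 2 Box = RR 2 \<inter> T" unfolding openin_open by blast
  then show ?thesis by auto
qed

section \<open>Divergence integrals over sets with interval slices\<close>

lemma abs_integral_deriv_interval_le:
  fixes g g' :: "real \<Rightarrow> real"
  assumes I: "is_interval I" "bounded I"
    and d: "\<And>x. (g has_real_derivative g' x) (at x)" and c: "continuous_on UNIV g'"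
    and g: "\<And>x. \<bar>g x\<bar> \<le> 1"
  shows "\<bar>\<integral>x. indicator I x * g' x \<partial>lborel\<bar> \<le> 2"
proof (cases "I = {}")
  case False
  define a b where "a = Inf I" "b = Sup I"
  have bd: "bdd_below I" "bdd_above I" using I(2) bounded_imp_bdd_below bounded_imp_bdd_above by auto
  have sub: "I \<subseteq> {a..b}" using bd by (auto simp: a_b_def cInf_lower cSup_upper)
  have ab: "a \<le> b" using sub False by force
  have sub2: "x \<in> I" if lo: "a < x" and hi: "x < b" for x
  proof -
    obtain u where "u \<in> I" "u < x" using lo cInf_less_iff[OF False bd(1), of x] by (auto simp: a_b_def)
    moreover obtain v where "v \<in> I" "x < v" using hi less_cSup_iff[OF False bd(2), of x] by (auto simp: a_b_def)
    ultimately show ?thesis using mem_is_interval_1_I[OF I(1)] by (meson less_imp_le)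
  qed
  \<comment> \<open>Membership is undecided only at the two end points. Hence \<open>I\<close> is
    Borel and agrees with \<open>{a..b}\<close> almost everywhere, and the fundamental theorem
    leaves \<open>g b - g a\<close>.\<close>
  have "I = {a<..<b} \<union> (I \<inter> {a, b})" using sub sub2 by force
  moreover have "{a<..<b} \<union> (I \<inter> {a, b}) \<in> sets borel"
    by (intro sets.Un borel_open finite_imp_closed borel_closed) auto
  ultimately have [measurable]: "I \<in> sets borel" by metis
  have [measurable]: "g' \<in> borel_measurable borel" using c by (rule borel_measurable_continuous_onI)
  have "(\<integral>x. indicator I x * g' x \<partial>lborel) = (\<integral>x. g' x * indicator {a..b} x \<partial>lborel)"
  proof (rule integral_cong_AE)
    have "AE x in lborel. x \<noteq> a" "AE x in lborel. x \<noteq> b" by (auto intro: AE_lborel_singleton)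
    then show "AE x in lborel. indicator I x * g' x = g' x * indicator {a..b} x"
      by eventually_elim (use sub sub2 in \<open>auto simp: indicator_def\<close>)
  qed auto
  also have "\<dots> = g b - g a"
    using ab d c by (intro integral_FTC_Icc_real)
      (auto simp: continuous_on_eq_continuous_at)
  finally show ?thesis using g[of a] g[of b] by linarith
qed simp

lemma test_field_partial:
  assumes "\<phi> \<in> test_fields 2 U" "i < 2"
  defines "\<psi> \<equiv> \<lambda>z. \<phi> z i"
  shows "continuous_on (RR 2) (partial_deriv i \<psi>)" "\<And>z. z \<in> RR 2 \<Longrightarrow> \<bar>\<psi> z\<bar> \<le> 1"
    "i = 0 \<Longrightarrow> ((\<lambda>s. \<psi> (pt s y)) has_real_derivative partial_deriv i \<psi> (pt x y)) (at x)"
    "i = 1 \<Longrightarrow> ((\<lambda>s. \<psi> (pt x s)) has_real_derivative partial_deriv i \<psi> (pt x y)) (at y)"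
proof -
  have C: "C1_fun 2 \<psi>" and n: "\<And>z. z \<in> RR 2 \<Longrightarrow> enorm 2 (\<phi> z) \<le> 1"
    using assms unfolding test_fields_def by auto
  show "continuous_on (RR 2) (partial_deriv i \<psi>)" using C assms unfolding C1_fun_def by auto
  show "\<bar>\<psi> z\<bar> \<le> 1" if "z \<in> RR 2" for z
  proof -
    have "\<bar>\<phi> z i\<bar> \<le> L2_set (\<lambda>i. \<bar>\<phi> z i\<bar>) {..<2}" by (rule member_le_L2_set) (use assms in auto)
    also have "\<dots> = enorm 2 (\<phi> z)" by (simp add: enorm_def L2_set_def)
    finally show ?thesis using n[OF that] by (simp add: \<psi>_def)
  qed
  have df: "(\<lambda>s. \<psi> ((pt x y)(i := s))) differentiable (at (pt x y i))" for x y
    using C assms unfolding C1_fun_def by auto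
  then have dr: "((\<lambda>s. \<psi> ((pt x y)(i := s))) has_real_derivative partial_deriv i \<psi> (pt x y)) (at (pt x y i))" for x y
    unfolding partial_deriv_def using DERIV_deriv_iff_real_differentiable by blast
  show "i = 0 \<Longrightarrow> ((\<lambda>s. \<psi> (pt s y)) has_real_derivative partial_deriv i \<psi> (pt x y)) (at x)"
    using dr[of x y] by simp
  show "i = 1 \<Longrightarrow> ((\<lambda>s. \<psi> (pt x s)) has_real_derivative partial_deriv i \<psi> (pt x y)) (at y)"
    using dr[of x y] by simp
qed

lemma emeasure_leb2_Box: "emeasure (leb 2) Box < \<infinity>"
proof -
  have "emeasure (leb 2) Box = (\<integral>\<^sup>+z. indicator Box z \<partial>leb 2)" by simp
  also have "\<dots> = (\<integral>\<^sup>+y. \<integral>\<^sup>+x. indicator {-1..4::real} y * indicator {-1..4::real} x \<partial>lborel \<partial>lborel)"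
    by (subst nn_integral_leb2) (auto intro!: nn_integral_cong simp: indicator_def)
  also have "\<dots> = 25" by (simp add: nn_integral_cmult nn_integral_multc ennreal_mult[symmetric] flip: ennreal_numeral)
  finally show ?thesis by simp
qed

lemma integrable_leb2_Box:
  fixes f :: "(nat \<Rightarrow> real) \<Rightarrow> real"
  assumes "f \<in> borel_measurable borel" "\<And>z. \<bar>f z\<bar> \<le> B * indicator Box z"
  shows "integrable (leb 2) f"
proof (rule Bochner_Integration.integrable_bound[where f="\<lambda>z. B * indicator Box z"])
  show "integrable (leb 2) (\<lambda>z. B * indicator Box z)"
    using emeasure_leb2_Box by (intro integrable_mult_right integrable_real_indicator) auto
  show "f \<in> borel_measurable (leb 2)" using assms(1) by simp
  show "AE z in leb 2. norm (f z) \<le> norm (B * indicator Box z)"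
    using assms(2) by (intro AE_I2) (smt (verit) real_norm_def)
qed

lemma continuous_on_RR2_Box:
  fixes f :: "(nat \<Rightarrow> real) \<Rightarrow> real"
  assumes "continuous_on Box f"
  shows "(\<lambda>z. indicator Box z * f z) \<in> borel_measurable borel"
    "\<exists>B\<ge>0. \<forall>z. \<bar>indicator Box z * f z\<bar> \<le> B * indicator Box z"
proof -
  show "(\<lambda>z. indicator Box z * f z) \<in> borel_measurable borel"
    using borel_measurable_continuous_on_indicator[OF _ assms] by simp
  have "bounded (f ` Box)" using assms compact_Box compact_continuous_image compact_imp_bounded by blast
  then obtain B where "\<And>z. z \<in> Box \<Longrightarrow> \<bar>f z\<bar> \<le> B" unfolding bounded_iff by auto
  then show "\<exists>B\<ge>0. \<forall>z. \<bar>indicator Box z * f z\<bar> \<le> B * indicator Box z"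
    by (intro exI[of _ "max B 0"]) (auto simp: indicator_def max.coboundedI1)
qed

lemma Box_subset_RR: "Box \<subseteq> RR 2" by (auto simp: Box_def)

text \<open>A perimeter bound uniform in \<open>E\<close>: each slice contributes at most
  \<open>2\<close>, the slices range over an interval of length \<open>5\<close>, and there are two
  coordinate directions, which gives \<open>20\<close>. The last claim is a bound depending on the
  field, kept for exchanging sums and integrals.\<close>

lemma abs_integral_divergence_le:
  assumes \<phi>: "\<phi> \<in> test_fields 2 U"
    and E [measurable]: "E \<in> sets borel" and EB: "E \<subseteq> Box"
    and sx: "\<And>y. is_interval {x. pt x y \<in> E}" and sy: "\<And>x. is_interval {y. pt x y \<in> E}"
  shows "integrable (leb 2) (\<lambda>z. indicator E z * divergence 2 \<phi> z)"
    "\<bar>\<integral>z. indicator E z * divergence 2 \<phi> z \<partial>leb 2\<bar> \<le> 20"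
    "\<exists>B\<ge>0. \<forall>z\<in>Box. \<bar>divergence 2 \<phi> z\<bar> \<le> B"
proof -
  define p where "p i = partial_deriv i (\<lambda>z. \<phi> z i)" for i
  have div: "divergence 2 \<phi> z = p 0 z + p 1 z" for z
    unfolding divergence_def p_def by (simp add: numeral_2_eq_2)
  have c: "continuous_on (RR 2) (p i)" if "i < 2" for i
    unfolding p_def using test_field_partial(1)[OF \<phi> that] .
  have cB: "continuous_on Box (p i)" if "i < 2" for i
    using c[OF that] Box_subset_RR by (rule continuous_on_subset)
  have int: "integrable (leb 2) (\<lambda>z. indicator E z * p i z)" if i: "i < 2" for i
  proof -
    note [measurable] = continuous_on_RR2_Box(1)[OF cB[OF i]]
    obtain B where B: "B \<ge> 0" "\<And>z. \<bar>indicator Box z * p i z\<bar> \<le> B * indicator Box z"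
      using continuous_on_RR2_Box(2)[OF cB[OF i]] by blast
    have eq: "indicator E z * p i z = indicator E z * (indicator Box z * p i z)" for z
      using EB by (auto simp: indicator_def)
    show ?thesis unfolding eq
    proof (rule integrable_leb2_Box)
      show "\<bar>indicator E z * (indicator Box z * p i z)\<bar> \<le> B * indicator Box z" for z
        using B(2)[of z] B(1) by (auto simp: indicator_def)
    qed measurable
  qed
  show *: "integrable (leb 2) (\<lambda>z. indicator E z * divergence 2 \<phi> z)"
    unfolding div distrib_left using int[of 0] int[of 1] by (intro Bochner_Integration.integrable_add) auto
  show "\<exists>B\<ge>0. \<forall>z\<in>Box. \<bar>divergence 2 \<phi> z\<bar> \<le> B"
  proof -
    have "continuous_on Box (\<lambda>z. p 0 z + p 1 z)" using cB by (intro continuous_intros) auto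
    from continuous_on_RR2_Box(2)[OF this] show ?thesis unfolding div
      by (metis (no_types, lifting) indicator_simps(1) mult.left_neutral mult.right_neutral)
  qed
  have bs: "bounded {x. pt x y \<in> E}" "bounded {x. pt y x \<in> E}" for y
    by (rule bounded_subset[of "{-1..4}"]; use EB in force)+
  have cp: "continuous_on UNIV (\<lambda>x. p i (pt (f x) (g x)))"
    if "i < 2" "continuous_on UNIV f" "continuous_on UNIV g" for i f and g :: "real \<Rightarrow> real"
    using that by (intro continuous_on_compose2[OF c[OF that(1)]] continuous_intros) auto
  have slice: "\<bar>\<integral>x. indicator E (pt x y) * p 0 (pt x y) \<partial>lborel\<bar> \<le> 2 * indicator {-1..4} y" for y
  proof (cases "y \<in> {-1..4}")
    case True
    have "\<bar>\<integral>x. indicator {x. pt x y \<in> E} x * p 0 (pt x y) \<partial>lborel\<bar> \<le> 2"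
    proof (rule abs_integral_deriv_interval_le[OF sx bs(1), where g="\<lambda>x. \<phi> (pt x y) 0"])
      show "((\<lambda>x. \<phi> (pt x y) 0) has_real_derivative p 0 (pt x y)) (at x)" for x
        unfolding p_def by (rule test_field_partial(3)[OF \<phi>]) auto
      show "continuous_on UNIV (\<lambda>x. p 0 (pt x y))"
        using cp[of 0 "\<lambda>x. x" "\<lambda>x. y"] by simp
      show "\<bar>\<phi> (pt x y) 0\<bar> \<le> 1" for x by (rule test_field_partial(2)[OF \<phi>]) auto
    qed
    then show ?thesis using True by (simp add: indicator_def)
  next
    case False
    then have "pt x y \<notin> E" for x using EB by auto
    then show ?thesis by simp
  qed
  have slice': "\<bar>\<integral>y. indicator E (pt x y) * p 1 (pt x y) \<partial>lborel\<bar> \<le> 2 * indicator {-1..4} x" for x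
  proof (cases "x \<in> {-1..4}")
    case True
    have "\<bar>\<integral>y. indicator {y. pt x y \<in> E} y * p 1 (pt x y) \<partial>lborel\<bar> \<le> 2"
    proof (rule abs_integral_deriv_interval_le[OF sy bs(2), where g="\<lambda>y. \<phi> (pt x y) 1"])
      show "((\<lambda>y. \<phi> (pt x y) 1) has_real_derivative p 1 (pt x y)) (at y)" for y
        unfolding p_def by (rule test_field_partial(4)[OF \<phi>]) auto
      show "continuous_on UNIV (\<lambda>y. p 1 (pt x y))"
        using cp[of 1 "\<lambda>y. x" "\<lambda>y. y"] by simp
      show "\<bar>\<phi> (pt x y) 1\<bar> \<le> 1" for y by (rule test_field_partial(2)[OF \<phi>]) auto
    qed
    then show ?thesis using True by (simp add: indicator_def)
  next
    case False
    then have "pt x y \<notin> E" for y using EB by auto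
    then show ?thesis by simp
  qed
  have i2: "integrable lborel (\<lambda>y. 2 * indicator {-1..4::real} y :: real)" by simp
  have v2: "(\<integral>y. 2 * indicator {-1..4::real} y \<partial>lborel) = (10::real)" by simp
  have "\<bar>\<integral>z. indicator E z * p 0 z \<partial>leb 2\<bar> = \<bar>\<integral>y. \<integral>x. indicator E (pt x y) * p 0 (pt x y) \<partial>lborel \<partial>lborel\<bar>"
    by (subst integral_leb2(1)[OF int]) auto
  also have "\<dots> \<le> (\<integral>y. 2 * indicator {-1..4::real} y \<partial>lborel)"
    by (rule order_trans[OF integral_abs_bound integral_mono])
       (use integral_leb2(2)[OF int[of 0]] slice i2 in auto)
  finally have a: "\<bar>\<integral>z. indicator E z * p 0 z \<partial>leb 2\<bar> \<le> 10" unfolding v2 .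
  have "\<bar>\<integral>z. indicator E z * p 1 z \<partial>leb 2\<bar> = \<bar>\<integral>x. \<integral>y. indicator E (pt x y) * p 1 (pt x y) \<partial>lborel \<partial>lborel\<bar>"
    by (subst integral_leb2_swap(1)[OF int]) auto
  also have "\<dots> \<le> (\<integral>y. 2 * indicator {-1..4::real} y \<partial>lborel)"
    by (rule order_trans[OF integral_abs_bound integral_mono])
       (use integral_leb2_swap(2)[OF int[of 1]] slice' i2 in auto)
  finally have b: "\<bar>\<integral>z. indicator E z * p 1 z \<partial>leb 2\<bar> \<le> 10" unfolding v2 .
  have "(\<integral>z. indicator E z * divergence 2 \<phi> z \<partial>leb 2) = (\<integral>z. indicator E z * p 0 z \<partial>leb 2) + (\<integral>z. indicator E z * p 1 z \<partial>leb 2)"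
    unfolding div distrib_left using int[of 0] int[of 1] by (intro Bochner_Integration.integral_add) auto
  then show "\<bar>\<integral>z. indicator E z * divergence 2 \<phi> z \<partial>leb 2\<bar> \<le> 20" using a b by linarith
qed

text \<open>Every indicator costs at most \<open>20\<close> whatever the shape of
  \<open>E j\<close>, so summing the costs bounds the variation of \<open>f\<close> by
  \<open>20 * suminf a\<close>.\<close>

lemma BV_sum_indicators:
  fixes a :: "nat \<Rightarrow> real" and E :: "nat \<Rightarrow> (nat \<Rightarrow> real) set"
  assumes a: "\<And>j. 0 \<le> a j" "summable a"
    and E [measurable]: "\<And>j. E j \<in> sets borel" and EB: "\<And>j. E j \<subseteq> Box0"
    and sx: "\<And>j y. is_interval {x. pt x y \<in> E j}" and sy: "\<And>j x. is_interval {y. pt x y \<in> E j}"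
    and f: "\<And>z. f z = (\<Sum>j. a j * indicator (E j) z)"
  shows "f \<in> BV 2 Box"
proof -
  let ?U = "int_of 2 Box"
  have EU: "E j \<subseteq> ?U" for j using EB Box0_int by blast
  have EBox: "E j \<subseteq> Box" for j using EU int_Box_subset by blast
  have sm: "summable (\<lambda>j. \<bar>a j * indicator (E j) z\<bar>)" for z
    using a by (intro summable_comparison_test[OF _ a(2)]) (auto simp: indicator_def)
  have ie: "integrable (leb 2) (\<lambda>z. indicator (E j) z :: real)" for j
    by (rule integrable_leb2_Box[where B=1]) (use EBox[of j] in \<open>auto simp: indicator_def\<close>)
  have ibd: "(\<integral>z. indicator (E j) z \<partial>leb 2) \<le> measure (leb 2) Box" for j
  proof -
    have "measure (leb 2) (E j) \<le> measure (leb 2) Box"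
      using EBox emeasure_leb2_Box by (intro measure_mono_fmeasurable) (auto simp: fmeasurable_def)
    then show ?thesis by simp
  qed
  have intf: "integrable (leb 2) (\<lambda>z. \<Sum>j. a j * indicator (E j) z)"
  proof (rule integrable_suminf)
    show "summable (\<lambda>i. \<integral>z. norm (a i * indicator (E i) z) \<partial>leb 2)"
    proof (rule summable_comparison_test'[OF summable_mult2[OF a(2), of "measure (leb 2) Box"], of 0])
      fix n :: nat
      have "(\<integral>z. norm (a n * indicator (E n) z) \<partial>leb 2) = a n * (\<integral>z. indicator (E n) z \<partial>leb 2)"
        using a(1)[of n] by (simp add: abs_mult)
      also have "\<dots> \<le> a n * measure (leb 2) Box" using a(1) ibd by (intro mult_left_mono) auto
      finally show "norm (\<integral>z. norm (a n * indicator (E n) z) \<partial>leb 2) \<le> a n * measure (leb 2) Box"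
        by simp
    qed
  qed (use ie sm in auto)
  have fU: "indicator ?U z * f z = f z" for z
  proof (cases "z \<in> ?U")
    case False
    then have "z \<notin> E j" for j using EU by blast
    then show ?thesis unfolding f by simp
  qed simp
  have si: "set_integrable (leb 2) ?U f"
    unfolding set_integrable_def real_scaleR_def fU using intf by (simp add: f)
  have bound: "(LINT z:?U|leb 2. f z * divergence 2 \<phi> z) \<le> 20 * suminf a" if \<phi>: "\<phi> \<in> test_fields 2 ?U" for \<phi>
  proof -
    note A = abs_integral_divergence_le[OF \<phi> E EBox sx sy]
    obtain B where B: "B \<ge> 0" "\<And>z. z \<in> Box \<Longrightarrow> \<bar>divergence 2 \<phi> z\<bar> \<le> B" using A(3) by blast
    have eq: "f z * divergence 2 \<phi> z = (\<Sum>j. a j * (indicator (E j) z * divergence 2 \<phi> z))" for z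
    proof -
      have "summable (\<lambda>j. a j * indicator (E j) z)" using sm by (rule summable_rabs_cancel)
      then show ?thesis unfolding f by (simp add: suminf_mult2 mult.assoc)
    qed
    have "(LINT z:?U|leb 2. f z * divergence 2 \<phi> z) = (\<integral>z. f z * divergence 2 \<phi> z \<partial>leb 2)"
      unfolding set_lebesgue_integral_def real_scaleR_def mult.assoc[symmetric] fU ..
    also have "\<dots> = (\<integral>z. (\<Sum>j. a j * (indicator (E j) z * divergence 2 \<phi> z)) \<partial>leb 2)"
      unfolding eq ..
    \<comment> \<open>The bound \<open>B\<close> depends on the test field and only justifies this
      exchange; the uniform bound \<open>20\<close> enters in the next estimate.\<close>
    also have "\<dots> = (\<Sum>j. \<integral>z. a j * (indicator (E j) z * divergence 2 \<phi> z) \<partial>leb 2)"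
    proof (rule integral_suminf)
      show "AE z in leb 2. summable (\<lambda>i. norm (a i * (indicator (E i) z * divergence 2 \<phi> z)))"
      proof (rule AE_I2)
        fix z show "summable (\<lambda>i. norm (a i * (indicator (E i) z * divergence 2 \<phi> z)))"
          using summable_mult2[OF sm[of z], of "\<bar>divergence 2 \<phi> z\<bar>"] by (simp add: abs_mult mult.assoc)
      qed
      show "summable (\<lambda>i. \<integral>z. norm (a i * (indicator (E i) z * divergence 2 \<phi> z)) \<partial>leb 2)"
      proof (rule summable_comparison_test'[OF summable_mult2[OF a(2), of "B * measure (leb 2) Box"], of 0])
        fix n :: nat
        have "(\<integral>z. norm (a n * (indicator (E n) z * divergence 2 \<phi> z)) \<partial>leb 2) = a n * (\<integral>z. \<bar>indicator (E n) z * divergence 2 \<phi> z\<bar> \<partial>leb 2)"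
          using a(1)[of n] by (simp add: abs_mult)
        also have "\<dots> \<le> a n * (\<integral>z. B * indicator (E n) z \<partial>leb 2)"
        proof (intro mult_left_mono integral_mono)
          show "\<bar>indicator (E n) z * divergence 2 \<phi> z\<bar> \<le> B * indicator (E n) z" for z
            using B(2)[of z] EBox[of n] by (auto simp: indicator_def)
        qed (use A(1) a(1) ie in \<open>auto intro: integrable_abs\<close>)
        also have "\<dots> \<le> a n * (B * measure (leb 2) Box)"
          using a(1) B(1) ibd[of n] by (auto intro!: mult_left_mono)
        finally show "norm (\<integral>z. norm (a n * (indicator (E n) z * divergence 2 \<phi> z)) \<partial>leb 2) \<le> a n * (B * measure (leb 2) Box)"
          by simp
      qed
    qed (use A(1) in auto)
    also have "\<dots> \<le> (\<Sum>j. 20 * a j)"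
    proof (rule suminf_le)
      show le: "(\<integral>z. a j * (indicator (E j) z * divergence 2 \<phi> z) \<partial>leb 2) \<le> 20 * a j" for j
        using mult_left_mono[OF A(2)[of j] a(1)[of j]] a(1)[of j] by (simp add: abs_le_iff mult.commute) (smt (verit) mult_left_mono)
      show "summable (\<lambda>j. \<integral>z. a j * (indicator (E j) z * divergence 2 \<phi> z) \<partial>leb 2)"
      proof (rule summable_comparison_test'[OF summable_mult[OF a(2), of 20], of 0])
        fix n show "norm (\<integral>z. a n * (indicator (E n) z * divergence 2 \<phi> z) \<partial>leb 2) \<le> 20 * a n"
          using mult_left_mono[OF A(2)[of n] a(1)[of n]] a(1)[of n] by (simp add: abs_mult mult.commute)
      qed
    qed (use a(2) in \<open>auto intro: summable_mult\<close>)
    also have "\<dots> = 20 * suminf a" using a(2) by (simp add: suminf_mult)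
    finally show ?thesis .
  qed
  have "variation 2 ?U f \<le> ereal (20 * suminf a)"
    unfolding variation_def by (rule SUP_least) (use bound in simp)
  also have "\<dots> < \<infinity>" by simp
  finally show ?thesis using si unfolding BV_def by simp
qed

subsection \<open>Rays and their potential\<close>

lemma emeasure_lborel_Ioc_finite: "emeasure lborel {a<..b::real} < \<infinity>"
  by (rule emeasure_bounded_finite) (rule bounded_subset[OF bounded_closed_interval[of a b]], auto)

lemma edist2: "edist 2 p q = sqrt ((p 0 - q 0)\<^sup>2 + (p 1 - q 1)\<^sup>2)"
  by (simp add: edist_def enorm_def L2_set_def numeral_2_eq_2)

text \<open>\<open>C\<close> is the speed at which the foot of a ray moves with its slope, and
  \<open>\<xi> k\<close> is the foot on height \<open>0\<close>. Since \<open>C\<close> is only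
  measurable, \<open>\<xi>\<close> is merely Lipschitz. Slopes run over all reals, with
  \<open>\<xi>\<close> constant outside \<open>{0..1}\<close>, so that the rays fill the whole upper
  half-plane.\<close>

locale rays =
  fixes C :: "real \<Rightarrow> real"
  assumes C_meas [measurable]: "C \<in> borel_measurable borel"
    and C_nonneg: "0 \<le> C k" and C_le: "C k \<le> 1/2"
    and C_supp: "k \<notin> {0<..1} \<Longrightarrow> C k = 0"
begin

definition \<xi> :: "real \<Rightarrow> real" where
  "\<xi> k = (\<integral>s. C s * indicator {0<..k} s \<partial>lborel)"

lemma integrable_C: "integrable lborel (\<lambda>s. C s * indicator {a<..b} s)"
proof (rule Bochner_Integration.integrable_bound[where f="\<lambda>s. indicator {a<..b} s :: real"])
  show "integrable lborel (\<lambda>s. indicator {a<..b} s :: real)"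
    using emeasure_lborel_Ioc_finite[of a b] by (intro integrable_real_indicator) auto
  show "AE x in lborel. norm (C x * indicator {a<..b} x) \<le> norm (indicat_real {a<..b} x)"
    using C_nonneg C_le by (intro AE_I2) (auto simp: indicator_def intro: order_trans[OF C_le])
qed measurable

lemma \<xi>_diff:
  assumes "a \<le> b"
  shows "\<xi> b - \<xi> a = (\<integral>s. C s * indicator {a<..b} s \<partial>lborel)"
proof -
  have "\<xi> b - \<xi> a = (\<integral>s. C s * indicator {0<..b} s - C s * indicator {0<..a} s \<partial>lborel)"
    unfolding \<xi>_def using integrable_C by (subst Bochner_Integration.integral_diff) auto
  also have "(\<lambda>s. C s * indicator {0<..b} s - C s * indicator {0<..a} s) = (\<lambda>s. C s * indicator {a<..b} s)"
    using assms C_supp by (auto simp: indicator_def fun_eq_iff)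
  finally show ?thesis .
qed

lemma nn_integral_C:
  assumes "a \<le> b"
  shows "(\<integral>\<^sup>+s. ennreal (C s * indicator {a<..b} s) \<partial>lborel) = ennreal (\<xi> b - \<xi> a)"
  unfolding \<xi>_diff[OF assms]
  by (rule nn_integral_eq_integral) (use integrable_C C_nonneg in auto)

lemma \<xi>_diff_bounds:
  assumes "a \<le> b"
  shows "0 \<le> \<xi> b - \<xi> a" "\<xi> b - \<xi> a \<le> (b - a) / 2"
proof -
  show "0 \<le> \<xi> b - \<xi> a" unfolding \<xi>_diff[OF assms]
    using C_nonneg by (intro Bochner_Integration.integral_nonneg) auto
  have i: "integrable lborel (\<lambda>s. (1/2) * indicator {a<..b} s :: real)"
    using emeasure_lborel_Ioc_finite[of a b]
    by (intro integrable_mult_right integrable_real_indicator) auto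
  have "\<xi> b - \<xi> a \<le> (\<integral>s. (1/2) * indicator {a<..b} s \<partial>lborel)" unfolding \<xi>_diff[OF assms]
    using C_le by (intro integral_mono integrable_C i) (auto simp: indicator_def)
  also have "\<dots> = (b - a) / 2" using assms by (simp add: measure_lborel_Ioc)
  finally show "\<xi> b - \<xi> a \<le> (b - a) / 2" .
qed

lemma \<xi>_mono: "a \<le> b \<Longrightarrow> \<xi> a \<le> \<xi> b"
  using \<xi>_diff_bounds(1) by fastforce

lemma \<xi>_0 [simp]: "\<xi> 0 = 0"
  by (simp add: \<xi>_def)

lemma \<xi>_bounds: "k \<in> {0..1} \<Longrightarrow> 0 \<le> \<xi> k \<and> \<xi> k \<le> 1/2"
  using \<xi>_diff_bounds[of 0 k] by auto

lemma \<xi>_cont: "continuous_on S \<xi>"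
proof -
  have "\<bar>\<xi> x - \<xi> y\<bar> \<le> 1 * \<bar>x - y\<bar>" for x y
    using \<xi>_diff_bounds[of x y] \<xi>_diff_bounds[of y x] by (cases "x \<le> y") auto
  then have "1-lipschitz_on S \<xi>"
    by (intro lipschitz_onI) (auto simp: dist_real_def)
  then show ?thesis by (rule lipschitz_on_continuous_on)
qed

lemma \<xi>_meas [measurable]: "\<xi> \<in> borel_measurable borel"
  by (rule borel_measurable_continuous_onI[OF \<xi>_cont])

text \<open>Both \<open>\<xi> k\<close> and \<open>k * y\<close> grow with \<open>k\<close>, the
  latter strictly, so distinct rays never meet above height \<open>0\<close>.\<close>

lemma ray_less_iff: "y > 0 \<Longrightarrow> \<xi> a + a * y < \<xi> b + b * y \<longleftrightarrow> a < b"
proof -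
  assume y: "y > 0"
  have "\<xi> a + a * y < \<xi> b + b * y" if "a < b" for a b
    using \<xi>_mono[of a b] that y by (simp add: add_le_less_mono)
  then show ?thesis by (metis less_asym linorder_neqE_linordered_idom)
qed

lemma ray_le_iff: "y > 0 \<Longrightarrow> \<xi> a + a * y \<le> \<xi> b + b * y \<longleftrightarrow> a \<le> b"
  using ray_less_iff by (meson linorder_not_less)

lemma ray_eq_iff: "y > 0 \<Longrightarrow> \<xi> a + a * y = \<xi> b + b * y \<longleftrightarrow> a = b"
  using ray_le_iff[of y a b] ray_le_iff[of y b a] unfolding order_eq_iff by simp

lemma ray_surj:
  assumes "y > 0" shows "\<exists>k. \<xi> k + k * y = x"
proof -
  \<comment> \<open>Since \<open>\<xi> 0 = 0\<close> and \<open>\<xi>\<close> is nondecreasing,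
    these two slopes already straddle \<open>x\<close> at height \<open>y\<close>.\<close>
  define k1 where "k1 = - \<bar>x\<bar> / y"
  define k2 where "k2 = \<bar>x\<bar> / y"
  have k: "k1 \<le> 0" "0 \<le> k2" using assms by (auto simp: k1_def k2_def)
  have "\<xi> k1 + k1 * y \<le> x" using \<xi>_mono[OF k(1)] assms by (simp add: k1_def)
  moreover have "x \<le> \<xi> k2 + k2 * y" using \<xi>_mono[OF k(2)] assms by (simp add: k2_def)
  moreover have "continuous_on {k1..k2} (\<lambda>k. \<xi> k + k * y)" by (intro continuous_intros \<xi>_cont)
  ultimately show ?thesis using IVT'[of "\<lambda>k. \<xi> k + k * y" k1 x k2] k by auto
qed

text \<open>The inverse of the ray map on the upper half-plane; the default \<open>0\<close>
  elsewhere keeps \<open>K\<close> a total Borel function.\<close>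

definition K :: "(nat \<Rightarrow> real) \<Rightarrow> real" where
  "K z = (if z 1 > 0 then THE k. \<xi> k + k * z 1 = z 0 else 0)"

definition Z :: "real \<Rightarrow> real \<Rightarrow> nat \<Rightarrow> real" where
  "Z k y = pt (\<xi> k + k * y) y"

lemma Z_simps [simp]: "Z k y 0 = \<xi> k + k * y" "Z k y (Suc 0) = y"
  by (simp_all add: Z_def)

lemma ray_K: "z 1 > 0 \<Longrightarrow> \<xi> (K z) + K z * z 1 = z 0"
proof -
  assume y: "z 1 > 0"
  obtain k where "\<xi> k + k * z 1 = z 0" using ray_surj[OF y] by blast
  then have "\<exists>!k. \<xi> k + k * z 1 = z 0" using ray_eq_iff[OF y] by metis
  from theI'[OF this] show ?thesis using y by (simp add: K_def)
qed

lemma K_Z [simp]: "y > 0 \<Longrightarrow> K (Z k y) = k"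
  using ray_K[of "Z k y"] ray_eq_iff[of y] by simp

lemma K_pt [simp]: "y > 0 \<Longrightarrow> K (pt (\<xi> k + k * y) y) = k"
  using K_Z[of y k] unfolding Z_def .

lemma Z_K: "y > 0 \<Longrightarrow> Z (K (pt x y)) y = pt x y"
  using ray_K[of "pt x y"] by (simp add: Z_def)

lemma K_le_iff: "z 1 > 0 \<Longrightarrow> K z \<le> k \<longleftrightarrow> z 0 \<le> \<xi> k + k * z 1"
  using ray_K[of z] ray_le_iff[of "z 1"] by metis

lemma K_less_iff: "z 1 > 0 \<Longrightarrow> K z < k \<longleftrightarrow> z 0 < \<xi> k + k * z 1"
  using ray_K[of z] ray_less_iff[of "z 1"] by metis

lemma K_meas [measurable]: "K \<in> borel_measurable borel"
proof (rule borel_measurableI_le)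
  fix a
  have "{z \<in> space borel. K z \<le> a} = {z. py z > 0 \<and> px z \<le> \<xi> a + a * py z} \<union> {z. py z \<le> 0 \<and> 0 \<le> a}"
    using K_le_iff unfolding px_def py_def by (auto simp: K_def)
  also have "\<dots> \<in> sets borel" by measurable
  finally show "{z \<in> space borel. K z \<le> a} \<in> sets borel" .
qed

lemma Z_meas [measurable]:
  assumes [measurable]: "f \<in> borel_measurable M" "g \<in> borel_measurable M"
  shows "(\<lambda>x. Z (f x) (g x)) \<in> borel_measurable M"
  unfolding Z_def by measurable

text \<open>Substitution \<open>x = \<xi> k + k * y\<close> without a continuous derivative: the
  pushforward of the density \<open>C k + y\<close> is compared with Lebesgue measure on open
  intervals only, where both sides are increments of \<open>\<xi> k + k * y\<close>.\<close>

lemma nn_integral_ray: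
  assumes y: "y > 0" and [measurable]: "h \<in> borel_measurable borel"
  shows "(\<integral>\<^sup>+x. h x \<partial>lborel) = (\<integral>\<^sup>+k. h (\<xi> k + k * y) * ennreal (C k + y) \<partial>lborel)"
proof -
  let ?D = "density lborel (\<lambda>k. ennreal (C k + y))"
  let ?M = "distr ?D borel (\<lambda>k. \<xi> k + k * y)"
  have "lborel = ?M"
  proof (rule lborel_eqI)
    fix l u :: real assume "\<And>b. b \<in> Basis \<Longrightarrow> l \<bullet> b \<le> u \<bullet> b"
    then have lu: "l \<le> u" by simp
    obtain a b where ab: "\<xi> a + a * y = l" "\<xi> b + b * y = u" using ray_surj[OF y] by metis
    have le: "a \<le> b" using lu ab ray_le_iff[OF y] by metis
    have pre: "(\<lambda>k. \<xi> k + k * y) -` {l<..<u} = {a<..<b}"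
      unfolding ab[symmetric] using ray_less_iff[OF y] by auto
    have "emeasure ?M (box l u) = emeasure ?D {a<..<b}"
      by (subst emeasure_distr) (auto simp: box_real pre)
    also have "\<dots> = (\<integral>\<^sup>+k. ennreal (C k + y) * indicator {a<..<b} k \<partial>lborel)"
      by (subst emeasure_density) auto
    also have "\<dots> = (\<integral>\<^sup>+k. ennreal (C k * indicator {a<..b} k) + ennreal y * indicator {a<..b} k \<partial>lborel)"
    proof (rule nn_integral_cong_AE)
      have "AE k in lborel. k \<noteq> b" by (rule AE_lborel_singleton)
      then show "AE k in lborel. ennreal (C k + y) * indicator {a<..<b} k = ennreal (C k * indicator {a<..b} k) + ennreal y * indicator {a<..b} k"
        by eventually_elim (use y C_nonneg in \<open>auto simp: indicator_def\<close>)
    qed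
    also have "\<dots> = ennreal (\<xi> b - \<xi> a) + ennreal y * ennreal (b - a)"
      using le by (subst nn_integral_add) (auto simp: nn_integral_C nn_integral_cmult)
    also have "\<dots> = ennreal (u - l)"
      using le y \<xi>_diff_bounds[OF le] by (simp add: ab[symmetric] ennreal_mult[symmetric] ennreal_plus[symmetric] algebra_simps del: ennreal_plus)
    finally show "emeasure ?M (box l u) = ennreal (\<Prod>b\<in>Basis. (u - l) \<bullet> b)" by simp
  qed simp
  then have "(\<integral>\<^sup>+x. h x \<partial>lborel) = (\<integral>\<^sup>+x. h x \<partial>?M)" by simp
  also have "\<dots> = (\<integral>\<^sup>+k. h (\<xi> k + k * y) \<partial>?D)" by (subst nn_integral_distr) auto
  also have "\<dots> = (\<integral>\<^sup>+k. h (\<xi> k + k * y) * ennreal (C k + y) \<partial>lborel)"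
    by (subst nn_integral_density) (auto simp: mult.commute)
  finally show ?thesis .
qed

lemma nn_integral_leb2_rays:
  assumes [measurable]: "h \<in> borel_measurable borel" and h: "\<And>z. z 1 \<le> 0 \<Longrightarrow> h z = 0"
  shows "(\<integral>\<^sup>+z. h z \<partial>leb 2) = (\<integral>\<^sup>+y. \<integral>\<^sup>+k. h (Z k y) * ennreal (C k + y) \<partial>lborel \<partial>lborel)"
  unfolding nn_integral_leb2[OF assms(1)]
proof (rule nn_integral_cong)
  fix y :: real
  show "(\<integral>\<^sup>+x. h (pt x y) \<partial>lborel) = (\<integral>\<^sup>+k. h (Z k y) * ennreal (C k + y) \<partial>lborel)"
  proof (cases "y > 0")
    case True
    show ?thesis unfolding Z_def by (rule nn_integral_ray[OF True, where h="\<lambda>x. h (pt x y)"]) measurable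
  next
    case False
    then show ?thesis using h[of "pt _ y"] h[of "Z _ y"] by simp
  qed
qed

text \<open>The correction that makes
  \<open>s \<mapsto> (s * x + y) / sqrt (1 + s\<^sup>2) - H s\<close> stationary exactly where
  \<open>x = \<xi> s + s * y\<close>, that is, at the slope of the ray through the point. Starting
  the integral at \<open>-1\<close> makes \<open>0\<close> an interior point, so that
  \<open>H\<close> has a two-sided derivative at all slopes \<open>s \<ge> 0\<close>.\<close>

definition H :: "real \<Rightarrow> real" where
  "H k = integral {-1..k} (\<lambda>s. \<xi> s / sqrt (1 + s\<^sup>2) ^ 3)"

definition potential :: "(nat \<Rightarrow> real) \<Rightarrow> real" where
  "potential z = (K z * z 0 + z 1) / sqrt (1 + (K z)\<^sup>2) - H (K z)"

lemma H_deriv: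
  assumes "-1 < k" shows "(H has_real_derivative \<xi> k / sqrt (1 + k\<^sup>2) ^ 3) (at k)"
proof -
  have "((\<lambda>k. integral {-1..k} (\<lambda>s. \<xi> s / sqrt (1 + s\<^sup>2) ^ 3)) has_real_derivative \<xi> k / sqrt (1 + k\<^sup>2) ^ 3) (at k within {-1..k+1})"
    by (rule integral_has_real_derivative)
       (use assms in \<open>auto intro!: continuous_intros \<xi>_cont simp: add_nonneg_eq_0_iff\<close>)
  then show ?thesis using assms unfolding H_def by (simp add: at_within_Icc_at)
qed

lemma envelope_deriv:
  assumes "-1 < s"
  shows "((\<lambda>s. (s * x + y) / sqrt (1 + s\<^sup>2) - H s) has_real_derivative (x - s * y - \<xi> s) / sqrt (1 + s\<^sup>2) ^ 3) (at s)"
proof -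
  have pos: "0 < 1 + s\<^sup>2" by (simp add: add_pos_nonneg)
  define r where "r = sqrt (1 + s\<^sup>2)"
  have r: "r > 0" "r\<^sup>2 = 1 + s\<^sup>2" using pos by (auto simp: r_def)
  have "((\<lambda>s. (s * x + y) / sqrt (1 + s\<^sup>2)) has_real_derivative (x * r - (s * x + y) * (s / r)) / (r * r)) (at s)"
    unfolding r_def using pos by (auto intro!: derivative_eq_intros simp: field_simps)
  also have "(x * r - (s * x + y) * (s / r)) / (r * r) = (x * r\<^sup>2 - (s * x + y) * s) / r ^ 3"
    using r(1) by (simp add: field_simps power2_eq_square power3_eq_cube)
  also have "\<dots> = (x - s * y) / r ^ 3" unfolding r(2) by (simp add: algebra_simps power2_eq_square)
  finally have "((\<lambda>s. (s * x + y) / sqrt (1 + s\<^sup>2) - H s) has_real_derivative (x - s * y) / r ^ 3 - \<xi> s / r ^ 3) (at s)"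
    using H_deriv[OF assms] unfolding r_def by (rule DERIV_diff)
  then show ?thesis by (simp add: r_def diff_divide_distrib)
qed

text \<open>\<open>potential\<close> is the upper envelope of affine functions with unit gradient \<open>(k, 1) / \<surd>(1 + k\<^sup>2)\<close>;
  along the ray of slope \<open>k\<close> the maximum is attained at \<open>k\<close>.\<close>

lemma potential_max:
  assumes z: "z 1 > 0" "0 \<le> K z" and k: "0 \<le> k"
  shows "(k * z 0 + z 1) / sqrt (1 + k\<^sup>2) - H k \<le> potential z"
proof -
  let ?g = "\<lambda>s. (s * z 0 + z 1) / sqrt (1 + s\<^sup>2) - H s"
  \<comment> \<open>Both summands have the sign of \<open>K z - s\<close>, since the height is
    positive and \<open>\<xi>\<close> is nondecreasing. The affine functions therefore increase in
    \<open>s\<close> up to \<open>K z\<close> and decrease afterwards.\<close>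
  have sgn: "z 0 - s * z 1 - \<xi> s = (K z - s) * z 1 + (\<xi> (K z) - \<xi> s)" for s
    using ray_K[of z, OF z(1)] by (simp add: algebra_simps)
  have "?g k \<le> ?g (K z)"
  proof (cases "k \<le> K z")
    case True
    show ?thesis
    proof (rule DERIV_nonneg_imp_nondecreasing[OF True])
      fix s assume s: "k \<le> s" "s \<le> K z"
      then have "0 \<le> z 0 - s * z 1 - \<xi> s" unfolding sgn using z \<xi>_mono[of s "K z"] by simp
      then show "\<exists>d. (?g has_real_derivative d) (at s) \<and> 0 \<le> d"
        using envelope_deriv[of s "z 0" "z 1"] s k by (intro exI conjI) (assumption | force)+
    qed
  next
    case False
    show ?thesis
    proof (rule DERIV_nonpos_imp_nonincreasing[of "K z" k])
      fix s assume s: "K z \<le> s" "s \<le> k"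
      then have "z 0 - s * z 1 - \<xi> s \<le> 0" unfolding sgn using z \<xi>_mono[of "K z" s]
        by (simp add: add_nonpos_nonpos mult_nonpos_nonneg)
      then show "\<exists>d. (?g has_real_derivative d) (at s) \<and> d \<le> 0"
        using envelope_deriv[of s "z 0" "z 1"] s z
        by (intro exI[of _ "(z 0 - s * z 1 - \<xi> s) / sqrt (1 + s\<^sup>2) ^ 3"] conjI divide_nonpos_nonneg) auto
    qed (use False in simp)
  qed
  then show ?thesis by (simp add: potential_def)
qed

text \<open>Bounding \<open>potential p\<close> from below by the affine function active at
  \<open>q\<close> reduces the claim to Cauchy-Schwarz for \<open>q - p\<close> and the direction of
  the ray through \<open>q\<close>. Equality makes the two parallel, so \<open>p\<close> lies on
  that ray; this rigidity later determines the pairs of every optimal plan.\<close>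

lemma potential_diff_le:
  assumes p: "p 1 > 0" "0 \<le> K p" and q: "q 1 > 0" "0 \<le> K q"
  shows "potential q - potential p \<le> edist 2 p q"
    and "potential q - potential p = edist 2 p q \<Longrightarrow> p 0 = \<xi> (K q) + K q * p 1"
proof -
  define k where "k = K q"
  define a b where "a = q 0 - p 0" and "b = q 1 - p 1"
  define r where "r = sqrt (1 + k\<^sup>2)"
  have r: "r > 0" "r\<^sup>2 = 1 + k\<^sup>2" by (auto simp: r_def add_pos_nonneg)
  have 1: "potential q - potential p \<le> (k * a + b) / r"
    using potential_max[OF p, of k] q(2) unfolding potential_def[of q] k_def[symmetric] r_def a_def b_def
    by (simp add: diff_divide_distrib add_divide_distrib algebra_simps)
  \<comment> \<open>Lagrange's identity; the last square is the defect in Cauchy-Schwarz.\<close>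
  have id: "r\<^sup>2 * (a\<^sup>2 + b\<^sup>2) = (k * a + b)\<^sup>2 + (a - k * b)\<^sup>2"
    unfolding r(2) by (simp add: power2_eq_square algebra_simps)
  have e: "edist 2 p q = sqrt (a\<^sup>2 + b\<^sup>2)"
    unfolding edist2 a_def b_def by (simp add: power2_commute)
  have re: "r * sqrt (a\<^sup>2 + b\<^sup>2) = sqrt ((k * a + b)\<^sup>2 + (a - k * b)\<^sup>2)"
    unfolding id[symmetric] using r(1) by (simp add: real_sqrt_mult)
  have "\<bar>k * a + b\<bar> \<le> sqrt ((k * a + b)\<^sup>2 + (a - k * b)\<^sup>2)" by (rule real_le_rsqrt) simp
  then have "k * a + b \<le> r * sqrt (a\<^sup>2 + b\<^sup>2)" unfolding re by linarith
  then have 2: "(k * a + b) / r \<le> edist 2 p q" unfolding e using r(1) by (simp add: field_simps)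
  show "potential q - potential p \<le> edist 2 p q" using 1 2 by linarith
  assume "potential q - potential p = edist 2 p q"
  then have "edist 2 p q = (k * a + b) / r" using 1 2 by linarith
  then have "k * a + b = r * sqrt (a\<^sup>2 + b\<^sup>2)" unfolding e using r(1) by (simp add: field_simps)
  then have "(k * a + b)\<^sup>2 = r\<^sup>2 * (a\<^sup>2 + b\<^sup>2)" by (simp add: power_mult_distrib)
  then have "a = k * b" unfolding id by simp
  then show "p 0 = \<xi> (K q) + K q * p 1"
    using ray_K[of q, OF q(1)] unfolding a_def b_def k_def by (simp add: algebra_simps)
qed

lemma edist_ray: "edist 2 (Z k s) (Z k t) = sqrt (1 + k\<^sup>2) * \<bar>t - s\<bar>"
proof -
  have "(\<xi> k + k * s - (\<xi> k + k * t))\<^sup>2 + (s - t)\<^sup>2 = (1 + k\<^sup>2) * (t - s)\<^sup>2"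
    by (simp add: power2_eq_square algebra_simps)
  then show ?thesis by (simp add: edist2 real_sqrt_mult)
qed

lemma potential_ray:
  assumes "s > 0" "t > 0"
  shows "potential (Z k t) - potential (Z k s) = sqrt (1 + k\<^sup>2) * (t - s)"
proof -
  define r where "r = sqrt (1 + k\<^sup>2)"
  have r: "r > 0" "r * r = 1 + k\<^sup>2" by (auto simp: r_def add_pos_nonneg)
  have p: "potential (Z k y) = (k * (\<xi> k + k * y) + y) / r - H k" if "y > 0" for y
    using that by (simp add: potential_def r_def)
  have "potential (Z k t) - potential (Z k s) = ((k * (\<xi> k + k * t) + t) - (k * (\<xi> k + k * s) + s)) / r"
    unfolding p[OF assms(1)] p[OF assms(2)] by (simp add: diff_divide_distrib)
  also have "\<dots> = (1 + k\<^sup>2) * (t - s) / r"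
    by (simp add: algebra_simps power2_eq_square)
  also have "\<dots> = r * (t - s)" unfolding r(2)[symmetric] using r(1) by simp
  finally show ?thesis unfolding r_def .
qed

lemma seg_point_ray: "seg_point (Z k s) (Z k t) u = Z k (s + u * (t - s))"
  by (auto simp: seg_point_def Z_def pt_def fun_eq_iff algebra_simps)

end

subsection \<open>Measures with a density on the box\<close>

lemma sets_borel_restrict_Box: "A \<in> sets (restrict_space borel Box) \<longleftrightarrow> A \<in> sets borel \<and> A \<subseteq> Box"
  by (auto simp: sets_restrict_space_iff)

lemma sets_fun_measure [simp]: "sets (fun_measure 2 Box f) = sets (restrict_space borel Box)"
  unfolding fun_measure_def by (simp add: sets_restrict_space cong: sets_restrict_space_cong)

lemma space_fun_measure [simp]: "space (fun_measure 2 Box f) = Box"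
  unfolding fun_measure_def by (simp add: space_restrict_space)

text \<open>With the indicator inside \<open>ennreal\<close>, measurability is asked only of the
  product with the indicator. This matters for an arbitrary transport density, about which nothing
  is known outside the interior.\<close>

lemma fun_measure_eq:
  "fun_measure 2 Box f = density (restrict_space (leb 2) Box) (\<lambda>z. ennreal (indicator (int_of 2 Box) z * f z))"
  unfolding fun_measure_def by (rule arg_cong2[where f=density]) (auto simp: indicator_def)

lemma measurable_restrict_leb2:
  "h \<in> borel_measurable (restrict_space borel Box) \<Longrightarrow> h \<in> borel_measurable (restrict_space (leb 2) Box)"
  using measurable_cong_sets[OF sets_restrict_space_cong[OF sets_leb] refl] by blast

lemma nn_integral_fun_measure:
  assumes f: "(\<lambda>z. indicator (int_of 2 Box) z * f z) \<in> borel_measurable borel"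
    and h: "h \<in> borel_measurable (restrict_space borel Box)"
  shows "(\<integral>\<^sup>+z. h z \<partial>fun_measure 2 Box f) = (\<integral>\<^sup>+z. ennreal (indicator (int_of 2 Box) z * f z) * h z \<partial>leb 2)"
proof -
  have [measurable]: "(\<lambda>z. indicator (int_of 2 Box) z * f z) \<in> borel_measurable (restrict_space (leb 2) Box)"
    using f by (intro measurable_restrict_leb2 measurable_restrict_space1)
  note [measurable] = measurable_restrict_leb2[OF h]
  have "(\<integral>\<^sup>+z. h z \<partial>fun_measure 2 Box f) = (\<integral>\<^sup>+z. ennreal (indicator (int_of 2 Box) z * f z) * h z \<partial>restrict_space (leb 2) Box)"
    unfolding fun_measure_eq by (subst nn_integral_density) auto
  also have "\<dots> = (\<integral>\<^sup>+z. ennreal (indicator (int_of 2 Box) z * f z) * h z * indicator Box z \<partial>leb 2)"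
    by (rule nn_integral_restrict_space) simp
  also have "\<dots> = (\<integral>\<^sup>+z. ennreal (indicator (int_of 2 Box) z * f z) * h z \<partial>leb 2)"
    using int_Box_subset by (intro nn_integral_cong) (auto simp: indicator_def)
  finally show ?thesis .
qed

lemma integral_fun_measure:
  fixes h :: "(nat \<Rightarrow> real) \<Rightarrow> real"
  assumes f: "(\<lambda>z. indicator (int_of 2 Box) z * f z) \<in> borel_measurable borel" and pos: "\<And>z. z \<in> int_of 2 Box \<Longrightarrow> 0 \<le> f z"
    and h: "h \<in> borel_measurable (restrict_space borel Box)"
  shows "(\<integral>z. h z \<partial>fun_measure 2 Box f) = (\<integral>z. indicator (int_of 2 Box) z * f z * h z \<partial>leb 2)"
proof -
  have [measurable]: "(\<lambda>z. indicator (int_of 2 Box) z * f z) \<in> borel_measurable (restrict_space (leb 2) Box)"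
    using f by (intro measurable_restrict_leb2 measurable_restrict_space1)
  note [measurable] = measurable_restrict_leb2[OF h]
  have "(\<integral>z. h z \<partial>fun_measure 2 Box f) = (\<integral>z. (indicator (int_of 2 Box) z * f z) *\<^sub>R h z \<partial>restrict_space (leb 2) Box)"
    unfolding fun_measure_eq
  proof (rule integral_density)
    show "AE z in restrict_space (leb 2) Box. 0 \<le> indicator (int_of 2 Box) z * f z"
      using pos by (intro AE_I2) (auto simp: indicator_def)
  qed measurable
  also have "\<dots> = (\<integral>z. indicator Box z *\<^sub>R ((indicator (int_of 2 Box) z * f z) *\<^sub>R h z) \<partial>leb 2)"
    by (subst integral_restrict_space) auto
  also have "\<dots> = (\<integral>z. indicator (int_of 2 Box) z * f z * h z \<partial>leb 2)"
    using int_Box_subset by (intro Bochner_Integration.integral_cong) (auto simp: indicator_def)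
  finally show ?thesis .
qed

lemma AE_fun_measure:
  assumes f: "(\<lambda>z. indicator (int_of 2 Box) z * f z) \<in> borel_measurable borel"
    and P: "\<And>z. z \<in> Box \<Longrightarrow> f z > 0 \<Longrightarrow> P z"
  shows "AE z in fun_measure 2 Box f. P z"
proof -
  have [measurable]: "(\<lambda>z. indicator (int_of 2 Box) z * f z) \<in> borel_measurable (restrict_space (leb 2) Box)"
    using f by (intro measurable_restrict_leb2 measurable_restrict_space1)
  have "AE z in restrict_space (leb 2) Box. 0 < ennreal (indicator (int_of 2 Box) z * f z) \<longrightarrow> P z"
    using P int_Box_subset by (intro AE_I2) (auto simp: indicator_def space_restrict_space split: if_splits)
  then show ?thesis unfolding fun_measure_eq by (subst AE_density) auto
qed

lemma continuous_on_Box_restrict: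
  fixes f :: "(nat \<Rightarrow> real) \<Rightarrow> real"
  shows "continuous_on Box f \<Longrightarrow> f \<in> borel_measurable (restrict_space borel Box)"
  by (rule borel_measurable_continuous_on_restrict)

lemma fst_borel [measurable]: "fst \<in> borel_measurable (borel :: (('a::topological_space \<times> 'b::topological_space) measure))"
  by (intro borel_measurable_continuous_onI continuous_intros)

lemma snd_borel [measurable]: "snd \<in> borel_measurable (borel :: (('a::topological_space \<times> 'b::topological_space) measure))"
  by (intro borel_measurable_continuous_onI continuous_intros)

abbreviation BB where "BB \<equiv> restrict_space borel (Box \<times> Box)"

lemma BoxBox_sets [measurable]: "Box \<times> Box \<in> sets borel"
  using compact_Box by (intro borel_closed closed_Times compact_imp_closed)

lemma fst_BB [measurable]: "fst \<in> BB \<rightarrow>\<^sub>M restrict_space borel Box"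
  by (rule measurable_restrict_space3) (auto simp: fst_borel)

lemma snd_BB [measurable]: "snd \<in> BB \<rightarrow>\<^sub>M restrict_space borel Box"
  by (rule measurable_restrict_space3) (auto simp: snd_borel)

lemma transport_planD:
  assumes "transport_plan 2 Box f g \<gamma>"
  shows "sets \<gamma> = sets BB" "space \<gamma> = Box \<times> Box"
    "distr \<gamma> (restrict_space borel Box) fst = fun_measure 2 Box f"
    "distr \<gamma> (restrict_space borel Box) snd = fun_measure 2 Box g"
    "fst \<in> \<gamma> \<rightarrow>\<^sub>M restrict_space borel Box" "snd \<in> \<gamma> \<rightarrow>\<^sub>M restrict_space borel Box"
proof -
  show s: "sets \<gamma> = sets BB" using assms unfolding transport_plan_def by simp
  show "space \<gamma> = Box \<times> Box" using sets_eq_imp_space_eq[OF s] by (simp add: space_restrict_space)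
  show "distr \<gamma> (restrict_space borel Box) fst = fun_measure 2 Box f"
    "distr \<gamma> (restrict_space borel Box) snd = fun_measure 2 Box g"
    using assms unfolding transport_plan_def by auto
  show "fst \<in> \<gamma> \<rightarrow>\<^sub>M restrict_space borel Box" "snd \<in> \<gamma> \<rightarrow>\<^sub>M restrict_space borel Box"
    using fst_BB snd_BB measurable_cong_sets[OF s refl] by blast+
qed

lemma transport_plan_AE:
  assumes T: "transport_plan 2 Box f g \<gamma>"
  shows "{z \<in> Box. P z} \<in> sets borel \<Longrightarrow> AE z in fun_measure 2 Box f. P z \<Longrightarrow> AE p in \<gamma>. P (fst p)"
    and "{z \<in> Box. P z} \<in> sets borel \<Longrightarrow> AE z in fun_measure 2 Box g. P z \<Longrightarrow> AE p in \<gamma>. P (snd p)"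
proof -
  have s: "{z \<in> space (restrict_space borel Box). P z} \<in> sets (restrict_space borel Box)" if "{z \<in> Box. P z} \<in> sets borel"
    using that by (auto simp: sets_borel_restrict_Box space_restrict_space)
  show "{z \<in> Box. P z} \<in> sets borel \<Longrightarrow> AE z in fun_measure 2 Box f. P z \<Longrightarrow> AE p in \<gamma>. P (fst p)"
    unfolding transport_planD(3)[OF T, symmetric] using AE_distr_iff[OF transport_planD(5)[OF T] s] by blast
  show "{z \<in> Box. P z} \<in> sets borel \<Longrightarrow> AE z in fun_measure 2 Box g. P z \<Longrightarrow> AE p in \<gamma>. P (snd p)"
    unfolding transport_planD(4)[OF T, symmetric] using AE_distr_iff[OF transport_planD(6)[OF T] s] by blast
qed

lemma edist2_xy: "edist 2 p q = sqrt ((px p - px q)\<^sup>2 + (py p - py q)\<^sup>2)"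
  unfolding px_def py_def by (rule edist2)

lemma edist_meas [measurable]: "(\<lambda>p. edist 2 (fst p) (snd p)) \<in> borel_measurable borel"
  unfolding edist2_xy by measurable

lemma edist_nonneg: "0 \<le> edist 2 p q"
  unfolding edist2 by simp

lemma edist_Box_le: "p \<in> Box \<Longrightarrow> q \<in> Box \<Longrightarrow> edist 2 p q \<le> 10"
proof -
  assume "p \<in> Box" "q \<in> Box"
  then have "\<bar>p 0 - q 0\<bar> \<le> 5" "\<bar>p 1 - q 1\<bar> \<le> 5" by (auto simp: Box_def)
  moreover have "edist 2 p q \<le> \<bar>p 0 - q 0\<bar> + \<bar>p 1 - q 1\<bar>"
    unfolding edist2 by (rule sqrt_sum_squares_le_sum_abs)
  ultimately show ?thesis by linarith
qed

lemma nn_integral_lborel3: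
  fixes f :: "real \<times> real \<times> real \<Rightarrow> ennreal"
  assumes [measurable]: "f \<in> borel_measurable (lborel \<Otimes>\<^sub>M (lborel \<Otimes>\<^sub>M lborel))"
  shows "(\<integral>\<^sup>+x. f x \<partial>(lborel \<Otimes>\<^sub>M (lborel \<Otimes>\<^sub>M lborel))) = (\<integral>\<^sup>+k. \<integral>\<^sup>+s. \<integral>\<^sup>+t. f (k, s, t) \<partial>lborel \<partial>lborel \<partial>lborel)"
proof -
  have [measurable]: "f \<in> borel_measurable (lborel \<Otimes>\<^sub>M lborel)"
    using assms unfolding lborel_prod .
  have "(\<integral>\<^sup>+x. f x \<partial>(lborel \<Otimes>\<^sub>M (lborel \<Otimes>\<^sub>M lborel))) = (\<integral>\<^sup>+k. \<integral>\<^sup>+st. f (k, st) \<partial>(lborel \<Otimes>\<^sub>M lborel) \<partial>lborel)"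
    unfolding lborel_prod[where 'a=real and 'b=real] by (rule lborel.nn_integral_fst[symmetric]) simp
  also have "\<dots> = (\<integral>\<^sup>+k. \<integral>\<^sup>+s. \<integral>\<^sup>+t. f (k, s, t) \<partial>lborel \<partial>lborel \<partial>lborel)"
    by (intro nn_integral_cong lborel.nn_integral_fst[symmetric]) simp
  finally show ?thesis .
qed

subsection \<open>An optimal plan along rays\<close>

text \<open>\<open>\<tau> k\<close> is the height of the source layer on the ray of slope \<open>k\<close>, \<open>m k\<close> the mass it contains per
  unit of \<open>k\<close>, and \<open>b k\<close> the constant target density on \<open>1 < y < 2\<close> that balances this mass.\<close>

locale transport_rays = rays +
  fixes \<tau> :: "real \<Rightarrow> real"
  assumes \<tau>_meas [measurable]: "\<tau> \<in> borel_measurable borel"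
    and \<tau>_pos: "k \<in> {0<..1} \<Longrightarrow> 0 < \<tau> k" and \<tau>_le: "\<tau> k \<le> 1"
begin

definition m :: "real \<Rightarrow> real" where "m k = C k * \<tau> k + (\<tau> k)\<^sup>2 / 2"
definition b :: "real \<Rightarrow> real" where "b k = m k / (C k + 3/2)"

definition Rp :: "(nat \<Rightarrow> real) set" where
  "Rp = {z \<in> RR 2. 0 < py z \<and> 0 < K z \<and> K z \<le> 1 \<and> py z < \<tau> (K z)}"

definition Rm :: "(nat \<Rightarrow> real) set" where
  "Rm = {z \<in> RR 2. 1 < py z \<and> py z < 2 \<and> 0 < K z \<and> K z \<le> 1}"

definition fp :: "(nat \<Rightarrow> real) \<Rightarrow> real" where "fp z = indicator Rp z"
definition fm :: "(nat \<Rightarrow> real) \<Rightarrow> real" where "fm z = b (K z) * indicator Rm z"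

lemma m_meas [measurable]: "m \<in> borel_measurable borel" unfolding m_def[abs_def] by measurable
lemma b_meas [measurable]: "b \<in> borel_measurable borel" unfolding b_def[abs_def] by measurable

lemma Rp_sets [measurable]: "Rp \<in> sets borel" unfolding Rp_def by measurable
lemma Rm_sets [measurable]: "Rm \<in> sets borel" unfolding Rm_def by measurable
lemma fp_meas [measurable]: "fp \<in> borel_measurable borel" unfolding fp_def[abs_def] by measurable
lemma fm_meas [measurable]: "fm \<in> borel_measurable borel" unfolding fm_def[abs_def] by measurable

lemma m_pos: "k \<in> {0<..1} \<Longrightarrow> 0 < m k"
  using \<tau>_pos[of k] C_nonneg[of k] by (simp add: m_def add_nonneg_pos)

lemma b_pos: "k \<in> {0<..1} \<Longrightarrow> 0 < b k"
  using m_pos[of k] C_nonneg[of k] by (simp add: b_def)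

lemma Z_Box0: "k \<in> {0..1} \<Longrightarrow> 0 \<le> y \<Longrightarrow> y \<le> 2 \<Longrightarrow> Z k y \<in> Box0"
proof -
  assume k: "k \<in> {0..1}" and y: "0 \<le> y" "y \<le> 2"
  have "0 \<le> k * y" "k * y \<le> 1 * 2" using k y by (simp, intro mult_mono) auto
  then show ?thesis using \<xi>_bounds[OF k] y by (simp add: Z_def)
qed

lemma K_Box0:
  assumes "z \<in> RR 2" "0 < py z" "py z \<le> 2" "0 \<le> K z" "K z \<le> 1"
  shows "z \<in> Box0" "z = Z (K z) (py z)"
proof -
  have z: "z = pt (px z) (py z)" using assms(1) RR2_iff[of z] by (simp add: px_def py_def)
  then show *: "z = Z (K z) (py z)" using Z_K[OF assms(2), of "px z"] by simp
  show "z \<in> Box0" by (subst *) (use assms in \<open>intro Z_Box0, auto\<close>)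
qed

lemma Rp_Box0: "Rp \<subseteq> Box0"
proof
  fix z assume "z \<in> Rp"
  then show "z \<in> Box0" using \<tau>_le[of "K z"] by (intro K_Box0) (auto simp: Rp_def)
qed

lemma Rm_Box0: "Rm \<subseteq> Box0"
  by (auto simp: Rm_def intro: K_Box0)

lemma Box0_int_ind: "(\<And>z. z \<notin> Box0 \<Longrightarrow> f z = 0) \<Longrightarrow> indicator (int_of 2 Box) z * f z = (f z :: real)"
  using Box0_int by (cases "z \<in> int_of 2 Box") auto

lemma fp_int [simp]: "indicator (int_of 2 Box) z * fp z = fp z"
  by (rule Box0_int_ind) (use Rp_Box0 in \<open>auto simp: fp_def indicator_def\<close>)

lemma fm_int [simp]: "indicator (int_of 2 Box) z * fm z = fm z"
  by (rule Box0_int_ind) (use Rm_Box0 in \<open>auto simp: fm_def indicator_def\<close>)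

lemma fp_nonneg: "0 \<le> fp z" by (simp add: fp_def)
lemma fm_nonneg: "0 \<le> fm z"
  using b_pos[of "K z"] by (auto simp: fm_def Rm_def indicator_def)

text \<open>Given the ray, source and target points are coupled independently.\<close>

definition plan_density :: "real \<Rightarrow> real \<Rightarrow> real \<Rightarrow> real" where
  "plan_density k s t = (if 0 < k \<and> k \<le> 1 \<and> 0 < s \<and> s < \<tau> k \<and> 1 < t \<and> t < 2 then (C k + s) * (C k + t) / (C k + 3/2) else 0)"

lemma plan_density_meas [measurable]:
  assumes [measurable]: "f \<in> borel_measurable M" "g \<in> borel_measurable M" "h \<in> borel_measurable M"
  shows "(\<lambda>x. plan_density (f x) (g x) (h x)) \<in> borel_measurable M"
  unfolding plan_density_def by measurable

lemma plan_density_nonneg: "0 \<le> plan_density k s t"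
  using C_nonneg[of k] by (auto simp: plan_density_def)

text \<open>\<open>distr\<close> into a restricted space needs a map with values in \<open>Box \<times> Box\<close> everywhere, not only
  where the density is positive.\<close>

definition clamp2 :: "(nat \<Rightarrow> real) \<times> (nat \<Rightarrow> real) \<Rightarrow> (nat \<Rightarrow> real) \<times> (nat \<Rightarrow> real)" where
  "clamp2 p = (if p \<in> Box \<times> Box then p else (pt 0 0, pt 0 0))"

lemma clamp2_meas: "clamp2 \<in> borel \<rightarrow>\<^sub>M BB"
  by (rule measurable_restrict_space2) (auto simp: clamp2_def[abs_def] intro!: measurable_If_set)

definition \<gamma>0 :: "((nat \<Rightarrow> real) \<times> (nat \<Rightarrow> real)) measure" where
  "\<gamma>0 = distr (density (lborel \<Otimes>\<^sub>M (lborel \<Otimes>\<^sub>M lborel)) (\<lambda>(k, s, t). ennreal (plan_density k s t))) BB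
     (\<lambda>(k, s, t). clamp2 (Z k s, Z k t))"

lemma sets_\<gamma>0 [simp]: "sets \<gamma>0 = sets BB" by (simp add: \<gamma>0_def)

lemma ZZ_meas: "(\<lambda>(k, s, t). (Z k s, Z k t)) \<in> borel_measurable (lborel \<Otimes>\<^sub>M (lborel \<Otimes>\<^sub>M lborel))"
  unfolding case_prod_beta' by measurable

lemma clamp2_ZZ_meas [measurable]: "(\<lambda>(k, s, t). clamp2 (Z k s, Z k t)) \<in> (lborel \<Otimes>\<^sub>M (lborel \<Otimes>\<^sub>M lborel)) \<rightarrow>\<^sub>M BB"
  using measurable_compose[OF ZZ_meas clamp2_meas] by (simp add: case_prod_beta')

lemma plan_density_Z: "plan_density k s t \<noteq> 0 \<Longrightarrow> k \<in> {0<..1} \<and> s \<in> {0<..<\<tau> k} \<and> t \<in> {1<..<2} \<and> clamp2 (Z k s, Z k t) = (Z k s, Z k t)"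
proof -
  assume "plan_density k s t \<noteq> 0"
  then have *: "k \<in> {0<..1}" "s \<in> {0<..<\<tau> k}" "t \<in> {1<..<2}" by (auto simp: plan_density_def split: if_splits)
  then have "Z k s \<in> Box" "Z k t \<in> Box"
    using Z_Box0[of k s] Z_Box0[of k t] \<tau>_le[of k] Box0_int int_Box_subset by auto
  then show ?thesis using * by (simp add: clamp2_def)
qed

lemma nn_integral_\<gamma>0:
  assumes h: "h \<in> borel_measurable BB"
  shows "(\<integral>\<^sup>+p. h p \<partial>\<gamma>0) = (\<integral>\<^sup>+k. \<integral>\<^sup>+s. \<integral>\<^sup>+t. ennreal (plan_density k s t) * h (clamp2 (Z k s, Z k t)) \<partial>lborel \<partial>lborel \<partial>lborel)"
proof -
  let ?B = "lborel \<Otimes>\<^sub>M (lborel \<Otimes>\<^sub>M lborel) :: (real \<times> real \<times> real) measure"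
  note [measurable] = measurable_compose[OF clamp2_ZZ_meas h, unfolded case_prod_beta']
  have "(\<integral>\<^sup>+p. h p \<partial>\<gamma>0) = (\<integral>\<^sup>+x. ennreal (plan_density (fst x) (fst (snd x)) (snd (snd x))) * h (clamp2 (Z (fst x) (fst (snd x)), Z (fst x) (snd (snd x)))) \<partial>?B)"
    unfolding \<gamma>0_def using h by (subst nn_integral_distr, simp, simp) (subst nn_integral_density; simp add: case_prod_beta')
  also have "\<dots> = (\<integral>\<^sup>+k. \<integral>\<^sup>+s. \<integral>\<^sup>+t. ennreal (plan_density k s t) * h (clamp2 (Z k s, Z k t)) \<partial>lborel \<partial>lborel \<partial>lborel)"
    by (subst nn_integral_lborel3) (simp_all)
  finally show ?thesis .
qed

end

lemma nn_integral_linear_Ioo: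
  fixes a b c :: real
  assumes "0 \<le> c" "0 \<le> a" "a \<le> b"
  shows "(\<integral>\<^sup>+s. ennreal (if a < s \<and> s < b then c + s else 0) \<partial>lborel) = ennreal (c * (b - a) + (b\<^sup>2 - a\<^sup>2) / 2)"
proof -
  have "(\<integral>\<^sup>+s. ennreal (if a < s \<and> s < b then c + s else 0) \<partial>lborel) = (\<integral>\<^sup>+s. ennreal (c + s) * indicator {a..b} s \<partial>lborel)"
  proof (rule nn_integral_cong_AE)
    have "AE s in lborel. s \<noteq> a" "AE s in lborel. s \<noteq> b" by (auto intro: AE_lborel_singleton)
    then show "AE s in lborel. ennreal (if a < s \<and> s < b then c + s else 0) = ennreal (c + s) * indicator {a..b} s"
      by eventually_elim (auto simp: indicator_def)
  qed
  also have "\<dots> = ennreal ((c * b + b\<^sup>2 / 2) - (c * a + a\<^sup>2 / 2))"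
    by (rule nn_integral_FTC_Icc[where F="\<lambda>s. c * s + s\<^sup>2 / 2"])
       (use assms in \<open>auto intro!: derivative_eq_intros\<close>)
  also have "(c * b + b\<^sup>2 / 2) - (c * a + a\<^sup>2 / 2) = c * (b - a) + (b\<^sup>2 - a\<^sup>2) / 2"
    by (simp add: algebra_simps diff_divide_distrib)
  finally show ?thesis .
qed

context transport_rays
begin

definition source_flux :: "real \<Rightarrow> real \<Rightarrow> real" where
  "source_flux k s = (if 0 < k \<and> k \<le> 1 \<and> 0 < s \<and> s < \<tau> k then C k + s else 0)"

text \<open>The law of the target height on a given ray. The normaliser \<open>C k + 3/2\<close> is
  the integral of the area element \<open>C k + t\<close> over \<open>1 < t < 2\<close>.\<close>

definition q :: "real \<Rightarrow> real \<Rightarrow> real" where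
  "q k t = (if 0 < k \<and> k \<le> 1 \<and> 1 < t \<and> t < 2 then (C k + t) / (C k + 3/2) else 0)"

lemma source_flux_meas [measurable]:
  assumes [measurable]: "f \<in> borel_measurable M" "g \<in> borel_measurable M"
  shows "(\<lambda>x. source_flux (f x) (g x)) \<in> borel_measurable M"
  unfolding source_flux_def by measurable

lemma q_meas [measurable]:
  assumes [measurable]: "f \<in> borel_measurable M" "g \<in> borel_measurable M"
  shows "(\<lambda>x. q (f x) (g x)) \<in> borel_measurable M"
  unfolding q_def by measurable

lemma source_flux_nonneg: "0 \<le> source_flux k s" using C_nonneg[of k] by (simp add: source_flux_def)
lemma q_nonneg: "0 \<le> q k t" using C_nonneg[of k] by (simp add: q_def)

lemma plan_density_eq: "plan_density k s t = source_flux k s * q k t"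
  by (simp add: plan_density_def source_flux_def q_def)

lemma nn_integral_source_flux: "k \<in> {0<..1} \<Longrightarrow> (\<integral>\<^sup>+s. ennreal (source_flux k s) \<partial>lborel) = ennreal (m k)"
  using nn_integral_linear_Ioo[of "C k" 0 "\<tau> k"] C_nonneg[of k] \<tau>_pos[of k]
  by (simp add: source_flux_def m_def)

lemma nn_integral_q_gt:
  assumes k: "k \<in> {0<..1}" and a: "1 \<le> a" "a \<le> 2"
  shows "(\<integral>\<^sup>+t. ennreal (if a < t then q k t else 0) \<partial>lborel) = ennreal ((C k * (2 - a) + (4 - a\<^sup>2) / 2) / (C k + 3/2))"
proof -
  define c where "c = 1 / (C k + 3/2)"
  have c: "0 \<le> c" using C_nonneg[of k] by (simp add: c_def)
  have "(\<integral>\<^sup>+t. ennreal (if a < t then q k t else 0) \<partial>lborel)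
     = (\<integral>\<^sup>+t. ennreal c * ennreal (if a < t \<and> t < 2 then C k + t else 0) \<partial>lborel)"
  proof (intro nn_integral_cong)
    fix t :: real
    have *: "q k t = c * (if 1 < t \<and> t < 2 then C k + t else 0)"
      using k by (simp add: q_def c_def)
    show "ennreal (if a < t then q k t else 0) = ennreal c * ennreal (if a < t \<and> t < 2 then C k + t else 0)"
      unfolding ennreal_mult'[OF c, symmetric] * using a by simp
  qed
  also have "\<dots> = ennreal c * ennreal (C k * (2 - a) + (2\<^sup>2 - a\<^sup>2) / 2)"
    using a C_nonneg[of k] nn_integral_linear_Ioo[of "C k" a 2] by (subst nn_integral_cmult) auto
  also have "\<dots> = ennreal (c * (C k * (2 - a) + (4 - a\<^sup>2) / 2))"
    using c by (simp add: ennreal_mult')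
  finally show ?thesis by (simp add: c_def)
qed

lemma nn_integral_q: "k \<in> {0<..1} \<Longrightarrow> (\<integral>\<^sup>+t. ennreal (q k t) \<partial>lborel) = 1"
proof -
  assume k: "k \<in> {0<..1}"
  have "(\<integral>\<^sup>+t. ennreal (q k t) \<partial>lborel) = (\<integral>\<^sup>+t. ennreal (if 1 < t then q k t else 0) \<partial>lborel)"
    by (intro nn_integral_cong) (simp add: q_def)
  also have "\<dots> = 1" using nn_integral_q_gt[OF k, of 1] C_nonneg[of k] by simp
  finally show ?thesis .
qed

lemma fp_ray: "y > 0 \<Longrightarrow> fp (Z k y) * (C k + y) = source_flux k y"
  by (auto simp: fp_def source_flux_def Rp_def indicator_def) (auto simp: Z_def)

lemma fm_ray: "y > 0 \<Longrightarrow> fm (Z k y) * (C k + y) = m k * q k y"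
  by (auto simp: fm_def q_def Rm_def indicator_def b_def) (auto simp: Z_def)

lemma fp_y: "z 1 \<le> 0 \<Longrightarrow> fp z = 0" by (simp add: fp_def Rp_def py_def)
lemma fm_y: "z 1 \<le> 0 \<Longrightarrow> fm z = 0" by (simp add: fm_def Rm_def py_def)

lemma source_flux_y: "y \<le> 0 \<Longrightarrow> source_flux k y = 0" by (simp add: source_flux_def)
lemma q_y: "y \<le> 0 \<Longrightarrow> q k y = 0" by (simp add: q_def)

lemma plan_density_clamp: "ennreal (plan_density k s t) * h (clamp2 (Z k s, Z k t)) = ennreal (plan_density k s t) * h (Z k s, Z k t)"
  using plan_density_Z[of k s t] by (cases "plan_density k s t = 0") auto

text \<open>In ray coordinates \<open>f dx\<close> has the density
  \<open>f (Z k y) * (C k + y)\<close>. The integrals are then swapped so that the slope is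
  outermost, as it is in the plan; both marginals of the plan are identified in this form.\<close>

lemma emeasure_ray_density:
  assumes f [measurable]: "f \<in> borel_measurable borel" and f0: "\<And>z. 0 \<le> f z" "\<And>z. z 1 \<le> 0 \<Longrightarrow> f z = 0"
    and fi: "\<And>z. indicator (int_of 2 Box) z * f z = f z"
    and h [measurable]: "(\<lambda>x. h (fst x) (snd x)) \<in> borel_measurable (lborel \<Otimes>\<^sub>M lborel)"
    and fh: "\<And>k y. 0 < y \<Longrightarrow> f (Z k y) * (C k + y) = h k y" "\<And>k y. y \<le> 0 \<Longrightarrow> h k y = 0"
    and A [measurable]: "A \<in> sets borel" and AB: "A \<subseteq> Box"
  shows "emeasure (fun_measure 2 Box f) A = (\<integral>\<^sup>+k. \<integral>\<^sup>+y. ennreal (h k y) * indicator A (Z k y) \<partial>lborel \<partial>lborel)"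
proof -
  have "A \<in> sets (fun_measure 2 Box f)" using A AB by (simp add: sets_borel_restrict_Box)
  then have "emeasure (fun_measure 2 Box f) A = (\<integral>\<^sup>+z. indicator A z \<partial>fun_measure 2 Box f)" by simp
  also have "\<dots> = (\<integral>\<^sup>+z. ennreal (f z) * indicator A z \<partial>leb 2)"
    by (subst nn_integral_fun_measure) (auto simp: fi intro: measurable_restrict_space1)
  also have "\<dots> = (\<integral>\<^sup>+y. \<integral>\<^sup>+k. ennreal (f (Z k y)) * indicator A (Z k y) * ennreal (C k + y) \<partial>lborel \<partial>lborel)"
    by (subst nn_integral_leb2_rays) (auto simp: f0)
  also have "\<dots> = (\<integral>\<^sup>+y. \<integral>\<^sup>+k. ennreal (h k y) * indicator A (Z k y) \<partial>lborel \<partial>lborel)"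
  proof (intro nn_integral_cong)
    fix y k :: real
    show "ennreal (f (Z k y)) * indicator A (Z k y) * ennreal (C k + y) = ennreal (h k y) * indicator A (Z k y)"
    proof (cases "y > 0")
      case True
      then show ?thesis using C_nonneg[of k] f0(1)
        by (simp add: fh(1)[symmetric] ennreal_mult mult_ac)
    qed (simp add: f0 fh(2))
  qed
  also have "\<dots> = (\<integral>\<^sup>+k. \<integral>\<^sup>+y. ennreal (h k y) * indicator A (Z k y) \<partial>lborel \<partial>lborel)"
    by (rule lborel_pair.Fubini') measurable
  finally show ?thesis .
qed

lemma emeasure_distr_\<gamma>0:
  assumes f: "f \<in> BB \<rightarrow>\<^sub>M restrict_space borel Box" and A: "A \<in> sets (restrict_space borel Box)"
  shows "emeasure (distr \<gamma>0 (restrict_space borel Box) f) A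
    = (\<integral>\<^sup>+k. \<integral>\<^sup>+s. \<integral>\<^sup>+t. ennreal (plan_density k s t) * indicator A (f (Z k s, Z k t)) \<partial>lborel \<partial>lborel \<partial>lborel)"
proof -
  have mf: "f \<in> \<gamma>0 \<rightarrow>\<^sub>M restrict_space borel Box" using f by (simp cong: measurable_cong_sets)
  have mi: "indicator A \<in> borel_measurable (restrict_space borel Box)" using A by simp
  have "emeasure (distr \<gamma>0 (restrict_space borel Box) f) A = (\<integral>\<^sup>+z. indicator A z \<partial>distr \<gamma>0 (restrict_space borel Box) f)"
    using A by simp
  also have "\<dots> = (\<integral>\<^sup>+p. indicator A (f p) \<partial>\<gamma>0)" by (rule nn_integral_distr[OF mf]) (use mi in simp)
  also have "\<dots> = (\<integral>\<^sup>+k. \<integral>\<^sup>+s. \<integral>\<^sup>+t. ennreal (plan_density k s t) * indicator A (f (Z k s, Z k t)) \<partial>lborel \<partial>lborel \<partial>lborel)"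
    using measurable_compose[OF f mi] by (subst nn_integral_\<gamma>0) (simp_all add: plan_density_clamp[where h="\<lambda>p. indicator A (f p)"])
  finally show ?thesis .
qed

text \<open>The plan density factors into \<open>source_flux k s\<close> and the probability density
  \<open>q k t\<close>; integrating out \<open>t\<close> leaves the source in ray
  coordinates.\<close>

lemma \<gamma>0_fst: "distr \<gamma>0 (restrict_space borel Box) fst = fun_measure 2 Box fp"
proof (rule measure_eqI)
  fix A assume A': "A \<in> sets (distr \<gamma>0 (restrict_space borel Box) fst)"
  then have A: "A \<in> sets (restrict_space borel Box)" by simp
  then have [measurable]: "A \<in> sets borel" and AB: "A \<subseteq> Box" by (auto simp: sets_borel_restrict_Box)
  have "emeasure (distr \<gamma>0 (restrict_space borel Box) fst) A = (\<integral>\<^sup>+k. \<integral>\<^sup>+s. \<integral>\<^sup>+t. ennreal (plan_density k s t) * indicator A (Z k s) \<partial>lborel \<partial>lborel \<partial>lborel)"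
    using emeasure_distr_\<gamma>0[OF fst_BB A] by simp
  also have "\<dots> = (\<integral>\<^sup>+k. \<integral>\<^sup>+s. ennreal (source_flux k s) * indicator A (Z k s) \<partial>lborel \<partial>lborel)"
  proof (intro nn_integral_cong)
    fix k s :: real
    have "(\<integral>\<^sup>+t. ennreal (plan_density k s t) * indicator A (Z k s) \<partial>lborel) = (\<integral>\<^sup>+t. (ennreal (source_flux k s) * indicator A (Z k s)) * ennreal (q k t) \<partial>lborel)"
      by (intro nn_integral_cong) (simp add: plan_density_eq ennreal_mult source_flux_nonneg q_nonneg mult_ac)
    also have "\<dots> = (ennreal (source_flux k s) * indicator A (Z k s)) * (\<integral>\<^sup>+t. ennreal (q k t) \<partial>lborel)"
      by (rule nn_integral_cmult) measurable
    also have "\<dots> = ennreal (source_flux k s) * indicator A (Z k s)"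
      using nn_integral_q[of k] by (cases "k \<in> {0<..1}") (auto simp: source_flux_def)
    finally show "(\<integral>\<^sup>+t. ennreal (plan_density k s t) * indicator A (Z k s) \<partial>lborel) = ennreal (source_flux k s) * indicator A (Z k s)" .
  qed
  also have "\<dots> = emeasure (fun_measure 2 Box fp) A"
    using AB by (intro emeasure_ray_density[symmetric] fp_meas fp_nonneg fp_y fp_int fp_ray source_flux_y) measurable
  finally show "emeasure (distr \<gamma>0 (restrict_space borel Box) fst) A = emeasure (fun_measure 2 Box fp) A" .
qed simp

text \<open>Integrating out \<open>s\<close> leaves the mass \<open>m k\<close> times
  \<open>q k t\<close>, and \<open>b\<close> is chosen so that this is the target in ray
  coordinates.\<close>

lemma \<gamma>0_snd: "distr \<gamma>0 (restrict_space borel Box) snd = fun_measure 2 Box fm"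
proof (rule measure_eqI)
  fix A assume A': "A \<in> sets (distr \<gamma>0 (restrict_space borel Box) snd)"
  then have A: "A \<in> sets (restrict_space borel Box)" by simp
  then have [measurable]: "A \<in> sets borel" and AB: "A \<subseteq> Box" by (auto simp: sets_borel_restrict_Box)
  have "emeasure (distr \<gamma>0 (restrict_space borel Box) snd) A = (\<integral>\<^sup>+k. \<integral>\<^sup>+s. \<integral>\<^sup>+t. ennreal (plan_density k s t) * indicator A (Z k t) \<partial>lborel \<partial>lborel \<partial>lborel)"
    using emeasure_distr_\<gamma>0[OF snd_BB A] by simp
  also have "\<dots> = (\<integral>\<^sup>+k. \<integral>\<^sup>+t. ennreal (m k * q k t) * indicator A (Z k t) \<partial>lborel \<partial>lborel)"
  proof (rule nn_integral_cong)
    fix k :: real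
    let ?Y = "\<integral>\<^sup>+t. ennreal (q k t) * indicator A (Z k t) \<partial>lborel"
    have "(\<integral>\<^sup>+s. \<integral>\<^sup>+t. ennreal (plan_density k s t) * indicator A (Z k t) \<partial>lborel \<partial>lborel) = (\<integral>\<^sup>+s. ennreal (source_flux k s) * ?Y \<partial>lborel)"
      by (subst nn_integral_cmult[symmetric]) (auto simp: plan_density_eq ennreal_mult source_flux_nonneg q_nonneg mult.assoc intro!: nn_integral_cong)
    also have "\<dots> = (\<integral>\<^sup>+s. ennreal (source_flux k s) \<partial>lborel) * ?Y"
      by (rule nn_integral_multc) measurable
    also have "\<dots> = ennreal (m k) * ?Y"
      using nn_integral_source_flux[of k] by (cases "k \<in> {0<..1}") (auto simp: q_def)
    also have "\<dots> = (\<integral>\<^sup>+t. ennreal (m k * q k t) * indicator A (Z k t) \<partial>lborel)"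
    proof (cases "k \<in> {0<..1}")
      case True
      then show ?thesis using m_pos[of k]
        by (subst nn_integral_cmult[symmetric]) (auto simp: ennreal_mult q_nonneg mult.assoc intro!: nn_integral_cong)
    qed (auto simp: q_def)
    finally show "(\<integral>\<^sup>+s. \<integral>\<^sup>+t. ennreal (plan_density k s t) * indicator A (Z k t) \<partial>lborel \<partial>lborel) = (\<integral>\<^sup>+t. ennreal (m k * q k t) * indicator A (Z k t) \<partial>lborel)" .
  qed
  also have "\<dots> = emeasure (fun_measure 2 Box fm) A"
    using AB by (intro emeasure_ray_density[symmetric] fm_meas fm_nonneg fm_y fm_int fm_ray) (auto simp: q_y)
  finally show "emeasure (distr \<gamma>0 (restrict_space borel Box) snd) A = emeasure (fun_measure 2 Box fm) A" .
qed simp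

lemma transport_plan_\<gamma>0: "transport_plan 2 Box fp fm \<gamma>0"
  unfolding transport_plan_def using \<gamma>0_fst \<gamma>0_snd by simp

lemma finite_fp: "finite_measure (fun_measure 2 Box fp)"
proof (rule finite_measureI)
  have "emeasure (fun_measure 2 Box fp) Box = (\<integral>\<^sup>+z. 1 \<partial>fun_measure 2 Box fp)" by simp
  also have "\<dots> = (\<integral>\<^sup>+z. ennreal (fp z) \<partial>leb 2)"
    by (subst nn_integral_fun_measure) auto
  also have "\<dots> \<le> (\<integral>\<^sup>+z. indicator Box z \<partial>leb 2)"
    using Rp_Box0 Box0_int int_Box_subset by (intro nn_integral_mono) (auto simp: fp_def indicator_def)
  also have "\<dots> < \<infinity>" using emeasure_leb2_Box by simp
  finally show "emeasure (fun_measure 2 Box fp) (space (fun_measure 2 Box fp)) \<noteq> \<infinity>" by simp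
qed

lemma plan_finite:
  assumes T: "transport_plan 2 Box fp fm \<gamma>"
  shows "finite_measure \<gamma>"
proof (rule finite_measureI)
  have "emeasure \<gamma> (space \<gamma>) = emeasure (distr \<gamma> (restrict_space borel Box) fst) Box"
    using transport_planD[OF T] by (subst emeasure_distr) (auto simp: space_restrict_space sets_borel_restrict_Box intro!: arg_cong2[where f=emeasure])
  then show "emeasure \<gamma> (space \<gamma>) \<noteq> \<infinity>"
    using transport_planD(3)[OF T] finite_measure.emeasure_finite[OF finite_fp] by simp
qed

text \<open>Almost every pair of any plan inherits positive heights and slopes in
  \<open>{0<..1}\<close> from the marginals; the estimates for \<open>potential\<close> hold only
  there.\<close>

lemma plan_AE_supp:
  assumes T: "transport_plan 2 Box fp fm \<gamma>"
  shows "AE p in \<gamma>. fst p \<in> Rp \<and> snd p \<in> Rm"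
proof -
  have s: "{z \<in> Box. z \<in> A} \<in> sets borel" if "A \<in> sets borel" for A
  proof -
    have "{z \<in> Box. z \<in> A} = Box \<inter> A" by auto
    then show ?thesis using that by auto
  qed
  have "AE z in fun_measure 2 Box fp. z \<in> Rp"
    by (rule AE_fun_measure) (auto simp: fp_def indicator_def split: if_splits)
  then have 1: "AE p in \<gamma>. fst p \<in> Rp" by (intro transport_plan_AE(1)[OF T] s) auto
  have "AE z in fun_measure 2 Box fm. z \<in> Rm"
    by (rule AE_fun_measure) (auto simp: fm_def split: split_indicator_asm)
  then have 2: "AE p in \<gamma>. snd p \<in> Rm" by (intro transport_plan_AE(2)[OF T] s) auto
  show ?thesis using 1 2 by eventually_elim simp
qed

lemma plan_integral:
  fixes F :: "(nat \<Rightarrow> real) \<Rightarrow> real"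
  assumes T: "transport_plan 2 Box fp fm \<gamma>"
    and F: "F \<in> borel_measurable borel"
  shows "(\<integral>p. F (fst p) \<partial>\<gamma>) = (\<integral>z. F z \<partial>fun_measure 2 Box fp)" "(\<integral>p. F (snd p) \<partial>\<gamma>) = (\<integral>z. F z \<partial>fun_measure 2 Box fm)"
  unfolding transport_planD(3,4)[OF T, symmetric]
  using transport_planD(5,6)[OF T] measurable_restrict_space1[OF F]
  by (auto simp: integral_distr)

lemma plan_integrable:
  fixes F :: "(nat \<Rightarrow> real) \<Rightarrow> real"
  assumes T: "transport_plan 2 Box fp fm \<gamma>"
    and F: "F \<in> borel_measurable borel" "\<And>z. z \<in> Rp \<union> Rm \<Longrightarrow> \<bar>F z\<bar> \<le> B"
  shows "integrable \<gamma> (\<lambda>p. F (fst p))" "integrable \<gamma> (\<lambda>p. F (snd p))"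
proof -
  interpret finite_measure \<gamma> by (rule plan_finite[OF T])
  have m: "(\<lambda>p. F (fst p)) \<in> borel_measurable \<gamma>" "(\<lambda>p. F (snd p)) \<in> borel_measurable \<gamma>"
    using transport_planD(5,6)[OF T] measurable_restrict_space1[OF F(1)] by (auto intro: measurable_compose)
  show "integrable \<gamma> (\<lambda>p. F (fst p))" "integrable \<gamma> (\<lambda>p. F (snd p))"
    using plan_AE_supp[OF T] by (intro integrable_const_bound[where B=B] m; eventually_elim; use F(2) in auto)+
qed

lemma potential_meas [measurable]: "potential \<in> borel_measurable borel"
proof -
  have "continuous_on {-1<..} H"
    using H_deriv by (intro continuous_at_imp_continuous_on ballI DERIV_isCont) auto
  then have "(\<lambda>k. indicator {-1<..} k *\<^sub>R H k) \<in> borel_measurable borel"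
    by (intro borel_measurable_continuous_on_indicator) auto
  \<comment> \<open>For such \<open>k\<close> the interval of integration is empty or a single
    point, so \<open>H\<close> is its continuous part on \<open>{-1<..}\<close> extended by
    \<open>0\<close>.\<close>
  moreover have "H k = 0" if "k \<le> -1" for k
    using that by (cases "k = -1") (auto simp: H_def)
  then have "(\<lambda>k. indicator {-1<..} k *\<^sub>R H k) = H" by (auto simp: fun_eq_iff indicator_def)
  ultimately have [measurable]: "H \<in> borel_measurable borel" by simp
  show ?thesis unfolding potential_def[abs_def] px_def[symmetric] py_def[symmetric] by measurable
qed

end

subsection \<open>The transport integral is the same for all optimal plans\<close>

lemma seg_point_meas [measurable]:
  "(\<lambda>w. seg_point (fst (fst w)) (snd (fst w)) (snd w)) \<in> borel_measurable (borel \<Otimes>\<^sub>M lborel)"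
proof (rule measurable_coordinatewise_then_product)
  fix i
  have [measurable]: "(\<lambda>w :: ((nat \<Rightarrow> real) \<times> (nat \<Rightarrow> real)) \<times> real. fst (fst w) i) \<in> borel_measurable (borel \<Otimes>\<^sub>M lborel)"
    by (rule measurable_compose[OF measurable_compose[OF measurable_fst fst_borel] measurable_coord])
  have [measurable]: "(\<lambda>w :: ((nat \<Rightarrow> real) \<times> (nat \<Rightarrow> real)) \<times> real. snd (fst w) i) \<in> borel_measurable (borel \<Otimes>\<^sub>M lborel)"
    by (rule measurable_compose[OF measurable_compose[OF measurable_fst snd_borel] measurable_coord])
  show "(\<lambda>w. seg_point (fst (fst w)) (snd (fst w)) (snd w) i) \<in> borel_measurable (borel \<Otimes>\<^sub>M lborel)"
    unfolding seg_point_def by measurable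
qed

lemma segment_meas:
  fixes \<phi> :: "(nat \<Rightarrow> real) \<Rightarrow> real"
  assumes \<phi>: "continuous_on Box \<phi>"
  shows "(\<lambda>(x, y). (LBINT t:{0..1}. \<phi> (seg_point x y t) * edist 2 x y)) \<in> borel_measurable BB"
proof -
  \<comment> \<open>The extension of \<open>\<phi>\<close> by zero is Borel on the whole space, and
    convexity of \<open>Box\<close> keeps all segment points inside, so the integrand is unchanged
    on \<open>Box \<times> Box\<close>.\<close>
  define g where "g z = indicator Box z * \<phi> z" for z
  have [measurable]: "g \<in> borel_measurable borel" unfolding g_def by (rule continuous_on_RR2_Box(1)[OF \<phi>])
  have "(\<lambda>p. \<integral>t. indicator {0..1} t * (g (seg_point (fst p) (snd p) t) * edist 2 (fst p) (snd p)) \<partial>lborel) \<in> borel_measurable borel"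
  proof (rule lborel.borel_measurable_lebesgue_integral)
    have "(\<lambda>w. indicator {0..1} (snd w) * (g (seg_point (fst (fst w)) (snd (fst w)) (snd w)) * edist 2 (fst (fst w)) (snd (fst w)))) \<in> borel_measurable (borel \<Otimes>\<^sub>M lborel)"
      using measurable_compose[OF measurable_fst edist_meas] by measurable
    then show "(\<lambda>(p, t). indicator {0..1} t * (g (seg_point (fst p) (snd p) t) * edist 2 (fst p) (snd p))) \<in> borel_measurable (borel \<Otimes>\<^sub>M lborel)"
      by (simp add: case_prod_beta')
  qed
  then have "(\<lambda>p. \<integral>t. indicator {0..1} t * (g (seg_point (fst p) (snd p) t) * edist 2 (fst p) (snd p)) \<partial>lborel) \<in> borel_measurable BB"
    by (rule measurable_restrict_space1)
  also have "?this \<longleftrightarrow> ?thesis"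
  proof (rule measurable_cong)
    fix p assume "p \<in> space BB"
    then have p: "fst p \<in> Box" "snd p \<in> Box" by (auto simp: space_restrict_space)
    have "indicator {0..1} t * (g (seg_point (fst p) (snd p) t) * edist 2 (fst p) (snd p))
        = indicator {0..1} t *\<^sub>R (\<phi> (seg_point (fst p) (snd p) t) * edist 2 (fst p) (snd p))" for t
      using convex_Box p unfolding convex_set_def by (auto simp: g_def indicator_def)
    then show "(\<integral>t. indicator {0..1} t * (g (seg_point (fst p) (snd p) t) * edist 2 (fst p) (snd p)) \<partial>lborel)
        = (case p of (x, y) \<Rightarrow> (LBINT t:{0..1}. \<phi> (seg_point x y t) * edist 2 x y))"
      unfolding set_lebesgue_integral_def case_prod_beta' by presburger
  qed
  finally show ?thesis .
qed

context transport_rays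
begin

lemma potential_bounded: "\<exists>B. \<forall>z\<in>Rp \<union> Rm. \<bar>potential z\<bar> \<le> B"
proof -
  have "continuous_on {0..1} H"
    by (intro continuous_at_imp_continuous_on ballI, rule DERIV_isCont[OF H_deriv]) auto
  then have "bounded (H ` {0..1})" by (intro compact_imp_bounded compact_continuous_image) auto
  then obtain B where B: "\<And>k. k \<in> {0..1} \<Longrightarrow> \<bar>H k\<bar> \<le> B" unfolding bounded_iff by (metis imageI real_norm_def)
  have "\<bar>potential z\<bar> \<le> 8 + B" if z: "z \<in> Rp \<union> Rm" for z
  proof -
    have K: "0 \<le> K z" "K z \<le> 1" using z by (auto simp: Rp_def Rm_def)
    have "z \<in> Box0" using z Rp_Box0 Rm_Box0 by blast
    then have z': "\<bar>z 0\<bar> \<le> 4" "\<bar>z 1\<bar> \<le> 4" by (auto simp: Box0_def)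
    have "\<bar>K z * z 0\<bar> \<le> 1 * 4" unfolding abs_mult using K z' by (intro mult_mono) auto
    then have n: "\<bar>K z * z 0 + z 1\<bar> \<le> 8" using z' by linarith
    have "\<bar>(K z * z 0 + z 1) / sqrt (1 + (K z)\<^sup>2)\<bar> \<le> \<bar>K z * z 0 + z 1\<bar> / 1"
      unfolding abs_divide by (intro divide_left_mono) (auto simp: add_pos_nonneg)
    then have "\<bar>(K z * z 0 + z 1) / sqrt (1 + (K z)\<^sup>2)\<bar> \<le> 8" using n unfolding div_by_1 by linarith
    then show ?thesis using B[of "K z"] K unfolding potential_def abs_le_iff by auto
  qed
  then show ?thesis by blast
qed

text \<open>The Kantorovich dual functional at \<open>potential\<close>. It sees only the marginals
  and is therefore a common lower bound for the costs of all plans.\<close>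

definition dual_value :: real where
  "dual_value = (\<integral>z. potential z \<partial>fun_measure 2 Box fm) - (\<integral>z. potential z \<partial>fun_measure 2 Box fp)"

lemma plan_cost:
  assumes T: "transport_plan 2 Box fp fm \<gamma>"
  shows "integrable \<gamma> (\<lambda>p. edist 2 (fst p) (snd p))"
    "transport_cost 2 \<gamma> = ennreal (\<integral>p. edist 2 (fst p) (snd p) \<partial>\<gamma>)"
    "integrable \<gamma> (\<lambda>p. potential (snd p) - potential (fst p))"
    "(\<integral>p. potential (snd p) - potential (fst p) \<partial>\<gamma>) = dual_value"
    "AE p in \<gamma>. potential (snd p) - potential (fst p) \<le> edist 2 (fst p) (snd p)"
proof -
  interpret finite_measure \<gamma> by (rule plan_finite[OF T])
  have "(\<lambda>p. edist 2 (fst p) (snd p)) \<in> borel_measurable \<gamma>"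
    using measurable_restrict_space1[OF edist_meas, of "Box \<times> Box"] measurable_cong_sets[OF transport_planD(1)[OF T] refl] by blast
  then show i: "integrable \<gamma> (\<lambda>p. edist 2 (fst p) (snd p))"
    using edist_Box_le edist_nonneg transport_planD(2)[OF T]
    by (intro integrable_const_bound[where B=10] AE_I2) auto
  show "transport_cost 2 \<gamma> = ennreal (\<integral>p. edist 2 (fst p) (snd p) \<partial>\<gamma>)"
    unfolding transport_cost_def case_prod_beta'
    by (rule nn_integral_eq_integral[OF i]) (simp add: edist_nonneg)
  obtain B where B: "\<And>z. z \<in> Rp \<union> Rm \<Longrightarrow> \<bar>potential z\<bar> \<le> B" using potential_bounded by blast
  note I = plan_integrable[OF T potential_meas B]
  show "integrable \<gamma> (\<lambda>p. potential (snd p) - potential (fst p))" using I by simp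
  show "(\<integral>p. potential (snd p) - potential (fst p) \<partial>\<gamma>) = dual_value"
    using I plan_integral[OF T potential_meas] by (simp add: dual_value_def)
  show "AE p in \<gamma>. potential (snd p) - potential (fst p) \<le> edist 2 (fst p) (snd p)"
    using plan_AE_supp[OF T]
    by eventually_elim (intro potential_diff_le(1), auto simp: Rp_def Rm_def py_def)
qed

lemma AE_\<gamma>0: "AE p in \<gamma>0. potential (snd p) - potential (fst p) = edist 2 (fst p) (snd p)"
proof -
  have "(\<lambda>p. potential (snd p) - potential (fst p)) \<in> borel_measurable borel" by measurable
  then have s: "{p \<in> space BB. potential (snd p) - potential (fst p) = edist 2 (fst p) (snd p)} \<in> sets BB"
    using edist_meas by (intro borel_measurable_eq measurable_restrict_space1)
  have "potential (snd (clamp2 (Z k s, Z k t))) - potential (fst (clamp2 (Z k s, Z k t))) = edist 2 (fst (clamp2 (Z k s, Z k t))) (snd (clamp2 (Z k s, Z k t)))"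
    if "plan_density k s t \<noteq> 0" for k s t
    using plan_density_Z[OF that] potential_ray[of s t k] edist_ray[of k s t] \<tau>_le[of k] by auto
  then show ?thesis unfolding \<gamma>0_def
    by (subst AE_distr_iff[OF _ s], simp, subst AE_density) (auto simp: case_prod_beta' intro!: AE_I2)
qed

lemma cost_\<gamma>0: "(\<integral>p. edist 2 (fst p) (snd p) \<partial>\<gamma>0) = dual_value"
proof -
  note T = plan_cost[OF transport_plan_\<gamma>0]
  have "(\<integral>p. edist 2 (fst p) (snd p) \<partial>\<gamma>0) = (\<integral>p. potential (snd p) - potential (fst p) \<partial>\<gamma>0)"
    using T(1,3) AE_\<gamma>0 by (intro integral_cong_AE) (auto dest: borel_measurable_integrable)
  then show ?thesis using T(4) by simp
qed

text \<open>Weak duality: each plan costs at least \<open>dual_value\<close>, and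
  \<open>\<gamma>0\<close> attains it because along a ray the potential grows exactly by the
  distance.\<close>

lemma optimal_\<gamma>0: "optimal_plan 2 Box fp fm \<gamma>0"
  unfolding optimal_plan_def
proof (intro conjI allI impI)
  show "transport_plan 2 Box fp fm \<gamma>0" by (rule transport_plan_\<gamma>0)
  fix \<gamma> assume T: "transport_plan 2 Box fp fm \<gamma>"
  have "dual_value \<le> (\<integral>p. edist 2 (fst p) (snd p) \<partial>\<gamma>)"
    unfolding plan_cost(4)[OF T, symmetric] using plan_cost[OF T] by (intro integral_mono_AE) auto
  then show "transport_cost 2 \<gamma>0 \<le> transport_cost 2 \<gamma>"
    unfolding plan_cost(2)[OF T] plan_cost(2)[OF transport_plan_\<gamma>0] cost_\<gamma>0 by (rule ennreal_leI)
qed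

text \<open>Complementary slackness: distance minus potential difference is nonnegative almost
  everywhere, and for a plan of minimal cost its integral vanishes.\<close>

lemma optimal_AE:
  assumes "optimal_plan 2 Box fp fm \<gamma>"
  shows "AE p in \<gamma>. potential (snd p) - potential (fst p) = edist 2 (fst p) (snd p)"
proof -
  have T: "transport_plan 2 Box fp fm \<gamma>" and le: "transport_cost 2 \<gamma> \<le> transport_cost 2 \<gamma>0"
    using assms transport_plan_\<gamma>0 unfolding optimal_plan_def by auto
  note P = plan_cost[OF T]
  have ge0: "0 \<le> (\<integral>p. edist 2 (fst p) (snd p) \<partial>\<gamma>0)" by (simp add: edist_nonneg)
  have "(\<integral>p. edist 2 (fst p) (snd p) \<partial>\<gamma>) \<le> dual_value"
    using le ge0 unfolding P(2) plan_cost(2)[OF transport_plan_\<gamma>0] cost_\<gamma>0 by (simp add: ennreal_le_iff)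
  moreover have "dual_value \<le> (\<integral>p. edist 2 (fst p) (snd p) \<partial>\<gamma>)"
    unfolding P(4)[symmetric] using P by (intro integral_mono_AE) auto
  ultimately have "(\<integral>p. edist 2 (fst p) (snd p) - (potential (snd p) - potential (fst p)) \<partial>\<gamma>) = 0"
    using P(1,3,4) by (subst Bochner_Integration.integral_diff) auto
  moreover have "AE p in \<gamma>. 0 \<le> edist 2 (fst p) (snd p) - (potential (snd p) - potential (fst p))" using P(5) by eventually_elim simp
  ultimately have "AE p in \<gamma>. edist 2 (fst p) (snd p) - (potential (snd p) - potential (fst p)) = 0"
    using integral_nonneg_eq_0_iff_AE[OF Bochner_Integration.integrable_diff[OF P(1) P(3)]] by blast
  then show ?thesis by eventually_elim simp
qed

text \<open>The integral of \<open>g\<close> with respect to arc length along the ray through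
  \<open>z\<close>, from height \<open>0\<close> up to \<open>z\<close>. It is a primitive along
  rays: it turns a segment integral into a function of the end point minus a function of the
  starting point.\<close>

definition ray_int :: "((nat \<Rightarrow> real) \<Rightarrow> real) \<Rightarrow> (nat \<Rightarrow> real) \<Rightarrow> real" where
  "ray_int g z = sqrt (1 + (K z)\<^sup>2) * (\<integral>\<eta>. (if 0 < \<eta> \<and> \<eta> \<le> py z then g (Z (K z) \<eta>) else 0) \<partial>lborel)"

lemma ray_int_meas [measurable]:
  assumes [measurable]: "g \<in> borel_measurable borel"
  shows "ray_int g \<in> borel_measurable borel"
  unfolding ray_int_def[abs_def] by measurable

lemma integrable_ray:
  assumes [measurable]: "g \<in> borel_measurable borel" and B: "\<And>z. \<bar>g z\<bar> \<le> (B::real)"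
  shows "integrable lborel (\<lambda>\<eta>. if l < \<eta> \<and> \<eta> \<le> u then g (Z k \<eta>) else 0)"
proof (rule Bochner_Integration.integrable_bound[where f="\<lambda>\<eta>. B * indicator {l<..u} \<eta>"])
  show "integrable lborel (\<lambda>\<eta>. B * indicator {l<..u} \<eta>)"
    using emeasure_lborel_Ioc_finite[of l u] by (intro integrable_mult_right integrable_real_indicator) auto
  have "0 \<le> B" using B[of "pt 0 0"] by linarith
  then show "AE x in lborel. norm (if l < x \<and> x \<le> u then g (Z k x) else 0) \<le> norm (B * indicator {l<..u} x)"
    using B by (intro AE_I2) auto
qed measurable

lemma ray_int_bounded:
  assumes [measurable]: "g \<in> borel_measurable borel" and B: "\<And>z. \<bar>g z\<bar> \<le> (B::real)" and z: "z \<in> Rp \<union> Rm"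
  shows "\<bar>ray_int g z\<bar> \<le> 2 * (2 * B)"
proof -
  have K: "0 \<le> K z" "K z \<le> 1" "0 \<le> py z" "py z \<le> 2" using z \<tau>_le[of "K z"] by (auto simp: Rp_def Rm_def)
  have B0: "0 \<le> B" using B[of "pt 0 0"] by linarith
  have i: "integrable lborel (\<lambda>\<eta>. B * indicator {0<..py z} \<eta>)"
    using emeasure_lborel_Ioc_finite by (intro integrable_mult_right integrable_real_indicator) auto
  have "\<bar>\<integral>\<eta>. (if 0 < \<eta> \<and> \<eta> \<le> py z then g (Z (K z) \<eta>) else 0) \<partial>lborel\<bar> \<le> (\<integral>\<eta>. B * indicator {0<..py z} \<eta> \<partial>lborel)"
    using integrable_abs[OF integrable_ray[OF assms(1) B, of 0 "py z" "K z"]] B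
    by (intro order_trans[OF integral_abs_bound] integral_mono i) (auto simp: indicator_def)
  also have "\<dots> \<le> 2 * B" using K B0 by (simp add: measure_lborel_Ioc mult.commute mult_left_mono)
  finally have 1: "\<bar>\<integral>\<eta>. (if 0 < \<eta> \<and> \<eta> \<le> py z then g (Z (K z) \<eta>) else 0) \<partial>lborel\<bar> \<le> 2 * B" .
  have "(K z)\<^sup>2 \<le> 1" using K by (simp add: power_le_one)
  then have "sqrt (1 + (K z)\<^sup>2) \<le> sqrt 4" by (intro real_sqrt_le_mono) simp
  then have "sqrt (1 + (K z)\<^sup>2) \<le> 2" by simp
  then show ?thesis unfolding ray_int_def abs_mult using 1 by (intro mult_mono) auto
qed

lemma ray_int_diff:
  assumes "g \<in> borel_measurable borel" and B: "\<And>z. \<bar>g z\<bar> \<le> (B::real)" and st: "0 < s" "s < t"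
  shows "ray_int g (Z k t) - ray_int g (Z k s) = sqrt (1 + k\<^sup>2) * (\<integral>\<eta>. (if s < \<eta> \<and> \<eta> \<le> t then g (Z k \<eta>) else 0) \<partial>lborel)"
proof -
  let ?f = "\<lambda>l u \<eta>. if l < \<eta> \<and> \<eta> \<le> u then g (Z k \<eta>) else 0"
  have "py (Z k s) = s" "py (Z k t) = t" "K (Z k s) = k" "K (Z k t) = k" using st by (simp_all add: py_def)
  then have "ray_int g (Z k t) - ray_int g (Z k s) = sqrt (1 + k\<^sup>2) * ((\<integral>\<eta>. ?f 0 t \<eta> \<partial>lborel) - (\<integral>\<eta>. ?f 0 s \<eta> \<partial>lborel))"
    unfolding ray_int_def by (simp only: right_diff_distrib)
  also have "(\<integral>\<eta>. ?f 0 t \<eta> \<partial>lborel) - (\<integral>\<eta>. ?f 0 s \<eta> \<partial>lborel) = (\<integral>\<eta>. ?f 0 t \<eta> - ?f 0 s \<eta> \<partial>lborel)"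
    using integrable_ray[OF assms(1) B] by (intro Bochner_Integration.integral_diff[symmetric])
  also have "(\<lambda>\<eta>. ?f 0 t \<eta> - ?f 0 s \<eta>) = ?f s t"
    using st by (auto simp: fun_eq_iff)
  finally show ?thesis .
qed

lemma segment_integral:
  fixes \<phi> :: "(nat \<Rightarrow> real) \<Rightarrow> real"
  assumes \<phi>: "continuous_on Box \<phi>" and k: "k \<in> {0..1}" and st: "0 < s" "s < t" "t \<le> 2"
  defines "g \<equiv> \<lambda>z. indicator Box z * \<phi> z"
  shows "(LBINT u:{0..1}. \<phi> (seg_point (Z k s) (Z k t) u) * edist 2 (Z k s) (Z k t)) = ray_int g (Z k t) - ray_int g (Z k s)"
proof -
  have gm [measurable]: "g \<in> borel_measurable borel" unfolding g_def by (rule continuous_on_RR2_Box(1)[OF \<phi>])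
  obtain B where "B \<ge> 0" "\<And>z. \<bar>g z\<bar> \<le> B * indicator Box z" using continuous_on_RR2_Box(2)[OF \<phi>] unfolding g_def by blast
  then have B: "\<bar>g z\<bar> \<le> B" for z
    using mult_left_le[of "indicator Box z" B] indicator_le_1[of Box z] by (metis order_trans)
  define r where "r = sqrt (1 + k\<^sup>2)"
  \<comment> \<open>Substitution \<open>\<eta> = s + (t - s) * u\<close>; the Jacobian
    \<open>t - s\<close> times \<open>r\<close> is the length of the segment.\<close>
  have "(\<integral>\<eta>. (if s < \<eta> \<and> \<eta> \<le> t then g (Z k \<eta>) else 0) \<partial>lborel)
      = \<bar>t - s\<bar> *\<^sub>R (\<integral>u. (if s < s + (t - s) * u \<and> s + (t - s) * u \<le> t then g (Z k (s + (t - s) * u)) else 0) \<partial>lborel)"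
    by (rule lborel_integral_real_affine) (use st in simp)
  also have "(\<lambda>u. if s < s + (t - s) * u \<and> s + (t - s) * u \<le> t then g (Z k (s + (t - s) * u)) else 0)
      = (\<lambda>u. if 0 < u \<and> u \<le> 1 then g (Z k (s + (t - s) * u)) else 0)"
  proof
    fix u
    have "s < s + (t - s) * u \<longleftrightarrow> 0 < u" using st by (simp add: zero_less_mult_iff)
    moreover have "s + (t - s) * u \<le> t \<longleftrightarrow> (t - s) * u \<le> (t - s) * 1" unfolding mult_1_right by linarith
    then have "s + (t - s) * u \<le> t \<longleftrightarrow> u \<le> 1" using st by (simp add: mult_le_cancel_left_pos del: mult_1_right)
    ultimately show "(if s < s + (t - s) * u \<and> s + (t - s) * u \<le> t then g (Z k (s + (t - s) * u)) else 0)
      = (if 0 < u \<and> u \<le> 1 then g (Z k (s + (t - s) * u)) else 0)" by simp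
  qed
  finally have R: "ray_int g (Z k t) - ray_int g (Z k s) = r * ((t - s) * (\<integral>u. (if 0 < u \<and> u \<le> 1 then g (Z k (s + (t - s) * u)) else 0) \<partial>lborel))"
    unfolding ray_int_diff[OF gm B st(1,2)] r_def using st by simp
  have "(LBINT u:{0..1}. \<phi> (seg_point (Z k s) (Z k t) u) * edist 2 (Z k s) (Z k t))
      = (\<integral>u. indicator {0..1} u * (g (Z k (s + (t - s) * u)) * (r * (t - s))) \<partial>lborel)"
    unfolding set_lebesgue_integral_def real_scaleR_def
  proof (rule Bochner_Integration.integral_cong)
    fix u :: real
    show "indicator {0..1} u * (\<phi> (seg_point (Z k s) (Z k t) u) * edist 2 (Z k s) (Z k t)) = indicator {0..1} u * (g (Z k (s + (t - s) * u)) * (r * (t - s)))"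
    proof (cases "u \<in> {0..1}")
      case True
      then have "0 \<le> (t - s) * u" "(t - s) * u \<le> (t - s) * 1" using st by (auto intro!: mult_left_mono simp del: mult_1_right)
      then have "0 \<le> s + (t - s) * u" "s + (t - s) * u \<le> 2" using st unfolding mult_1_right by linarith+
      then have "Z k (s + (t - s) * u) \<in> Box" using Z_Box0[OF k, of "s + (t - s) * u"] Box0_int int_Box_subset by blast
      then show ?thesis using st by (simp add: seg_point_ray edist_ray g_def r_def mult.commute)
    qed simp
  qed simp
  also have "\<dots> = (\<integral>u. (r * (t - s)) * (if 0 < u \<and> u \<le> 1 then g (Z k (s + (t - s) * u)) else 0) \<partial>lborel)"
  proof (rule integral_cong_AE)
    have "AE u in lborel. u \<noteq> (0::real)" by (rule AE_lborel_singleton)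
    then show "AE u in lborel. indicator {0..1} u * (g (Z k (s + (t - s) * u)) * (r * (t - s))) = (r * (t - s)) * (if 0 < u \<and> u \<le> 1 then g (Z k (s + (t - s) * u)) else 0)"
      by eventually_elim (auto simp: indicator_def)
  qed measurable
  also have "\<dots> = ray_int g (Z k t) - ray_int g (Z k s)" unfolding R by simp
  finally show ?thesis .
qed

definition seg_integral :: "((nat \<Rightarrow> real) \<times> (nat \<Rightarrow> real)) measure \<Rightarrow> ((nat \<Rightarrow> real) \<Rightarrow> real) \<Rightarrow> real" where
  "seg_integral \<gamma> \<phi> = (\<integral>(x, y). (LBINT t:{0..1}. \<phi> (seg_point x y t) * edist 2 x y) \<partial>\<gamma>)"

text \<open>Almost every pair of an optimal plan lies on one ray, so the segment integral is a
  difference of values of \<open>ray_int g\<close>. Each of the two terms involves a single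
  marginal, hence the result does not depend on the plan. This is the uniqueness of the transport
  density in weak form.\<close>

lemma seg_integral_optimal:
  assumes O: "optimal_plan 2 Box fp fm \<gamma>" and \<phi>: "continuous_on Box \<phi>"
  defines "g \<equiv> \<lambda>z. indicator Box z * \<phi> z"
  shows "seg_integral \<gamma> \<phi> = (\<integral>p. ray_int g (snd p) - ray_int g (fst p) \<partial>\<gamma>)"
    "seg_integral \<gamma> \<phi> = (\<integral>z. ray_int g z \<partial>fun_measure 2 Box fm) - (\<integral>z. ray_int g z \<partial>fun_measure 2 Box fp)"
proof -
  have T: "transport_plan 2 Box fp fm \<gamma>" using O unfolding optimal_plan_def by simp
  have m: "(\<lambda>(x, y). (LBINT t:{0..1}. \<phi> (seg_point x y t) * edist 2 x y)) \<in> borel_measurable \<gamma>"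
    using segment_meas[OF \<phi>] measurable_cong_sets[OF transport_planD(1)[OF T] refl] by blast
  have gm [measurable]: "g \<in> borel_measurable borel" unfolding g_def by (rule continuous_on_RR2_Box(1)[OF \<phi>])
  obtain B where "B \<ge> 0" "\<And>z. \<bar>g z\<bar> \<le> B * indicator Box z" using continuous_on_RR2_Box(2)[OF \<phi>] unfolding g_def by blast
  then have B: "\<bar>g z\<bar> \<le> B" for z
    using mult_left_le[of "indicator Box z" B] indicator_le_1[of Box z] by (metis order_trans)
  note I = plan_integrable[OF T ray_int_meas[OF gm] ray_int_bounded[OF gm B]]
  have "AE p in \<gamma>. (case p of (x, y) \<Rightarrow> (LBINT t:{0..1}. \<phi> (seg_point x y t) * edist 2 x y)) = ray_int g (snd p) - ray_int g (fst p)"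
    using optimal_AE[OF O] plan_AE_supp[OF T]
  proof eventually_elim
    case (elim p)
    define k s t where kst: "k = K (snd p)" "s = py (fst p)" "t = py (snd p)"
    have y: "fst p \<in> RR 2" "snd p \<in> RR 2" "0 < s" "s < t" "t \<le> 2" "k \<in> {0..1}"
      using elim \<tau>_le[of "K (fst p)"] by (auto simp: Rp_def Rm_def kst)
    have "snd p = Z k t" using y elim K_Box0(2)[of "snd p"] by (auto simp: kst Rm_def)
    \<comment> \<open>The equality case of the potential estimate puts the source point on the ray
      of the target point.\<close>
    moreover have "px (fst p) = \<xi> k + k * s"
      using potential_diff_le(2)[of "fst p" "snd p"] elim unfolding kst px_def py_def by (auto simp: Rp_def Rm_def py_def)
    then have "fst p = Z k s" using y(1) RR2_iff[of "fst p"] by (simp add: Z_def kst px_def py_def)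
    ultimately show ?case
      using segment_integral[OF \<phi> y(6,3,4,5)] unfolding g_def by (simp add: case_prod_beta')
  qed
  then show "seg_integral \<gamma> \<phi> = (\<integral>p. ray_int g (snd p) - ray_int g (fst p) \<partial>\<gamma>)"
    unfolding seg_integral_def using m I by (intro integral_cong_AE) (auto dest: borel_measurable_integrable)
  then show "seg_integral \<gamma> \<phi> = (\<integral>z. ray_int g z \<partial>fun_measure 2 Box fm) - (\<integral>z. ray_int g z \<partial>fun_measure 2 Box fp)"
    using I plan_integral[OF T ray_int_meas[OF gm]] by simp
qed

end

subsection \<open>The transport density\<close>

context transport_rays
begin

text \<open>\<open>flux k y\<close> is the mass per unit of \<open>k\<close> that crosses height \<open>y\<close>: the source mass below \<open>y\<close> times the
  fraction of the target above \<open>y\<close>.\<close>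

definition flux :: "real \<Rightarrow> real \<Rightarrow> real" where
  "flux k y = (C k * min y (\<tau> k) + (min y (\<tau> k))\<^sup>2 / 2) *
     (if y \<le> 1 then 1 else (C k * (2 - y) + (4 - y\<^sup>2) / 2) / (C k + 3/2))"

definition Rs :: "(nat \<Rightarrow> real) set" where
  "Rs = {z \<in> RR 2. 0 < py z \<and> py z < 2 \<and> 0 < K z \<and> K z \<le> 1}"

definition \<sigma>0 :: "(nat \<Rightarrow> real) \<Rightarrow> real" where
  "\<sigma>0 z = indicator Rs z * (sqrt (1 + (K z)\<^sup>2) * flux (K z) (py z) / (C (K z) + py z))"

lemma flux_meas [measurable]:
  assumes [measurable]: "f \<in> borel_measurable M" "g \<in> borel_measurable M"
  shows "(\<lambda>x. flux (f x) (g x)) \<in> borel_measurable M"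
  unfolding flux_def by measurable

lemma Rs_sets [measurable]: "Rs \<in> sets borel" unfolding Rs_def by measurable

lemma \<sigma>0_meas [measurable]: "\<sigma>0 \<in> borel_measurable borel" unfolding \<sigma>0_def[abs_def] by measurable

lemma Rs_Box0: "Rs \<subseteq> Box0"
  by (auto simp: Rs_def intro: K_Box0)

text \<open>Near height \<open>0\<close> the denominator \<open>C k + y\<close> of
  \<open>\<sigma>0\<close> may become small. What crosses height \<open>y\<close> is at most the
  source mass below \<open>y\<close>, hence at most \<open>y * (C k + y)\<close>, so the quotient
  stays bounded.\<close>

lemma flux_bounds:
  assumes k: "k \<in> {0<..1}" and y: "0 < y" "y < 2"
  shows "0 \<le> flux k y" "flux k y \<le> y * (C k + y)"
proof -
  define c where "c = C k"
  have c: "0 \<le> c" using C_nonneg by (simp add: c_def)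
  define u where "u = min y (\<tau> k)"
  have u: "0 < u" "u \<le> y" using y \<tau>_pos[OF k] by (auto simp: u_def)
  define Q where "Q = (if y \<le> 1 then 1 else (c * (2 - y) + (4 - y\<^sup>2) / 2) / (c + 3/2))"
  have Q: "0 \<le> Q" "Q \<le> 1"
  proof -
    have "0 \<le> (2 - y) * (2 + y)" using y by simp
    then have "0 \<le> 4 - y\<^sup>2" by (simp add: power2_eq_square algebra_simps)
    then show "0 \<le> Q" using y c by (simp add: Q_def)
    show "Q \<le> 1"
    proof (cases "y \<le> 1")
      case False
      then have "c * (2 - y) \<le> c * 1" using c by (intro mult_left_mono) auto
      moreover have "1 \<le> y\<^sup>2" using False by (simp add: power2_eq_square mult_ge1_I)
      then have "(4 - y\<^sup>2) / 2 \<le> 3/2" by simp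
      ultimately have "c * (2 - y) + (4 - y\<^sup>2) / 2 \<le> c * 1 + 3/2" by (intro add_mono)
      then show ?thesis using False c by (simp add: Q_def pos_divide_le_eq add_nonneg_pos)
    qed (simp add: Q_def)
  qed
  have flux: "flux k y = (c * u + u\<^sup>2 / 2) * Q" by (simp add: flux_def c_def u_def Q_def)
  have nn: "0 \<le> c * u + u\<^sup>2 / 2" using c u by simp
  show "0 \<le> flux k y" unfolding flux using nn Q by simp
  have "flux k y \<le> (c * u + u\<^sup>2 / 2) * 1" unfolding flux using nn Q by (intro mult_left_mono) auto
  also have "\<dots> \<le> c * y + y * y"
  proof -
    have "c * u \<le> c * y" using c u by (intro mult_left_mono) auto
    moreover have "u\<^sup>2 / 2 \<le> y * y"
      using mult_mono[of u y u y] u mult_nonneg_nonneg[of u u] unfolding power2_eq_square by linarith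
    ultimately show ?thesis by simp
  qed
  finally show "flux k y \<le> y * (C k + y)" by (simp add: c_def algebra_simps)
qed

lemma \<sigma>0_bounds: "0 \<le> \<sigma>0 z" "\<bar>\<sigma>0 z\<bar> \<le> 4 * indicator Box z"
proof -
  have *: "0 \<le> \<sigma>0 z \<and> \<sigma>0 z \<le> 4" if z: "z \<in> Rs"
  proof -
    define k y where "k = K z" and "y = py z"
    have ky: "k \<in> {0<..1}" "0 < y" "y < 2" using z by (auto simp: Rs_def k_def y_def)
    have p: "0 < C k + y" using C_nonneg[of k] ky by simp
    have "y * (C k + y) \<le> 2 * (C k + y)" using p ky by (intro mult_right_mono) auto
    then have "flux k y \<le> 2 * (C k + y)" using flux_bounds(2)[OF ky] by linarith
    then have s: "0 \<le> flux k y / (C k + y)" "flux k y / (C k + y) \<le> 2"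
      using flux_bounds(1)[OF ky] p by (simp_all only: divide_nonneg_pos pos_divide_le_eq)
    have "k\<^sup>2 \<le> 1" using ky by (simp add: power_le_one)
    then have "sqrt (1 + k\<^sup>2) \<le> sqrt 4" by (intro real_sqrt_le_mono) simp
    then have "sqrt (1 + k\<^sup>2) \<le> 2" by simp
    then have "sqrt (1 + k\<^sup>2) * (flux k y / (C k + y)) \<le> 2 * 2" using s by (intro mult_mono) auto
    moreover have "\<sigma>0 z = sqrt (1 + k\<^sup>2) * (flux k y / (C k + y))" using z by (simp add: \<sigma>0_def k_def y_def)
    moreover have "0 \<le> sqrt (1 + k\<^sup>2) * (flux k y / (C k + y))" using s(1) by (intro mult_nonneg_nonneg) auto
    ultimately show ?thesis by linarith
  qed
  show "0 \<le> \<sigma>0 z" using * by (cases "z \<in> Rs") (auto simp: \<sigma>0_def)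
  show "\<bar>\<sigma>0 z\<bar> \<le> 4 * indicator Box z"
  proof (cases "z \<in> Rs")
    case True
    then have "z \<in> Box" using Rs_Box0 Box0_int int_Box_subset by blast
    then show ?thesis using *[OF True] by simp
  qed (simp add: \<sigma>0_def)
qed

lemma integrable_\<sigma>0: "integrable (leb 2) \<sigma>0"
  by (rule integrable_leb2_Box[OF \<sigma>0_meas \<sigma>0_bounds(2)])

lemma \<sigma>0_int [simp]: "indicator (int_of 2 Box) z * \<sigma>0 z = \<sigma>0 z"
  by (rule Box0_int_ind) (use Rs_Box0 in \<open>auto simp: \<sigma>0_def indicator_def\<close>)

text \<open>The variables are a height on the segment, the slope and the two end heights.
  Parametrising by height makes the position \<open>Z k \<eta>\<close> independent of the end
  points; \<open>sqrt (1 + k\<^sup>2)\<close> is the arc length per unit of height.\<close>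

definition w :: "real \<times> real \<times> real \<times> real \<Rightarrow> real" where
  "w = (\<lambda>(\<eta>, k, s, t). if s < \<eta> \<and> \<eta> \<le> t then plan_density k s t * sqrt (1 + k\<^sup>2) else 0)"

lemma w_meas [measurable]: "w \<in> borel_measurable (lborel \<Otimes>\<^sub>M (lborel \<Otimes>\<^sub>M (lborel \<Otimes>\<^sub>M lborel)))"
  unfolding w_def case_prod_beta' by measurable

lemma w_nonneg: "0 \<le> w x"
  using plan_density_nonneg by (auto simp: w_def split: prod.split)

text \<open>At fixed height and slope the conditions \<open>s < \<eta>\<close> and
  \<open>\<eta> \<le> t\<close> separate, so the source mass below and the target fraction above
  multiply to the flux.\<close>

lemma nn_integral_w:
  "(\<integral>\<^sup>+s. \<integral>\<^sup>+t. ennreal (w (\<eta>, k, s, t)) \<partial>lborel \<partial>lborel)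
    = (if 0 < \<eta> \<and> \<eta> < 2 \<and> 0 < k \<and> k \<le> 1 then ennreal (sqrt (1 + k\<^sup>2) * flux k \<eta>) else 0)"
proof (cases "0 < \<eta> \<and> \<eta> < 2 \<and> 0 < k \<and> k \<le> 1")
  case False
  then have "w (\<eta>, k, s, t) = 0" for s t by (auto simp: w_def plan_density_def)
  then show ?thesis using False by auto
next
  case True
  then have k: "k \<in> {0<..1}" and \<eta>: "0 < \<eta>" "\<eta> < 2" by auto
  let ?Q = "\<integral>\<^sup>+t. ennreal (if \<eta> \<le> t then q k t else 0) \<partial>lborel"
  let ?q = "if \<eta> \<le> 1 then 1 else (C k * (2 - \<eta>) + (4 - \<eta>\<^sup>2) / 2) / (C k + 3/2)"
  have Q: "?Q = ennreal ?q"
  proof (cases "\<eta> \<le> 1")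
    case True
    have "?Q = (\<integral>\<^sup>+t. ennreal (q k t) \<partial>lborel)"
      by (intro nn_integral_cong) (use True in \<open>auto simp: q_def\<close>)
    then show ?thesis using nn_integral_q[OF k] True by simp
  next
    case False
    have "?Q = (\<integral>\<^sup>+t. ennreal (if \<eta> < t then q k t else 0) \<partial>lborel)"
    proof (rule nn_integral_cong_AE)
      have "AE t in lborel. t \<noteq> \<eta>" by (rule AE_lborel_singleton)
      then show "AE t in lborel. ennreal (if \<eta> \<le> t then q k t else 0) = ennreal (if \<eta> < t then q k t else 0)"
        by eventually_elim auto
    qed
    then show ?thesis using nn_integral_q_gt[OF k, of \<eta>] False \<eta> by simp
  qed
  have A: "(\<integral>\<^sup>+s. ennreal (if s < \<eta> then source_flux k s else 0) \<partial>lborel) = ennreal (C k * min \<eta> (\<tau> k) + (min \<eta> (\<tau> k))\<^sup>2 / 2)"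
  proof -
    have "(\<integral>\<^sup>+s. ennreal (if s < \<eta> then source_flux k s else 0) \<partial>lborel) = (\<integral>\<^sup>+s. ennreal (if 0 < s \<and> s < min \<eta> (\<tau> k) then C k + s else 0) \<partial>lborel)"
      by (intro nn_integral_cong) (use k in \<open>auto simp: source_flux_def\<close>)
    then show ?thesis using nn_integral_linear_Ioo[of "C k" 0 "min \<eta> (\<tau> k)"] C_nonneg[of k] \<tau>_pos[OF k] \<eta> by simp
  qed
  have "(\<integral>\<^sup>+s. \<integral>\<^sup>+t. ennreal (w (\<eta>, k, s, t)) \<partial>lborel \<partial>lborel)
     = (\<integral>\<^sup>+s. ennreal (if s < \<eta> then source_flux k s else 0) * (ennreal (sqrt (1 + k\<^sup>2)) * ?Q) \<partial>lborel)"
  proof (rule nn_integral_cong)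
    fix s :: real
    have "(\<integral>\<^sup>+t. ennreal (w (\<eta>, k, s, t)) \<partial>lborel) = (\<integral>\<^sup>+t. (ennreal (if s < \<eta> then source_flux k s else 0) * ennreal (sqrt (1 + k\<^sup>2))) * ennreal (if \<eta> \<le> t then q k t else 0) \<partial>lborel)"
      by (intro nn_integral_cong) (simp add: w_def plan_density_eq source_flux_nonneg q_nonneg ennreal_mult mult_ac)
    also have "\<dots> = (ennreal (if s < \<eta> then source_flux k s else 0) * ennreal (sqrt (1 + k\<^sup>2))) * ?Q"
      by (rule nn_integral_cmult) measurable
    finally show "(\<integral>\<^sup>+t. ennreal (w (\<eta>, k, s, t)) \<partial>lborel) = ennreal (if s < \<eta> then source_flux k s else 0) * (ennreal (sqrt (1 + k\<^sup>2)) * ?Q)"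
      by (simp only: mult.assoc)
  qed
  also have "\<dots> = ennreal (C k * min \<eta> (\<tau> k) + (min \<eta> (\<tau> k))\<^sup>2 / 2) * (ennreal (sqrt (1 + k\<^sup>2)) * ennreal ?q)"
    unfolding Q A[symmetric] by (rule nn_integral_multc) measurable
  also have "\<dots> = ennreal (sqrt (1 + k\<^sup>2) * flux k \<eta>)"
  proof -
    have "0 \<le> C k * min \<eta> (\<tau> k) + (min \<eta> (\<tau> k))\<^sup>2 / 2" using C_nonneg[of k] \<tau>_pos[OF k] \<eta> by simp
    then show ?thesis unfolding flux_def by (simp add: ennreal_mult'[symmetric] mult_ac del: ennreal_mult'')
  qed
  finally show ?thesis using True by simp
qed

text \<open>Once \<open>s\<close> and \<open>t\<close> are integrated out, only
  \<open>sqrt (1 + k\<^sup>2) * flux k \<eta>\<close> is left, and passing from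
  \<open>(k, \<eta>)\<close> to points of the plane divides it by the area element
  \<open>C k + \<eta>\<close>.\<close>

lemma distr_w:
  "distr (density (lborel \<Otimes>\<^sub>M (lborel \<Otimes>\<^sub>M (lborel \<Otimes>\<^sub>M lborel))) (\<lambda>x. ennreal (w x))) borel (\<lambda>(\<eta>, k, s, t). Z k \<eta>)
    = density (leb 2) (\<lambda>z. ennreal (\<sigma>0 z))" (is "distr (density ?B _) _ ?Z = ?R")
proof (rule measure_eqI)
  fix A assume "A \<in> sets (distr (density ?B (\<lambda>x. ennreal (w x))) borel ?Z)"
  then have [measurable]: "A \<in> sets borel" by simp
  have Zm [measurable]: "?Z \<in> borel_measurable ?B" unfolding case_prod_beta' by measurable
  have "emeasure (distr (density ?B (\<lambda>x. ennreal (w x))) borel ?Z) A = (\<integral>\<^sup>+z. indicator A z \<partial>distr (density ?B (\<lambda>x. ennreal (w x))) borel ?Z)"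
    by simp
  also have "\<dots> = (\<integral>\<^sup>+x. ennreal (w x) * indicator A (?Z x) \<partial>?B)"
    by (subst nn_integral_distr, simp, simp) (subst nn_integral_density; simp)
  also have "\<dots> = (\<integral>\<^sup>+\<eta>. \<integral>\<^sup>+x. ennreal (w (\<eta>, x)) * indicator A (?Z (\<eta>, x)) \<partial>(lborel \<Otimes>\<^sub>M (lborel \<Otimes>\<^sub>M lborel)) \<partial>lborel)"
  proof -
    have "(\<lambda>x. ennreal (w x) * indicator A (?Z x)) \<in> borel_measurable ?B" by measurable
    then show ?thesis unfolding lborel_prod[where 'a=real and 'b="real"] lborel_prod[where 'a=real and 'b="real \<times> real"]
      by (rule lborel.nn_integral_fst[symmetric])
  qed
  also have "\<dots> = (\<integral>\<^sup>+\<eta>. \<integral>\<^sup>+k. \<integral>\<^sup>+s. \<integral>\<^sup>+t. ennreal (w (\<eta>, k, s, t)) * indicator A (Z k \<eta>) \<partial>lborel \<partial>lborel \<partial>lborel \<partial>lborel)"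
  proof (rule nn_integral_cong)
    fix \<eta> :: real
    have "(\<lambda>x. ennreal (w (\<eta>, x)) * indicator A (?Z (\<eta>, x))) \<in> borel_measurable (lborel \<Otimes>\<^sub>M (lborel \<Otimes>\<^sub>M lborel))"
      by measurable
    from nn_integral_lborel3[OF this]
    show "(\<integral>\<^sup>+x. ennreal (w (\<eta>, x)) * indicator A (?Z (\<eta>, x)) \<partial>(lborel \<Otimes>\<^sub>M (lborel \<Otimes>\<^sub>M lborel)))
        = (\<integral>\<^sup>+k. \<integral>\<^sup>+s. \<integral>\<^sup>+t. ennreal (w (\<eta>, k, s, t)) * indicator A (Z k \<eta>) \<partial>lborel \<partial>lborel \<partial>lborel)"
      by simp
  qed
  also have "\<dots> = (\<integral>\<^sup>+\<eta>. \<integral>\<^sup>+k. ennreal (\<sigma>0 (Z k \<eta>)) * indicator A (Z k \<eta>) * ennreal (C k + \<eta>) \<partial>lborel \<partial>lborel)"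
  proof (intro nn_integral_cong)
    fix \<eta> k :: real
    have wm: "(\<lambda>(s, t). ennreal (w (\<eta>, k, s, t))) \<in> borel_measurable (lborel \<Otimes>\<^sub>M lborel)" by measurable
    have "(\<integral>\<^sup>+s. \<integral>\<^sup>+t. ennreal (w (\<eta>, k, s, t)) * indicator A (Z k \<eta>) \<partial>lborel \<partial>lborel)
        = (\<integral>\<^sup>+s. \<integral>\<^sup>+t. ennreal (w (\<eta>, k, s, t)) \<partial>lborel \<partial>lborel) * indicator A (Z k \<eta>)"
    proof -
      have "(\<integral>\<^sup>+t. ennreal (w (\<eta>, k, s, t)) * indicator A (Z k \<eta>) \<partial>lborel) = (\<integral>\<^sup>+t. ennreal (w (\<eta>, k, s, t)) \<partial>lborel) * indicator A (Z k \<eta>)" for s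
        by (rule nn_integral_multc) measurable
      then have "(\<integral>\<^sup>+s. \<integral>\<^sup>+t. ennreal (w (\<eta>, k, s, t)) * indicator A (Z k \<eta>) \<partial>lborel \<partial>lborel)
        = (\<integral>\<^sup>+s. (\<integral>\<^sup>+t. ennreal (w (\<eta>, k, s, t)) \<partial>lborel) * indicator A (Z k \<eta>) \<partial>lborel)" by presburger
      also have "\<dots> = (\<integral>\<^sup>+s. \<integral>\<^sup>+t. ennreal (w (\<eta>, k, s, t)) \<partial>lborel \<partial>lborel) * indicator A (Z k \<eta>)"
        using wm by (intro nn_integral_multc) measurable
      finally show ?thesis .
    qed
    also have "\<dots> = ennreal (\<sigma>0 (Z k \<eta>)) * indicator A (Z k \<eta>) * ennreal (C k + \<eta>)"
    proof (cases "0 < \<eta> \<and> \<eta> < 2 \<and> 0 < k \<and> k \<le> 1")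
      case True
      then have R: "Z k \<eta> \<in> Rs" by (auto simp: Rs_def py_def Z_def)
      have p: "0 < C k + \<eta>" using C_nonneg[of k] True by simp
      have "\<sigma>0 (Z k \<eta>) * (C k + \<eta>) = sqrt (1 + k\<^sup>2) * flux k \<eta>" using R True p by (simp add: \<sigma>0_def py_def)
      then have "ennreal (\<sigma>0 (Z k \<eta>)) * ennreal (C k + \<eta>) = ennreal (sqrt (1 + k\<^sup>2) * flux k \<eta>)"
        using \<sigma>0_bounds(1) p by (simp add: ennreal_mult[symmetric])
      then have "ennreal (\<sigma>0 (Z k \<eta>)) * indicator A (Z k \<eta>) * ennreal (C k + \<eta>) = ennreal (sqrt (1 + k\<^sup>2) * flux k \<eta>) * indicator A (Z k \<eta>)"
        by (metis mult.assoc mult.commute)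
      then show ?thesis using True unfolding nn_integral_w by simp
    next
      case False
      have "Z k \<eta> \<notin> Rs"
      proof
        assume "Z k \<eta> \<in> Rs"
        then have "0 < \<eta>" by (simp add: Rs_def py_def)
        with \<open>Z k \<eta> \<in> Rs\<close> False show False by (simp add: Rs_def py_def)
      qed
      then show ?thesis using False unfolding nn_integral_w by (auto simp: \<sigma>0_def)
    qed
    finally show "(\<integral>\<^sup>+s. \<integral>\<^sup>+t. ennreal (w (\<eta>, k, s, t)) * indicator A (Z k \<eta>) \<partial>lborel \<partial>lborel) = ennreal (\<sigma>0 (Z k \<eta>)) * indicator A (Z k \<eta>) * ennreal (C k + \<eta>)" .
  qed
  also have "\<dots> = (\<integral>\<^sup>+z. ennreal (\<sigma>0 z) * indicator A z \<partial>leb 2)"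
    by (rule nn_integral_leb2_rays[symmetric]) (auto simp: \<sigma>0_def Rs_def py_def)
  also have "\<dots> = emeasure ?R A" by (subst emeasure_density) auto
  finally show "emeasure (distr (density ?B (\<lambda>x. ennreal (w x))) borel ?Z) A = emeasure ?R A" .
qed simp

text \<open>Both sides are the integral of \<open>g (Z k \<eta>)\<close> against the density
  \<open>w\<close>: pushing forward to the plane gives \<open>\<sigma>0\<close>, whereas integrating
  over \<open>\<eta>\<close> alone gives the difference of \<open>ray_int g\<close> weighted by the
  plan.\<close>

lemma integral_ray_int_\<gamma>0:
  assumes gm [measurable]: "g \<in> borel_measurable borel" and B: "\<And>z. \<bar>g z\<bar> \<le> B * indicator Box z"
  shows "(\<integral>p. ray_int g (snd p) - ray_int g (fst p) \<partial>\<gamma>0) = (\<integral>z. \<sigma>0 z * g z \<partial>leb 2)"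
proof -
  let ?B3 = "lborel :: (real \<times> real \<times> real) measure"
  let ?B4 = "lborel \<Otimes>\<^sub>M ?B3"
  let ?Z = "\<lambda>(\<eta>, k, s, t). Z k \<eta>"
  have B3: "lborel \<Otimes>\<^sub>M (lborel \<Otimes>\<^sub>M lborel) = ?B3" by (simp add: lborel_prod)
  have B0: "0 \<le> B" using B[of "pt 0 0"] by (simp add: indicator_def)
  have B': "\<bar>g z\<bar> \<le> B" for z using B[of z] B0 by (cases "z \<in> Box") auto
  have Zm [measurable]: "?Z \<in> borel_measurable ?B4" unfolding B3[symmetric] case_prod_beta' by measurable
  have wm [measurable]: "w \<in> borel_measurable ?B4" using w_meas unfolding B3 .
  have dw: "distr (density ?B4 (\<lambda>x. ennreal (w x))) borel ?Z = density (leb 2) (\<lambda>z. ennreal (\<sigma>0 z))"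
    using distr_w unfolding B3 .
  have ig: "integrable (leb 2) (\<lambda>z. \<sigma>0 z * g z)"
  proof (rule integrable_leb2_Box[where B="4 * B"])
    fix z
    have "\<bar>\<sigma>0 z * g z\<bar> \<le> (4 * indicator Box z) * B" unfolding abs_mult using \<sigma>0_bounds(2)[of z] B'[of z] by (intro mult_mono) auto
    then show "\<bar>\<sigma>0 z * g z\<bar> \<le> 4 * B * indicator Box z" by (simp add: mult_ac)
  qed measurable
  then have "integrable (density (leb 2) (\<lambda>z. ennreal (\<sigma>0 z))) g"
    using \<sigma>0_bounds(1) by (subst integrable_density) auto
  then have iw: "integrable ?B4 (\<lambda>x. w x * g (?Z x))"
    unfolding dw[symmetric] using w_nonneg by (simp add: integrable_distr_eq integrable_density)
  have "(\<integral>z. \<sigma>0 z * g z \<partial>leb 2) = (\<integral>z. g z \<partial>density (leb 2) (\<lambda>z. ennreal (\<sigma>0 z)))"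
    using \<sigma>0_bounds(1) by (subst integral_density) auto
  also have "\<dots> = (\<integral>x. w x * g (?Z x) \<partial>?B4)"
    unfolding dw[symmetric] using w_nonneg by (simp add: integral_distr integral_density)
  \<comment> \<open>Fubini for a signed integrand; its integrability was carried over from that of
    \<open>\<sigma>0 z * g z\<close> through the pushforward.\<close>
  also have "\<dots> = (\<integral>x. \<integral>\<eta>. w (\<eta>, x) * g (?Z (\<eta>, x)) \<partial>lborel \<partial>?B3)"
    using lborel_pair.integral_snd[of "\<lambda>\<eta> x. w (\<eta>, x) * g (?Z (\<eta>, x))"] iw by (simp add: case_prod_beta')
  also have "\<dots> = (\<integral>x. (case x of (k, s, t) \<Rightarrow> plan_density k s t * (ray_int g (snd (clamp2 (Z k s, Z k t))) - ray_int g (fst (clamp2 (Z k s, Z k t))))) \<partial>?B3)"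
  proof (rule Bochner_Integration.integral_cong)
    fix x :: "real \<times> real \<times> real"
    obtain k s t where x: "x = (k, s, t)" by (cases x)
    have "(\<integral>\<eta>. w (\<eta>, k, s, t) * g (Z k \<eta>) \<partial>lborel) = plan_density k s t * (ray_int g (snd (clamp2 (Z k s, Z k t))) - ray_int g (fst (clamp2 (Z k s, Z k t))))"
    proof (cases "plan_density k s t = 0")
      case True
      then have "w (\<eta>, k, s, t) = 0" for \<eta> by (simp add: w_def)
      then show ?thesis using True by simp
    next
      case False
      note WZ = plan_density_Z[OF False]
      have st: "0 < s" "s < t" using WZ \<tau>_le[of k] by auto
      have "(\<integral>\<eta>. w (\<eta>, k, s, t) * g (Z k \<eta>) \<partial>lborel) = (\<integral>\<eta>. (plan_density k s t * sqrt (1 + k\<^sup>2)) * (if s < \<eta> \<and> \<eta> \<le> t then g (Z k \<eta>) else 0) \<partial>lborel)"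
        by (intro Bochner_Integration.integral_cong) (auto simp: w_def)
      also have "\<dots> = plan_density k s t * (ray_int g (Z k t) - ray_int g (Z k s))"
        unfolding ray_int_diff[OF gm B' st] by simp
      finally show ?thesis using WZ by simp
    qed
    then show "(\<integral>\<eta>. w (\<eta>, x) * g (?Z (\<eta>, x)) \<partial>lborel) = (case x of (k, s, t) \<Rightarrow> plan_density k s t * (ray_int g (snd (clamp2 (Z k s, Z k t))) - ray_int g (fst (clamp2 (Z k s, Z k t)))))"
      by (simp add: x)
  qed simp
  also have "\<dots> = (\<integral>p. ray_int g (snd p) - ray_int g (fst p) \<partial>\<gamma>0)"
  proof -
    have Xm: "(\<lambda>p. ray_int g (snd p) - ray_int g (fst p)) \<in> borel_measurable BB"
      by (rule measurable_restrict_space1) measurable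
    have cm3: "(\<lambda>(k, s, t). clamp2 (Z k s, Z k t)) \<in> ?B3 \<rightarrow>\<^sub>M BB"
      using clamp2_ZZ_meas unfolding B3 .
    have cm: "(\<lambda>(k, s, t). clamp2 (Z k s, Z k t)) \<in> density ?B3 (\<lambda>(k, s, t). ennreal (plan_density k s t)) \<rightarrow>\<^sub>M BB"
      using clamp2_ZZ_meas unfolding B3 by simp
    have Wm: "(\<lambda>x. plan_density (fst x) (fst (snd x)) (snd (snd x))) \<in> borel_measurable ?B3"
      unfolding B3[symmetric] by measurable
    have "(\<integral>p. ray_int g (snd p) - ray_int g (fst p) \<partial>\<gamma>0) = (\<integral>x. (\<lambda>p. ray_int g (snd p) - ray_int g (fst p)) (case x of (k, s, t) \<Rightarrow> clamp2 (Z k s, Z k t)) \<partial>density ?B3 (\<lambda>(k, s, t). ennreal (plan_density k s t)))"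
      unfolding \<gamma>0_def B3 by (rule integral_distr[OF cm Xm])
    also have "\<dots> = (\<integral>x. plan_density (fst x) (fst (snd x)) (snd (snd x)) *\<^sub>R (\<lambda>p. ray_int g (snd p) - ray_int g (fst p)) (case x of (k, s, t) \<Rightarrow> clamp2 (Z k s, Z k t)) \<partial>?B3)"
      unfolding case_prod_beta'
      using measurable_compose[OF cm3 Xm] plan_density_nonneg
      by (intro integral_density Wm) (auto simp: case_prod_beta')
    finally show ?thesis by (simp add: case_prod_beta')
  qed
  finally show ?thesis ..
qed

lemma seg_integral_eq:
  assumes O: "optimal_plan 2 Box fp fm \<gamma>" and \<phi>: "continuous_on Box \<phi>"
  shows "seg_integral \<gamma> \<phi> = (\<integral>z. \<sigma>0 z * \<phi> z \<partial>leb 2)"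
proof -
  define g where "g z = indicator Box z * \<phi> z" for z
  have gm: "g \<in> borel_measurable borel" unfolding g_def by (rule continuous_on_RR2_Box(1)[OF \<phi>])
  obtain B where B: "\<And>z. \<bar>g z\<bar> \<le> B * indicator Box z" using continuous_on_RR2_Box(2)[OF \<phi>] unfolding g_def by blast
  have "seg_integral \<gamma> \<phi> = seg_integral \<gamma>0 \<phi>" using seg_integral_optimal(2)[OF O \<phi>] seg_integral_optimal(2)[OF optimal_\<gamma>0 \<phi>] by simp
  also have "\<dots> = (\<integral>z. \<sigma>0 z * g z \<partial>leb 2)"
    using seg_integral_optimal(1)[OF optimal_\<gamma>0 \<phi>] integral_ray_int_\<gamma>0[OF gm B] by (simp add: g_def)
  also have "\<dots> = (\<integral>z. \<sigma>0 z * \<phi> z \<partial>leb 2)"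
    using Rs_Box0 Box0_int int_Box_subset by (intro Bochner_Integration.integral_cong) (auto simp: \<sigma>0_def g_def indicator_def)
  finally show ?thesis .
qed

lemma finite_\<sigma>0: "finite_measure (fun_measure 2 Box \<sigma>0)"
proof (rule finite_measureI)
  have "emeasure (fun_measure 2 Box \<sigma>0) Box = (\<integral>\<^sup>+z. 1 \<partial>fun_measure 2 Box \<sigma>0)" by simp
  also have "\<dots> = (\<integral>\<^sup>+z. ennreal (\<sigma>0 z) \<partial>leb 2)"
    by (subst nn_integral_fun_measure) auto
  also have "\<dots> = ennreal (\<integral>z. \<sigma>0 z \<partial>leb 2)"
    using \<sigma>0_bounds(1) by (intro nn_integral_eq_integral integrable_\<sigma>0) auto
  finally show "emeasure (fun_measure 2 Box \<sigma>0) (space (fun_measure 2 Box \<sigma>0)) \<noteq> \<infinity>" by simp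
qed

lemma transport_density_\<sigma>0: "is_transport_density 2 Box fp fm \<sigma>0"
  unfolding is_transport_density_def transport_density_measure_def
proof (intro conjI exI[of _ \<gamma>0] ballI allI impI)
  show "set_integrable (leb 2) (int_of 2 Box) \<sigma>0"
    unfolding set_integrable_def using integrable_\<sigma>0 by simp
  fix \<phi> :: "(nat \<Rightarrow> real) \<Rightarrow> real" assume \<phi>: "continuous_on Box \<phi>"
  have "(\<integral>z. \<phi> z \<partial>fun_measure 2 Box \<sigma>0) = (\<integral>z. \<sigma>0 z * \<phi> z \<partial>leb 2)"
    using \<sigma>0_bounds(1) by (subst integral_fun_measure) (auto intro: continuous_on_Box_restrict[OF \<phi>])
  then show "(\<integral>z. \<phi> z \<partial>fun_measure 2 Box \<sigma>0) = (\<integral>(x, y). (LBINT t:{0..1}. \<phi> (seg_point x y t) * edist 2 x y) \<partial>\<gamma>0)"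
    using seg_integral_eq[OF optimal_\<gamma>0 \<phi>] by (simp add: seg_integral_def)
qed (use finite_\<sigma>0 optimal_\<gamma>0 \<sigma>0_bounds(1) in auto)

text \<open>A candidate \<open>\<sigma>\<close> comes with an optimal plan of its own, so it is
  compared with \<open>\<sigma>0\<close> through continuous test functions. This weak form fits the
  definition of variation, as the divergence of a \<open>C1\<close> field is continuous.\<close>

lemma transport_density_unique:
  assumes s: "is_transport_density 2 Box fp fm \<sigma>" and \<phi>: "continuous_on Box \<phi>"
  shows "(LINT z:int_of 2 Box|leb 2. \<sigma> z * \<phi> z) = (\<integral>z. \<sigma>0 z * \<phi> z \<partial>leb 2)"
proof -
  obtain \<gamma> where O: "optimal_plan 2 Box fp fm \<gamma>" and e: "(\<integral>z. \<phi> z \<partial>fun_measure 2 Box \<sigma>) = seg_integral \<gamma> \<phi>"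
    and si: "set_integrable (leb 2) (int_of 2 Box) \<sigma>" and nn: "\<And>z. z \<in> int_of 2 Box \<Longrightarrow> 0 \<le> \<sigma> z"
    using s \<phi> unfolding is_transport_density_def transport_density_measure_def seg_integral_def by blast
  have "(\<lambda>z. indicator (int_of 2 Box) z * \<sigma> z) \<in> borel_measurable borel"
    using si unfolding set_integrable_def by (auto dest!: borel_measurable_integrable)
  then have "(\<integral>z. \<phi> z \<partial>fun_measure 2 Box \<sigma>) = (LINT z:int_of 2 Box|leb 2. \<sigma> z * \<phi> z)"
    unfolding set_lebesgue_integral_def
    by (subst integral_fun_measure) (auto intro: continuous_on_Box_restrict[OF \<phi>] nn simp: mult.assoc)
  then show ?thesis using e seg_integral_eq[OF O \<phi>] by simp
qed

lemma equal_mass: "(LINT x:int_of 2 Box|leb 2. fp x) = (LINT x:int_of 2 Box|leb 2. fm x)"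
proof -
  have "(\<integral>z. 1 \<partial>fun_measure 2 Box fp) = (\<integral>p. (1::real) \<partial>\<gamma>0)" "(\<integral>z. 1 \<partial>fun_measure 2 Box fm) = (\<integral>p. (1::real) \<partial>\<gamma>0)"
    using plan_integral[OF transport_plan_\<gamma>0, of "\<lambda>_. 1"] by auto
  then have "(\<integral>z. 1 \<partial>fun_measure 2 Box fp) = (\<integral>z. (1::real) \<partial>fun_measure 2 Box fm)" by simp
  then show ?thesis unfolding set_lebesgue_integral_def
    by (subst (asm) (1 2) integral_fun_measure) (auto simp: fp_nonneg fm_nonneg)
qed

end

subsection \<open>Smooth steps\<close>

lemma DERIV_pos_part_sq: "((\<lambda>t. (max 0 t)\<^sup>2) has_real_derivative 2 * max 0 t) (at (t::real))"
proof -
  consider "t > 0" | "t < 0" | "t = 0" by linarith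
  then show ?thesis
  proof cases
    case 1
    have "((\<lambda>t. t\<^sup>2) has_real_derivative 2 * max 0 t) (at t)" using 1 by (auto intro!: derivative_eq_intros)
    then show ?thesis by (rule has_field_derivative_transform_within_open[where S="{0<..}"]) (use 1 in auto)
  next
    case 2
    have "((\<lambda>t. 0) has_real_derivative 2 * max 0 t) (at t)" using 2 by simp
    then show ?thesis by (rule has_field_derivative_transform_within_open[where S="{..<0}"]) (use 2 in auto)
  next
    case 3
    have "(\<lambda>h. ((max 0 (0 + h))\<^sup>2 - (max 0 0)\<^sup>2) / h) \<midarrow>0\<rightarrow> (0::real)"
    proof (rule Lim_null_comparison)
      show "\<forall>\<^sub>F h in at 0. norm (((max 0 (0 + h))\<^sup>2 - (max 0 0)\<^sup>2) / h) \<le> \<bar>h::real\<bar>"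
        by (intro always_eventually allI) (auto simp: max_def power2_eq_square)
      show "(\<lambda>h. \<bar>h\<bar>) \<midarrow>0\<rightarrow> (0::real)" by (rule tendsto_rabs_zero) (rule tendsto_ident_at)
    qed
    then show ?thesis using 3 by (simp add: DERIV_def)
  qed
qed

text \<open>A \<open>C1\<close> transition from \<open>0\<close> to \<open>1\<close> across
  \<open>{0..1}\<close>: the square of a positive part is \<open>C1\<close>, and the two squares in
  the denominator never vanish together.\<close>

definition step :: "real \<Rightarrow> real" where
  "step t = (max 0 t)\<^sup>2 / ((max 0 t)\<^sup>2 + (max 0 (1 - t))\<^sup>2)"

definition step' :: "real \<Rightarrow> real" where
  "step' t = 2 * (max 0 t * (max 0 (1 - t))\<^sup>2 + (max 0 t)\<^sup>2 * max 0 (1 - t)) / ((max 0 t)\<^sup>2 + (max 0 (1 - t))\<^sup>2)\<^sup>2"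

lemma step_den: "(max 0 t)\<^sup>2 + (max 0 (1 - t))\<^sup>2 > (0::real)"
  by (cases "t > 0") (auto simp: add_pos_nonneg add_nonneg_pos)

lemma step_deriv: "(step has_real_derivative step' t) (at t)"
proof -
  define a a' b b' where "a = (max 0 t)\<^sup>2" and "a' = 2 * max 0 t" and "b = (max 0 (1 - t))\<^sup>2" and "b' = 2 * max 0 (1 - t)"
  have "((\<lambda>t. (max 0 (1 - t))\<^sup>2) has_real_derivative b' * (-1)) (at t)"
    unfolding b'_def by (rule DERIV_chain2[OF DERIV_pos_part_sq]) (auto intro!: derivative_eq_intros)
  then have "(step has_real_derivative (a' * (a + b) - a * (a' + b' * (-1))) / ((a + b) * (a + b))) (at t)"
    unfolding step_def[abs_def] a_def a'_def b_def using step_den[of t]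
    by (intro DERIV_divide DERIV_add DERIV_pos_part_sq) auto
  also have "(a' * (a + b) - a * (a' + b' * (-1))) / ((a + b) * (a + b)) = step' t"
    by (simp add: step'_def a_def b_def a'_def b'_def algebra_simps power2_eq_square)
  finally show ?thesis .
qed

lemma step_cont [continuous_intros]: "continuous_on A f \<Longrightarrow> continuous_on A (\<lambda>x. step (f x))"
  unfolding step_def using step_den by (auto intro!: continuous_intros simp: less_imp_neq[symmetric])

lemma step'_cont [continuous_intros]: "continuous_on A f \<Longrightarrow> continuous_on A (\<lambda>x. step' (f x))"
  unfolding step'_def using step_den by (auto intro!: continuous_intros simp: less_imp_neq[symmetric])

lemma step_0 [simp]: "t \<le> 0 \<Longrightarrow> step t = 0" by (simp add: step_def)
lemma step_1 [simp]: "t \<ge> 1 \<Longrightarrow> step t = 1" using step_den[of t] by (simp add: step_def)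
lemma step_bounds: "0 \<le> step t" "step t \<le> 1" using step_den[of t] by (auto simp: step_def)
lemma step'_nonneg: "0 \<le> step' t" unfolding step'_def by simp
lemma step'_supp: "step' t \<noteq> 0 \<Longrightarrow> 0 < t \<and> t < 1" by (cases "0 < t"; cases "t < 1") (auto simp: step'_def)

text \<open>The derivative of a ramp of length \<open>d\<close> is a probability density carried by
  \<open>{a..a + d}\<close>; it will average the transport density on one side of an
  interface.\<close>

lemma step'_integral:
  fixes a d :: real
  assumes d: "d > 0"
  shows "integrable lborel (\<lambda>x. step' ((x - a) / d) / d)" "(\<integral>x. step' ((x - a) / d) / d \<partial>lborel) = 1"
proof -
  have D: "((\<lambda>x. step ((x - a) / d)) has_real_derivative step' ((x - a) / d) * (1 / d)) (at x)" for x
    by (rule DERIV_chain2[OF step_deriv]) (use d in \<open>auto intro!: derivative_eq_intros\<close>)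
  have eq: "step' ((x - a) / d) / d * indicator {a..a+d} x = step' ((x - a) / d) / d" for x
  proof (cases "step' ((x - a) / d) = 0")
    case False
    from step'_supp[OF this] show ?thesis using d by (auto simp: field_simps indicator_def)
  qed simp
  have c: "isCont (\<lambda>x. step' ((x - a) / d) / d) x" for x
    using d by (intro continuous_on_interior[where S=UNIV] continuous_intros) auto
  show "integrable lborel (\<lambda>x. step' ((x - a) / d) / d)"
    using borel_integrable_atLeastAtMost[of a "a + d" "\<lambda>x. step' ((x - a) / d) / d"] c
    by (simp only: eq)
  have "(\<integral>x. step' ((x - a) / d) / d * indicator {a..a+d} x \<partial>lborel) = step ((a + d - a) / d) - step ((a - a) / d)"
    by (rule integral_FTC_Icc_real[where F="\<lambda>x. step ((x - a) / d)"]) (use d D c in auto)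
  then show "(\<integral>x. step' ((x - a) / d) / d \<partial>lborel) = 1" using d unfolding eq by simp
qed

lemma C1_fun_plane:
  assumes f: "\<And>z. f z = G (z 0) (z 1)"
    and dx: "\<And>x y. ((\<lambda>s. G s y) has_real_derivative Gx x y) (at x)"
    and dy: "\<And>x y. ((\<lambda>s. G x s) has_real_derivative Gy x y) (at y)"
    and c: "continuous_on UNIV (\<lambda>z::nat\<Rightarrow>real. G (z 0) (z 1))"
    and cx: "continuous_on UNIV (\<lambda>z::nat\<Rightarrow>real. Gx (z 0) (z 1))"
    and cy: "continuous_on UNIV (\<lambda>z::nat\<Rightarrow>real. Gy (z 0) (z 1))"
  shows "C1_fun 2 f" "partial_deriv 0 f z = Gx (z 0) (z 1)"
proof -
  have x: "(\<lambda>s. f (z(0 := s))) = (\<lambda>s. G s (z 1))" "(\<lambda>s. f (z(1 := s))) = (\<lambda>s. G (z 0) s)" for z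
    by (auto simp: f)
  show p0: "partial_deriv 0 f z = Gx (z 0) (z 1)" for z
    unfolding partial_deriv_def x by (rule DERIV_imp_deriv[OF dx])
  have p1: "partial_deriv 1 f z = Gy (z 0) (z 1)" for z
    unfolding partial_deriv_def x by (rule DERIV_imp_deriv[OF dy])
  have *: "(\<lambda>s. f (z(i := s))) differentiable (at (z i)) \<and> continuous_on (RR 2) (partial_deriv i f)" if "i < 2" for i z
  proof -
    from that consider "i = 0" | "i = 1" by linarith
    then show ?thesis
    proof cases
      case 1
      have "continuous_on (RR 2) (partial_deriv 0 f)" unfolding p0[abs_def] by (rule continuous_on_subset[OF cx]) simp
      then show ?thesis using dx[of "z 1" "z 0"] unfolding 1 x by (auto simp: real_differentiable_def)
    next
      case 2
      have "continuous_on (RR 2) (partial_deriv 1 f)" unfolding p1[abs_def] by (rule continuous_on_subset[OF cy]) simp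
      then show ?thesis using dy[of "z 0" "z 1"] unfolding 2 x by (auto simp: real_differentiable_def)
    qed
  qed
  have "continuous_on (RR 2) f" unfolding f[abs_def] by (rule continuous_on_subset[OF c]) simp
  then show "C1_fun 2 f" unfolding C1_fun_def using * by blast
qed

text \<open>Serves the indexing by pieces, where \<open>2 * n\<close> and \<open>2 * n + 1\<close>
  share the value \<open>e n\<close>.\<close>

lemma summable_div2:
  fixes f :: "nat \<Rightarrow> real"
  assumes f: "summable f" "\<And>n. 0 \<le> f n"
  shows "summable (\<lambda>j. f (j div 2))"
proof (rule summableI_nonneg_bounded)
  show "0 \<le> f (j div 2)" for j by (rule f(2))
  fix n
  have e: "(\<Sum>j<2*n. f (j div 2)) = 2 * (\<Sum>i<n. f i)" for n
    by (induction n) auto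
  have "(\<Sum>j<n. f (j div 2)) \<le> (\<Sum>j<2*n. f (j div 2))" by (rule sum_mono2) (use f in auto)
  also have "\<dots> \<le> 2 * suminf f" unfolding e using sum_le_suminf[OF f(1), of "{..<n}"] f(2) by simp
  finally show "(\<Sum>j<n. f (j div 2)) \<le> 2 * suminf f" .
qed

section \<open>Slices of regions described by rays\<close>

context rays
begin

lemma K_mono_x: "y > 0 \<Longrightarrow> x \<le> x' \<Longrightarrow> K (pt x y) \<le> K (pt x' y)"
  using K_le_iff[of "pt x y" "K (pt x' y)"] ray_K[of "pt x' y"] by simp

text \<open>A ray of nonnegative slope drifts to the right as it rises, so going straight down from
  one of its points leads to rays of larger slope.\<close>

lemma K_antimono_y: "0 < y \<Longrightarrow> y \<le> y' \<Longrightarrow> 0 \<le> K (pt x y') \<Longrightarrow> K (pt x y') \<le> K (pt x y)"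
proof -
  assume y: "0 < y" "y \<le> y'" and k: "0 \<le> K (pt x y')"
  have "\<xi> (K (pt x y')) + K (pt x y') * y \<le> \<xi> (K (pt x y')) + K (pt x y') * y'"
    using y k by (simp add: mult_left_mono)
  also have "\<dots> = x" using ray_K[of "pt x y'"] y by simp
  finally show ?thesis using K_less_iff[of "pt x y" "K (pt x y')"] y by (simp add: not_less[symmetric])
qed

text \<open>Slopes increase along horizontal lines and decrease upwards along vertical ones, so a
  sector of rays has interval slices. Monotonicity of \<open>T\<close> preserves this under the
  upper bound: moving right, or down, never lowers the ceiling \<open>T (K z)\<close>.\<close>

lemma region_slices:
  assumes R: "\<And>x y. pt x y \<in> R \<longleftrightarrow> l < y \<and> K (pt x y) \<in> A \<and> y < T (K (pt x y))"
    and l: "0 \<le> l" and A: "A \<subseteq> {0<..}" "\<And>a b c. a \<in> A \<Longrightarrow> c \<in> A \<Longrightarrow> a \<le> b \<Longrightarrow> b \<le> c \<Longrightarrow> b \<in> A"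
    and T: "\<And>a b. a \<in> A \<Longrightarrow> b \<in> A \<Longrightarrow> a \<le> b \<Longrightarrow> T a \<le> (T b :: real)"
  shows "is_interval {x. pt x y \<in> R}" "is_interval {y. pt x y \<in> R}"
proof -
  show "is_interval {x. pt x y \<in> R}"
    unfolding is_interval_1
  proof (intro ballI allI impI, elim conjE)
    fix a b x assume ab: "a \<in> {x. pt x y \<in> R}" "b \<in> {x. pt x y \<in> R}" and x: "a \<le> x" "x \<le> b"
    have y: "y > 0" "l < y" using ab l by (auto simp: R)
    have K: "K (pt a y) \<le> K (pt x y)" "K (pt x y) \<le> K (pt b y)" using K_mono_x[OF y(1)] x by auto
    have "K (pt x y) \<in> A" using A(2)[OF _ _ K] ab by (auto simp: R)
    moreover have "y < T (K (pt x y))" using T[OF _ \<open>K (pt x y) \<in> A\<close> K(1)] ab(1) by (auto simp: R intro: less_le_trans)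
    ultimately show "x \<in> {x. pt x y \<in> R}" using y by (simp add: R)
  qed
  show "is_interval {y. pt x y \<in> R}"
    unfolding is_interval_1
  proof (intro ballI allI impI, elim conjE)
    fix a b y assume ab: "a \<in> {y. pt x y \<in> R}" "b \<in> {y. pt x y \<in> R}" and y: "a \<le> y" "y \<le> b"
    have a: "a > 0" "l < a" using ab l by (auto simp: R)
    have Kb: "K (pt x b) \<in> A" "K (pt x a) \<in> A" using ab by (auto simp: R)
    then have pb: "0 \<le> K (pt x b)" using A(1) by force
    have K1: "K (pt x b) \<le> K (pt x y)" using K_antimono_y[of y b x] a y pb by simp
    have K2: "K (pt x y) \<le> K (pt x a)" using K_antimono_y[of a y x] a y pb K1 by simp
    have "K (pt x y) \<in> A" using A(2)[OF Kb K1 K2] .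
    moreover have "y < T (K (pt x y))" using T[OF Kb(1) \<open>K (pt x y) \<in> A\<close> K1] ab(2) y by (auto simp: R)
    ultimately show "y \<in> {y. pt x y \<in> R}" using a y by (simp add: R)
  qed
qed

end

subsection \<open>Step-like ray families\<close>

text \<open>\<open>piece k = j\<close> means \<open>2 / (j + 1) < k \<le> 2 / j\<close>; the pieces \<open>2 n + 1\<close> and \<open>2 n\<close> form the \<open>n\<close>-th pair.\<close>

locale steps =
  fixes e :: "nat \<Rightarrow> real"
  assumes e_dec: "decseq e" and e_pos: "0 < e n" and e_le: "e n \<le> 1/4"
    and e_sum: "summable (\<lambda>n. (e n)\<^sup>2)" and e_div: "\<not> summable (\<lambda>n. (e n)\<^sup>2 * ln (1 / e n))"
begin

definition piece :: "real \<Rightarrow> nat" where "piece k = nat \<lfloor>2 / k\<rfloor>"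
text \<open>On \<open>{0<..1}\<close> the index of a piece is at least \<open>2\<close>, so only
  pairs with \<open>n \<ge> 1\<close> occur. The even piece of a pair has the larger slopes and the
  larger value. The bound \<open>e n \<le> 1/4\<close> keeps the doubled value within the limit
  \<open>1/2\<close> imposed on \<open>C\<close>.\<close>

definition c_val :: "nat \<Rightarrow> real" where "c_val j = (if even j then 2 else 1) * e (j div 2)"
definition C_step :: "real \<Rightarrow> real" where "C_step k = (if 0 < k \<and> k \<le> 1 then c_val (piece k) else 0)"
definition tau_step :: "real \<Rightarrow> real" where "tau_step k = e (piece k div 2)"

lemma piece_comp_meas: "(\<lambda>k. (f (piece k) :: real)) \<in> borel_measurable borel"
proof -
  have "(\<lambda>k::real. \<lfloor>2 / k\<rfloor>) \<in> borel \<rightarrow>\<^sub>M count_space UNIV" by measurable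
  from measurable_compose[OF this, of "\<lambda>i. f (nat i)" borel] show ?thesis by (simp add: piece_def)
qed

lemma piece_set_meas [measurable]: "{k. piece k = j} \<in> sets borel"
proof -
  have "{k. piece k = j} = (\<lambda>k. if piece k = j then 1 else 0 :: real) -` {1} \<inter> space borel" by (auto split: if_splits)
  also have "\<dots> \<in> sets borel"
    by (rule measurable_sets[OF piece_comp_meas[of "\<lambda>i. if i = j then 1 else 0"]]) simp
  finally show ?thesis .
qed

lemma c_val_bounds: "0 \<le> c_val j" "c_val j \<le> 1/2"
  using e_pos[of "j div 2"] e_le[of "j div 2"] by (auto simp: c_val_def)

sublocale transport_rays C_step tau_step
proof
  have [measurable]: "(\<lambda>k. c_val (piece k)) \<in> borel_measurable borel" by (rule piece_comp_meas)
  show "C_step \<in> borel_measurable borel" unfolding C_step_def[abs_def] by measurable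
  show "tau_step \<in> borel_measurable borel" unfolding tau_step_def[abs_def] by (rule piece_comp_meas)
  fix k
  show "0 \<le> C_step k" "C_step k \<le> 1/2" using c_val_bounds by (auto simp: C_step_def)
  show "k \<notin> {0<..1} \<Longrightarrow> C_step k = 0" by (auto simp: C_step_def)
  show "0 < tau_step k" "tau_step k \<le> 1" using e_pos e_le[of "piece k div 2"] by (auto simp: tau_step_def)
qed

section \<open>Bounded variation of source and target\<close>

lemma piece_antimono: "0 < k \<Longrightarrow> k \<le> k' \<Longrightarrow> piece k' \<le> piece k"
  unfolding piece_def by (intro nat_mono floor_mono divide_left_mono) auto

text \<open>Larger slopes have smaller indices and \<open>e\<close> is decreasing; this is the
  monotone ceiling that the source layer needs.\<close>

lemma tau_step_mono: "0 < k \<Longrightarrow> k \<le> k' \<Longrightarrow> tau_step k \<le> tau_step k'"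
  unfolding tau_step_def using piece_antimono[of k k'] by (intro decseqD[OF e_dec] div_le_mono)

text \<open>The layer as a whole has interval slices, so a single indicator suffices although the
  ceiling jumps infinitely often.\<close>

lemma fp_BV: "fp \<in> BV 2 Box"
proof (rule BV_sum_indicators[where a="\<lambda>j. if j = 0 then 1 else 0" and E="\<lambda>j. Rp"])
  have R: "pt x y \<in> Rp \<longleftrightarrow> 0 < y \<and> K (pt x y) \<in> {0<..1} \<and> y < tau_step (K (pt x y))" for x y
    by (auto simp: Rp_def)
  show "is_interval {x. pt x y \<in> Rp}" "is_interval {y. pt x y \<in> Rp}" for x y
    by (rule region_slices[OF R]; use tau_step_mono in auto)+
  fix z
  have "(\<Sum>j. (if j = 0 then 1 else 0) * indicator Rp z) = (\<Sum>j\<in>{0::nat}. (if j = 0 then 1 else 0) * indicat_real Rp z)"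
    by (rule suminf_finite) auto
  then show "fp z = (\<Sum>j::nat. (if j = 0 then 1 else 0) * indicator Rp z)" by (simp add: fp_def)
qed (use Rp_Box0 summable_single[of 0 "\<lambda>_. 1"] in \<open>auto intro: summable_finite[of "{0}"]\<close>)

definition bb :: "nat \<Rightarrow> real" where
  "bb j = (c_val j * e (j div 2) + (e (j div 2))\<^sup>2 / 2) / (c_val j + 3/2)"

lemma b_eq: "k \<in> {0<..1} \<Longrightarrow> b k = bb (piece k)"
  by (simp add: b_def bb_def m_def C_step_def tau_step_def)

lemma bb_bounds: "0 \<le> bb j" "bb j \<le> 5/2 * (e (j div 2))\<^sup>2"
proof -
  define x where "x = e (j div 2)"
  have x: "0 < x" using e_pos by (simp add: x_def)
  have c: "0 \<le> c_val j" "c_val j * x \<le> 2 * x\<^sup>2" using x by (auto simp: c_val_def x_def power2_eq_square)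
  have n: "0 \<le> c_val j * x + x\<^sup>2 / 2" using c x by simp
  show "0 \<le> bb j" using n c unfolding bb_def x_def[symmetric] by simp
  \<comment> \<open>The denominator is at least \<open>1\<close>, and
    \<open>c_val j \<le> 2 * x\<close> bounds the numerator by \<open>5/2 * x\<^sup>2\<close>, the
    value in an even piece.\<close>
  have "bb j \<le> (c_val j * x + x\<^sup>2 / 2) / 1" unfolding bb_def x_def[symmetric] using n c by (intro divide_left_mono) auto
  then show "bb j \<le> 5/2 * (e (j div 2))\<^sup>2" using c unfolding x_def[symmetric] by simp
qed

text \<open>On each piece the target is a constant of order \<open>(e n)\<^sup>2\<close> over a
  sector with interval slices, so summability of the squares suffices.\<close>

lemma fm_BV: "fm \<in> BV 2 Box"
proof (rule BV_sum_indicators[where a=bb and E="\<lambda>j. {z \<in> Rm. piece (K z) = j}"])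
  show "summable bb"
    by (rule summable_comparison_test'[OF summable_mult[OF summable_div2[OF e_sum], of "5/2"], of 0])
       (use bb_bounds in auto)
  fix j
  show "{z \<in> Rm. piece (K z) = j} \<in> sets borel"
  proof -
    have "{z \<in> Rm. piece (K z) = j} = Rm \<inter> (K -` {k. piece k = j} \<inter> space borel)" by auto
    also have "\<dots> \<in> sets borel" by (intro sets.Int Rm_sets measurable_sets[OF K_meas] piece_set_meas)
    finally show ?thesis .
  qed
  have R: "pt x y \<in> {z \<in> Rm. piece (K z) = j} \<longleftrightarrow> 1 < y \<and> K (pt x y) \<in> {k\<in>{0<..1}. piece k = j} \<and> y < (\<lambda>_. 2) (K (pt x y))" for x y
    by (auto simp: Rm_def)
  have A: "c \<in> {k\<in>{0<..1}. piece k = j}" if "a \<in> {k\<in>{0<..1}. piece k = j}" "d \<in> {k\<in>{0<..1}. piece k = j}" "a \<le> c" "c \<le> d" for a c d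
    using that piece_antimono[of a c] piece_antimono[of c d] by auto
  show "is_interval {x. pt x y \<in> {z \<in> Rm. piece (K z) = j}}" "is_interval {y. pt x y \<in> {z \<in> Rm. piece (K z) = j}}" for x y
    by (rule region_slices[OF R _ _ A]; auto)+
next
  fix z
  show "fm z = (\<Sum>j. bb j * indicator {z \<in> Rm. piece (K z) = j} z)"
  proof (cases "z \<in> Rm")
    case True
    then have k: "K z \<in> {0<..1}" by (auto simp: Rm_def)
    have "(\<Sum>j. bb j * indicator {z \<in> Rm. piece (K z) = j} z) = (\<Sum>j\<in>{piece (K z)}. bb j * indicator {z \<in> Rm. piece (K z) = j} z)"
      by (rule suminf_finite) auto
    then show ?thesis using True k by (simp add: fm_def b_eq)
  qed (simp add: fm_def)
qed (use bb_bounds Rm_Box0 in auto)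

subsection \<open>Unbounded variation of the transport density\<close>

text \<open>The test functions are \<open>- 1\<close> between a ramp at the left end of piece \<open>2 n + 1\<close> and a ramp at the left
  end of piece \<open>2 n\<close>, so that their \<open>x\<close>-derivative picks up the jump of the density between the two.\<close>

definition line :: "nat \<Rightarrow> real \<Rightarrow> real" where
  "line j y = \<xi> (2 / real j) + 2 / real j * y"

text \<open>The slope gap of piece \<open>2 * n + 1\<close> times the lowest height of interest.
  Rays spread as they rise, so a ramp of this length fits at every height
  \<open>y \<ge> e n\<close>, and a length independent of \<open>y\<close> keeps the derivatives
  simple.\<close>

definition width :: "nat \<Rightarrow> real" where
  "width n = e n * (2 / real (2*n+1) - 2 / real (2*n+2))"

text \<open>Rises between \<open>e n\<close> and \<open>2 * e n\<close> and falls between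
  \<open>1/2\<close> and \<open>1\<close>. Below \<open>e n\<close> the source layer has not been
  left and the ramps need not fit; above \<open>1\<close> the target layer begins.\<close>

definition cutoff :: "nat \<Rightarrow> real \<Rightarrow> real" where
  "cutoff n y = step ((y - e n) / e n) * step (2 * (1 - y))"

definition bump :: "nat \<Rightarrow> real \<Rightarrow> real \<Rightarrow> real" where
  "bump n x y = cutoff n y * (step ((x - line (2*n+1) y) / width n) - step ((x - line (2*n+2) y) / width n))"

definition bump_x :: "nat \<Rightarrow> real \<Rightarrow> real \<Rightarrow> real" where
  "bump_x n x y = cutoff n y * (step' ((x - line (2*n+1) y) / width n) / width n - step' ((x - line (2*n+2) y) / width n) / width n)"

definition cutoff' :: "nat \<Rightarrow> real \<Rightarrow> real" where
  "cutoff' n y = step' ((y - e n) / e n) / e n * step (2 * (1 - y)) + step ((y - e n) / e n) * (step' (2 * (1 - y)) * (-2))"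

text \<open>Serves the \<open>C1\<close> requirement: the test field is horizontal, so its
  divergence is built from \<open>bump_x\<close>.\<close>

definition bump_y :: "nat \<Rightarrow> real \<Rightarrow> real \<Rightarrow> real" where
  "bump_y n x y = cutoff' n y * (step ((x - line (2*n+1) y) / width n) - step ((x - line (2*n+2) y) / width n))
    + cutoff n y * (step' ((x - line (2*n+1) y) / width n) * (- (2 / real (2*n+1)) / width n) - step' ((x - line (2*n+2) y) / width n) * (- (2 / real (2*n+2)) / width n))"

lemma width_pos: "0 < width n"
proof -
  have "2 / real (2*n+2) < 2 / real (2*n+1)" by (rule divide_strict_left_mono) auto
  then show ?thesis unfolding width_def using e_pos[of n] by (intro mult_pos_pos) linarith+
qed

lemma bump_dx: "((\<lambda>s. bump n s y) has_real_derivative bump_x n x y) (at x)"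
proof -
  have D: "((\<lambda>s. step ((s - a) / width n)) has_real_derivative step' ((x - a) / width n) * (1 / width n)) (at x)" for a
    by (rule DERIV_chain2[OF step_deriv]) (use width_pos[of n] in \<open>auto intro!: derivative_eq_intros\<close>)
  show ?thesis unfolding bump_def bump_x_def
    using DERIV_cmult[OF DERIV_diff[OF D[of "line (2*n+1) y"] D[of "line (2*n+2) y"]], of "cutoff n y"] by simp
qed

lemma bump_dy: "((\<lambda>s. bump n x s) has_real_derivative bump_y n x y) (at y)"
proof -
  have L: "((\<lambda>s. step ((x - line j s) / width n)) has_real_derivative step' ((x - line j y) / width n) * (- (2 / real j) / width n)) (at y)" for j
  proof (rule DERIV_chain2[OF step_deriv])
    have "((\<lambda>s. (x - line j s) / width n) has_real_derivative (0 - (0 + 2 / real j * 1)) / width n) (at y)"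
      unfolding line_def by (intro DERIV_cdivide DERIV_diff DERIV_const DERIV_add DERIV_cmult DERIV_ident)
    then show "((\<lambda>s. (x - line j s) / width n) has_real_derivative - (2 / real j) / width n) (at y)" by simp
  qed
  have R1: "((\<lambda>s. step ((s - e n) / e n)) has_real_derivative step' ((y - e n) / e n) * (1 / e n)) (at y)"
    by (rule DERIV_chain2[OF step_deriv]) (use e_pos[of n] in \<open>auto intro!: derivative_eq_intros\<close>)
  have R2: "((\<lambda>s. step (2 * (1 - s))) has_real_derivative step' (2 * (1 - y)) * (-2)) (at y)"
    by (rule DERIV_chain2[OF step_deriv]) (auto intro!: derivative_eq_intros)
  have R: "((\<lambda>s. cutoff n s) has_real_derivative cutoff' n y) (at y)"
    unfolding cutoff_def cutoff'_def using DERIV_mult[OF R1 R2] by (simp add: mult.commute add.commute)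
  show ?thesis unfolding bump_def bump_y_def
    using DERIV_mult[OF R DERIV_diff[OF L[of "2*n+1"] L[of "2*n+2"]]] by (simp add: mult.commute)
qed

text \<open>At height \<open>y\<close> two neighbouring lines are at least \<open>y\<close> times
  their slope gap apart, the feet adding a nonnegative amount. The gaps
  \<open>2 / (j * (j + 1))\<close> decrease in \<open>j\<close>, so a ramp fitted to piece
  \<open>2 * n + 1\<close> also fits into piece \<open>2 * n\<close>.\<close>

lemma line_gap:
  assumes y: "e n \<le> y" and n: "1 \<le> n"
  shows "line (2*n+2) y + width n \<le> line (2*n+1) y" "line (2*n+1) y + width n \<le> line (2*n) y"
proof -
  define g where "g = 2 / real (2*n+1) - 2 / real (2*n+2)"
  have g0: "0 \<le> g" by (simp add: g_def frac_le)
  have gg: "g \<le> 2 / real (2*n) - 2 / real (2*n+1)"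
  proof -
    have f: "2 / a - 2 / (a + 1) = 2 / (a * (a + 1))" if "a > 0" for a :: real
      using that by (simp add: field_simps)
    define a where "a = real (2*n)"
    have a: "a > 0" "real (2*n+1) = a + 1" "real (2*n+2) = a + 1 + 1" using n by (auto simp: a_def)
    have "g = 2 / ((a + 1) * (a + 1 + 1))" unfolding g_def a(2,3) using a(1) by (intro f) simp
    also have "\<dots> \<le> 2 / (a * (a + 1))" using a(1) by (intro divide_left_mono mult_mono) auto
    also have "\<dots> = 2 / real (2*n) - 2 / real (2*n+1)" unfolding a(2) a_def[symmetric] using a(1) by (intro f[symmetric])
    finally show ?thesis .
  qed
  have y0: "0 \<le> y" using y e_pos[of n] by linarith
  have d: "width n \<le> y * g" unfolding width_def g_def[symmetric] using y g0 by (intro mult_right_mono)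
  have x1: "\<xi> (2 / real (2*n+2)) \<le> \<xi> (2 / real (2*n+1))" by (rule \<xi>_mono) (simp add: frac_le)
  have x2: "\<xi> (2 / real (2*n+1)) \<le> \<xi> (2 / real (2*n))" by (rule \<xi>_mono, rule divide_left_mono) (use n in auto)
  have "y * g = 2 / real (2*n+1) * y - 2 / real (2*n+2) * y" by (simp add: g_def algebra_simps)
  then show "line (2*n+2) y + width n \<le> line (2*n+1) y" unfolding line_def using x1 d by linarith
  have "y * g \<le> y * (2 / real (2*n) - 2 / real (2*n+1))" using gg y0 by (rule mult_left_mono)
  also have "\<dots> = 2 / real (2*n) * y - 2 / real (2*n+1) * y" by (simp only: algebra_simps)
  finally show "line (2*n+1) y + width n \<le> line (2*n) y" unfolding line_def using x2 d by linarith
qed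

lemma line_K: "y > 0 \<Longrightarrow> line j y < x \<longleftrightarrow> 2 / real j < K (pt x y)"
  using K_le_iff[of "pt x y" "2 / real j"] by (auto simp: line_def not_le[symmetric])

lemma K_line: "y > 0 \<Longrightarrow> x < line j y \<longleftrightarrow> K (pt x y) < 2 / real j"
  using K_less_iff[of "pt x y" "2 / real j"] by (auto simp: line_def)

lemma cutoff_supp: "cutoff n y \<noteq> 0 \<Longrightarrow> e n < y \<and> y < 1"
proof -
  assume r: "cutoff n y \<noteq> 0"
  then have "\<not> (y - e n) / e n \<le> 0" "\<not> 2 * (1 - y) \<le> 0" unfolding cutoff_def by (metis mult_eq_0_iff step_0)+
  then show ?thesis using e_pos[of n] by (auto simp: divide_le_0_iff)
qed

lemma cutoff_bounds: "0 \<le> cutoff n y" "cutoff n y \<le> 1"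
  unfolding cutoff_def using step_bounds by (auto intro: mult_le_one)

lemma piece_eqI: "2 / k < real (Suc j) \<Longrightarrow> real j \<le> 2 / k \<Longrightarrow> piece k = j"
  unfolding piece_def using floor_unique[of "int j" "2 / k"] by simp

text \<open>Up to the left line both ramps are \<open>0\<close> and from the right line on both are
  \<open>1\<close>, so their difference lives strictly inside the \<open>n\<close>-th pair. The last
  claim makes bumps of different index disjoint, which keeps their sum bounded by \<open>1\<close>
  for every number of bumps.\<close>

lemma bump_supp:
  assumes t: "bump n x y \<noteq> 0" and n: "1 \<le> n"
  shows "e n < y" "y < 1" "line (2*n+2) y < x" "x < line (2*n) y" "piece (K (pt x y)) div 2 = n"
proof -
  have r: "cutoff n y \<noteq> 0" using t by (auto simp: bump_def)
  show y: "e n < y" "y < 1" using cutoff_supp[OF r] by auto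
  note g = line_gap[OF less_imp_le[OF y(1)] n]
  have y0: "0 < y" using y e_pos[of n] by linarith
  show x1: "line (2*n+2) y < x"
  proof (rule ccontr)
    assume "\<not> line (2*n+2) y < x"
    then have "(x - line (2*n+2) y) / width n \<le> 0" "(x - line (2*n+1) y) / width n \<le> 0"
      using g(1) width_pos[of n] by (auto simp: divide_le_0_iff)
    then show False using t by (simp add: bump_def)
  qed
  show x2: "x < line (2*n) y"
  proof (rule ccontr)
    assume "\<not> x < line (2*n) y"
    then have "(x - line (2*n+2) y) / width n \<ge> 1" "(x - line (2*n+1) y) / width n \<ge> 1"
      using g width_pos[of n] by (auto simp: le_divide_eq)
    then show False using t by (simp add: bump_def)
  qed
  have k: "2 / real (2*n+2) < K (pt x y)" "K (pt x y) < 2 / real (2*n)"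
    using x1 x2 line_K[OF y0] K_line[OF y0] by auto
  have k0: "0 < K (pt x y)" by (rule less_trans[OF _ k(1)]) simp
  have a: "2 / K (pt x y) < real (2*n+2)" "real (2*n) < 2 / K (pt x y)"
    using k k0 n by (auto simp: field_simps)
  have "2 * n \<le> piece (K (pt x y))" "piece (K (pt x y)) < 2 * n + 2"
  proof -
    have "int (2*n) \<le> \<lfloor>2 / K (pt x y)\<rfloor>" using a(2) unfolding le_floor_iff by simp
    moreover have "\<lfloor>2 / K (pt x y)\<rfloor> < int (2*n+2)" using a(1) unfolding floor_less_iff by simp
    ultimately show "2 * n \<le> piece (K (pt x y))" "piece (K (pt x y)) < 2 * n + 2"
      unfolding piece_def by linarith+
  qed
  then show "piece (K (pt x y)) div 2 = n" by linarith
qed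

lemma bump_bounds: "1 \<le> n \<Longrightarrow> -1 \<le> bump n x y \<and> bump n x y \<le> 1"
proof -
  have "\<bar>cutoff n y * (step a - step b)\<bar> \<le> 1 * 1" for a b
    unfolding abs_mult using cutoff_bounds[of n y] step_bounds[of a] step_bounds[of b] by (intro mult_mono) auto
  then show ?thesis unfolding bump_def by (simp add: abs_le_iff)
qed

definition bumps :: "nat \<Rightarrow> (nat \<Rightarrow> real) \<Rightarrow> real" where "bumps N z = (\<Sum>n\<in>{1..N}. bump n (z 0) (z 1))"
definition bumps_x :: "nat \<Rightarrow> (nat \<Rightarrow> real) \<Rightarrow> real" where "bumps_x N z = (\<Sum>n\<in>{1..N}. bump_x n (z 0) (z 1))"

lemma bump_cont: "continuous_on UNIV (\<lambda>z::nat\<Rightarrow>real. bump n (z 0) (z 1))"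
  "continuous_on UNIV (\<lambda>z::nat\<Rightarrow>real. bump_x n (z 0) (z 1))"
  "continuous_on UNIV (\<lambda>z::nat\<Rightarrow>real. bump_y n (z 0) (z 1))"
  unfolding bump_def bump_x_def bump_y_def cutoff_def cutoff'_def line_def
  using e_pos[of n] width_pos[of n] by (auto intro!: continuous_intros)

lemma bumps_C1: "C1_fun 2 (bumps N)" "partial_deriv 0 (bumps N) z = bumps_x N z"
proof -
  have dx: "((\<lambda>s. \<Sum>n\<in>{1..N}. bump n s y) has_real_derivative (\<Sum>n\<in>{1..N}. bump_x n x y)) (at x)" for x y
    by (intro DERIV_sum bump_dx)
  have dy: "((\<lambda>s. \<Sum>n\<in>{1..N}. bump n x s) has_real_derivative (\<Sum>n\<in>{1..N}. bump_y n x y)) (at y)" for x y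
    by (intro DERIV_sum bump_dy)
  have c: "continuous_on UNIV (\<lambda>z::nat\<Rightarrow>real. \<Sum>n\<in>{1..N}. bump n (z 0) (z 1))"
    "continuous_on UNIV (\<lambda>z::nat\<Rightarrow>real. \<Sum>n\<in>{1..N}. bump_x n (z 0) (z 1))"
    "continuous_on UNIV (\<lambda>z::nat\<Rightarrow>real. \<Sum>n\<in>{1..N}. bump_y n (z 0) (z 1))"
    by (intro continuous_on_sum bump_cont)+
  note P = C1_fun_plane[where f="bumps N" and G="\<lambda>x y. \<Sum>n\<in>{1..N}. bump n x y", OF bumps_def dx dy c]
  show "C1_fun 2 (bumps N)" by (rule P(1))
  show "partial_deriv 0 (bumps N) z = bumps_x N z" unfolding bumps_x_def by (rule P(2))
qed

lemma bumps_abs: "\<bar>bumps N z\<bar> \<le> 1" if "z \<in> RR 2"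
proof -
  have z: "z = pt (z 0) (z 1)" using that RR2_iff by blast
  define n0 where "n0 = piece (K z) div 2"
  have "bump n (z 0) (z 1) = (if n = n0 then bump n0 (z 0) (z 1) else 0)" if "n \<in> {1..N}" for n
    using bump_supp(5)[of n "z 0" "z 1"] that z unfolding n0_def by (metis atLeastAtMost_iff)
  then have "bumps N z = (\<Sum>n\<in>{1..N}. if n = n0 then bump n0 (z 0) (z 1) else 0)"
    unfolding bumps_def by (intro sum.cong) auto
  also have "\<dots> = (if n0 \<in> {1..N} then bump n0 (z 0) (z 1) else 0)" by (simp add: sum.delta)
  finally show ?thesis using bump_bounds[of n0 "z 0" "z 1"] by (auto simp: abs_le_iff)
qed

definition test_field :: "nat \<Rightarrow> (nat \<Rightarrow> real) \<Rightarrow> nat \<Rightarrow> real" where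
  "test_field N z = (\<lambda>j. if j = 0 then bumps N z else 0)"

lemma test_field_admissible: "test_field N \<in> test_fields 2 (int_of 2 Box)"
  unfolding test_fields_def mem_Collect_eq
proof (intro conjI allI impI ballI)
  fix j :: nat assume "j < 2"
  have "C1_fun 2 (\<lambda>x. 0)"
    using C1_fun_plane(1)[where f="\<lambda>x. 0" and G="\<lambda>x y. 0" and Gx="\<lambda>x y. 0" and Gy="\<lambda>x y. 0"] by simp
  then show "C1_fun 2 (\<lambda>x. test_field N x j)" using bumps_C1(1)[of N] by (cases "j = 0") (auto simp: test_field_def)
next
  \<comment> \<open>The bumps live at heights in \<open>{0..1}\<close> and on slopes at most
    \<open>1\<close>, with feet in \<open>{0..1/2}\<close>; this rectangle contains them with room
    to spare, independently of \<open>N\<close>.\<close>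
  let ?K = "{z \<in> RR 2. z 0 \<in> {0..3} \<and> z 1 \<in> {0..1}}"
  show "\<exists>K. compactin (Euclidean_space 2) K \<and> K \<subseteq> int_of 2 Box \<and> (\<forall>x\<in>RR 2 - K. \<forall>j<2. test_field N x j = 0)"
  proof (intro exI[of _ ?K] conjI ballI allI impI)
    show "compactin (Euclidean_space 2) ?K"
      unfolding compactin_Euclidean_iff using compact_pt_rect[of 0 3 0 1] by auto
    have "?K \<subseteq> Box0" by (auto simp: Box0_def)
    then show "?K \<subseteq> int_of 2 Box" using Box0_int by blast
    fix z j assume z: "z \<in> RR 2 - ?K"
    have "bump n (z 0) (z 1) = 0" if n: "n \<in> {1..N}" for n
    proof (rule ccontr)
      assume "bump n (z 0) (z 1) \<noteq> 0"
      note s = bump_supp[OF this]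
      have n1: "1 \<le> n" using n by simp
      have y: "0 \<le> z 1" "z 1 \<le> 1" using s(1,2)[OF n1] e_pos[of n] by linarith+
      have k: "2 / real (2*n+2) \<in> {0..1}" "2 / real (2*n) \<in> {0..1}" using n1 by auto
      have "0 \<le> line (2*n+2) (z 1)" unfolding line_def using \<xi>_bounds[OF k(1)] k(1) y by (intro add_nonneg_nonneg mult_nonneg_nonneg) auto
      moreover have "2 / real (2*n) * z 1 \<le> 1 * 1" using k(2) y by (intro mult_mono) auto
      then have "line (2*n) (z 1) \<le> 3" unfolding line_def using \<xi>_bounds[OF k(2)] by linarith
      ultimately have "z \<in> ?K" using s(3,4)[OF n1] y z by auto
      then show False using z by blast
    qed
    then show "test_field N z j = 0" by (simp add: test_field_def bumps_def)
  qed
next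
  fix z assume "z \<in> RR 2"
  from bumps_abs[OF this, of N] show "enorm 2 (test_field N z) \<le> 1"
    by (simp add: enorm_def L2_set_def test_field_def numeral_2_eq_2)
qed

lemma test_field_div: "divergence 2 (test_field N) z = bumps_x N z"
proof -
  have "partial_deriv 1 (\<lambda>y. test_field N y 1) z = 0" unfolding partial_deriv_def test_field_def by simp
  moreover have "(\<lambda>y. test_field N y 0) = bumps N" by (simp add: test_field_def fun_eq_iff)
  ultimately show ?thesis unfolding divergence_def using bumps_C1(2)[of N z] by (simp add: numeral_2_eq_2)
qed

end

section \<open>The jump across an interface and its logarithmic integral\<close>

context steps
begin

text \<open>Between the layers the whole source mass of the ray has been collected and none has been
  delivered, so the flux equals \<open>m\<close>.\<close>

lemma \<sigma>0_piece:
  assumes y: "e n < y" "y \<le> 1" and k: "0 < K (pt x y)" "K (pt x y) \<le> 1" and j: "piece (K (pt x y)) = j" "j div 2 = n"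
  shows "\<sigma>0 (pt x y) = sqrt (1 + (K (pt x y))\<^sup>2) * ((c_val j * e n + (e n)\<^sup>2 / 2) / (c_val j + y))"
proof -
  have y0: "0 < y" using y e_pos[of n] by linarith
  then have "pt x y \<in> Rs" using y k by (simp add: Rs_def)
  moreover have "C_step (K (pt x y)) = c_val j" "tau_step (K (pt x y)) = e n" using k j by (auto simp: C_step_def tau_step_def)
  ultimately show ?thesis using y by (simp add: \<sigma>0_def flux_def)
qed

text \<open>The masses are \<open>5/2 * a\<^sup>2\<close> for \<open>c = 2 * a\<close> and
  \<open>3/2 * a\<^sup>2\<close> for \<open>c = a\<close>. Over a common denominator the difference
  is \<open>a\<^sup>2 * (y - a / 2) / ((2 * a + y) * (a + y))\<close>, and \<open>a \<le> y\<close>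
  bounds the fraction below by \<open>(y / 2) / (3 * y * (2 * y))\<close>, whence the
  \<open>12\<close>.\<close>

lemma jump_ge:
  fixes a y :: real
  assumes "0 < a" "a \<le> y"
  shows "a\<^sup>2 / (12 * y) \<le> 5/2 * a\<^sup>2 / (2 * a + y) - 3/2 * a\<^sup>2 / (a + y)"
proof -
  have "5/2 * a\<^sup>2 / (2 * a + y) - 3/2 * a\<^sup>2 / (a + y) = a\<^sup>2 * ((y - a / 2) / ((2 * a + y) * (a + y)))"
  proof -
    have "5/2 * A / u - 3/2 * A / v = A * ((5/2 * v - 3/2 * u) / (u * v))" if "u > 0" "v > 0" for A u v :: real
      using that by (simp add: field_simps)
    moreover have d: "5/2 * (a + y) - 3/2 * (2 * a + y) = y - a / 2" by (simp add: field_simps)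
    moreover have "2 * a + y > 0" "a + y > 0" using assms by auto
    ultimately show ?thesis by (metis (no_types))
  qed
  moreover have "(y / 2) / ((3 * y) * (2 * y)) \<le> (y - a / 2) / ((2 * a + y) * (a + y))"
    using assms by (intro frac_le mult_mono mult_pos_pos) auto
  moreover have "(y / 2) / ((3 * y) * (2 * y)) = 1 / (12 * y)" using assms by simp
  ultimately show ?thesis using mult_left_mono[of "1 / (12 * y)" "(y - a / 2) / ((2 * a + y) * (a + y))" "a\<^sup>2"] by simp
qed

text \<open>The right ramp lies in piece \<open>2 * n\<close>, with slopes above that of the
  interface, and the left ramp in piece \<open>2 * n + 1\<close>, with slopes below it. Freezing
  \<open>sqrt (1 + k\<^sup>2)\<close> at its interface value \<open>R\<close> therefore loses in the
  right direction on both sides.\<close>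

lemma \<sigma>0_tst_x_ge:
  assumes n: "1 \<le> n" and y: "e n < y" "y < 1"
  defines "R \<equiv> sqrt (1 + (2 / real (2*n+1))\<^sup>2)"
  shows "cutoff n y * (R * (5/2 * (e n)\<^sup>2 / (2 * e n + y)) * (step' ((x - line (2*n+1) y) / width n) / width n)
      - R * (3/2 * (e n)\<^sup>2 / (e n + y)) * (step' ((x - line (2*n+2) y) / width n) / width n))
    \<le> \<sigma>0 (pt x y) * bump_x n x y"
proof -
  define k where "k = K (pt x y)"
  define sH where "sH = step' ((x - line (2*n+1) y) / width n) / width n"
  define sL where "sL = step' ((x - line (2*n+2) y) / width n) / width n"
  have y0: "0 < y" using y e_pos[of n] by linarith
  have s0: "0 \<le> sH" "0 \<le> sL" using step'_nonneg width_pos[of n] by (auto simp: sH_def sL_def)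
  note g = line_gap[OF less_imp_le[OF y(1)] n]
  have mono: "sqrt (1 + a\<^sup>2) \<le> sqrt (1 + b\<^sup>2)" if "0 \<le> a" "a \<le> b" for a b :: real
    using that by (intro real_sqrt_le_mono add_left_mono power_mono)
  have e0: "0 \<le> (e n)\<^sup>2" "0 < e n" using e_pos[of n] by auto
  have H: "R * (5/2 * (e n)\<^sup>2 / (2 * e n + y)) * sH \<le> \<sigma>0 (pt x y) * sH"
  proof (cases "sH = 0")
    case False
    then have "0 < (x - line (2*n+1) y) / width n" "(x - line (2*n+1) y) / width n < 1"
      using step'_supp[of "(x - line (2*n+1) y) / width n"] by (auto simp: sH_def)
    then have "line (2*n+1) y < x" "x < line (2*n) y" using width_pos[of n] g(2) by (auto simp: zero_less_divide_iff)
    then have k: "2 / real (2*n+1) < k" "k < 2 / real (2*n)" unfolding k_def using line_K[OF y0] K_line[OF y0] by auto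
    have k0: "0 < k" by (rule less_trans[OF _ k(1)]) simp
    have "2 / real (2*n) \<le> 1" using n by simp
    then have k1: "k \<le> 1" using k by linarith
    have "piece k = 2 * n" using k k0 n by (intro piece_eqI) (auto simp: field_simps)
    then have "\<sigma>0 (pt x y) = sqrt (1 + k\<^sup>2) * ((c_val (2*n) * e n + (e n)\<^sup>2 / 2) / (c_val (2*n) + y))"
      unfolding k_def using k0 k1 y by (intro \<sigma>0_piece) (auto simp: k_def)
    also have "\<dots> = sqrt (1 + k\<^sup>2) * (5/2 * (e n)\<^sup>2 / (2 * e n + y))" by (simp add: c_val_def power2_eq_square)
    finally have v: "\<sigma>0 (pt x y) = sqrt (1 + k\<^sup>2) * (5/2 * (e n)\<^sup>2 / (2 * e n + y))" .
    have "R * (5/2 * (e n)\<^sup>2 / (2 * e n + y)) \<le> \<sigma>0 (pt x y)"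
      unfolding R_def v using k e0 y0 by (intro mult_right_mono mono) auto
    then show ?thesis using s0 by (intro mult_right_mono)
  qed simp
  have L: "\<sigma>0 (pt x y) * sL \<le> R * (3/2 * (e n)\<^sup>2 / (e n + y)) * sL"
  proof (cases "sL = 0")
    case False
    then have "0 < (x - line (2*n+2) y) / width n" "(x - line (2*n+2) y) / width n < 1"
      using step'_supp[of "(x - line (2*n+2) y) / width n"] by (auto simp: sL_def)
    then have "line (2*n+2) y < x" "x < line (2*n+1) y" using width_pos[of n] g(1) by (auto simp: zero_less_divide_iff)
    then have k: "2 / real (2*n+2) < k" "k < 2 / real (2*n+1)" unfolding k_def using line_K[OF y0] K_line[OF y0] by auto
    have k0: "0 < k" by (rule less_trans[OF _ k(1)]) simp
    have "2 / real (2*n+1) \<le> 1" using n by simp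
    then have k1: "k \<le> 1" using k by linarith
    have "piece k = 2 * n + 1" using k k0 n by (intro piece_eqI) (auto simp: field_simps)
    then have "\<sigma>0 (pt x y) = sqrt (1 + k\<^sup>2) * ((c_val (2*n+1) * e n + (e n)\<^sup>2 / 2) / (c_val (2*n+1) + y))"
      unfolding k_def using k0 k1 y by (intro \<sigma>0_piece) (auto simp: k_def)
    also have "\<dots> = sqrt (1 + k\<^sup>2) * (3/2 * (e n)\<^sup>2 / (e n + y))" by (simp add: c_val_def power2_eq_square)
    finally have v: "\<sigma>0 (pt x y) = sqrt (1 + k\<^sup>2) * (3/2 * (e n)\<^sup>2 / (e n + y))" .
    have "\<sigma>0 (pt x y) \<le> R * (3/2 * (e n)\<^sup>2 / (e n + y))"
      unfolding R_def v using k k0 e0 y0 by (intro mult_right_mono mono) auto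
    then show ?thesis using s0 by (intro mult_right_mono)
  qed simp
  have "cutoff n y * (R * (5/2 * (e n)\<^sup>2 / (2 * e n + y)) * sH - R * (3/2 * (e n)\<^sup>2 / (e n + y)) * sL)
      \<le> cutoff n y * (\<sigma>0 (pt x y) * sH - \<sigma>0 (pt x y) * sL)"
    using H L cutoff_bounds(1)[of n y] by (intro mult_left_mono diff_mono) auto
  also have "\<dots> = \<sigma>0 (pt x y) * bump_x n x y"
    unfolding bump_x_def sH_def[symmetric] sL_def[symmetric] by (simp add: algebra_simps)
  finally show ?thesis unfolding sH_def sL_def .
qed

text \<open>Both ramp derivatives have integral \<open>1\<close>, so the slice is at least
  \<open>cutoff n y\<close> times \<open>R\<close> times the jump. The cutoff is \<open>1\<close> on
  \<open>{2 * e n..1/2}\<close>, and elsewhere nonnegativity suffices.\<close>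

lemma slice_ge:
  assumes n: "1 \<le> n" and i: "integrable lborel (\<lambda>x. \<sigma>0 (pt x y) * bump_x n x y)"
  shows "(e n)\<^sup>2 / 12 * (1 / y * indicator {2 * e n..1/2} y) \<le> (\<integral>x. \<sigma>0 (pt x y) * bump_x n x y \<partial>lborel)"
proof (cases "e n < y \<and> y < 1")
  case False
  then have "cutoff n y = 0" using cutoff_supp by blast
  moreover have "y \<notin> {2 * e n..1/2}" using False e_pos[of n] by auto
  ultimately show ?thesis by (simp add: bump_x_def)
next
  case True
  then have y: "e n < y" "y < 1" by auto
  have e0: "0 < e n" by (rule e_pos)
  define R where "R = sqrt (1 + (2 / real (2*n+1))\<^sup>2)"
  define bH where "bH = 5/2 * (e n)\<^sup>2 / (2 * e n + y)"
  define bL where "bL = 3/2 * (e n)\<^sup>2 / (e n + y)"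
  define sH where "sH x = step' ((x - line (2*n+1) y) / width n) / width n" for x
  define sL where "sL x = step' ((x - line (2*n+2) y) / width n) / width n" for x
  have sH: "integrable lborel sH" "(\<integral>x. sH x \<partial>lborel) = 1"
    unfolding sH_def using step'_integral[OF width_pos[of n]] by auto
  have sL: "integrable lborel sL" "(\<integral>x. sL x \<partial>lborel) = 1"
    unfolding sL_def using step'_integral[OF width_pos[of n]] by auto
  have b: "(e n)\<^sup>2 / (12 * y) \<le> bH - bL" unfolding bH_def bL_def using jump_ge[OF e0, of y] y by simp
  have R1: "1 \<le> R" by (simp add: R_def)
  have pos: "0 \<le> (e n)\<^sup>2 / (12 * y)" using y e0 by simp
  have "1 * ((e n)\<^sup>2 / (12 * y)) \<le> R * (bH - bL)" using R1 b pos by (intro mult_mono) auto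
  then have Rb: "(e n)\<^sup>2 / (12 * y) \<le> R * (bH - bL)" by simp
  have "(e n)\<^sup>2 / 12 * (1 / y * indicator {2 * e n..1/2} y) \<le> cutoff n y * (R * (bH - bL))"
  proof (cases "y \<in> {2 * e n..1/2}")
    case True
    then have "cutoff n y = 1" unfolding cutoff_def using e0 by (simp add: le_divide_eq)
    then show ?thesis using Rb True by simp
  next
    case False
    have "0 \<le> R * (bH - bL)" using Rb pos by linarith
    then have "0 \<le> cutoff n y * (R * (bH - bL))" by (rule mult_nonneg_nonneg[OF cutoff_bounds(1)])
    then show ?thesis using False by simp
  qed
  also have "\<dots> = (\<integral>x. cutoff n y * (R * bH * sH x - R * bL * sL x) \<partial>lborel)"
    using sH sL by (simp add: algebra_simps)
  also have "\<dots> \<le> (\<integral>x. \<sigma>0 (pt x y) * bump_x n x y \<partial>lborel)"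
  proof (rule integral_mono[OF _ i])
    show "integrable lborel (\<lambda>x. cutoff n y * (R * bH * sH x - R * bL * sL x))" using sH sL by auto
    show "cutoff n y * (R * bH * sH x - R * bL * sL x) \<le> \<sigma>0 (pt x y) * bump_x n x y" for x
      using \<sigma>0_tst_x_ge[OF n y, of x] unfolding R_def bH_def bL_def sH_def sL_def .
  qed
  finally show ?thesis .
qed

lemma integrable_\<sigma>0_times:
  assumes "continuous_on Box g"
  shows "integrable (leb 2) (\<lambda>z. \<sigma>0 z * g z)"
proof -
  note m = continuous_on_RR2_Box(1)[OF assms]
  obtain B where B: "B \<ge> 0" "\<And>z. \<bar>indicator Box z * g z\<bar> \<le> B * indicator Box z"
    using continuous_on_RR2_Box(2)[OF assms] by blast
  have eq: "\<sigma>0 z * g z = \<sigma>0 z * (indicator Box z * g z)" for z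
    using \<sigma>0_bounds(2)[of z] by (cases "z \<in> Box") auto
  show ?thesis unfolding eq
  proof (rule integrable_leb2_Box[where B="4 * B"])
    show "(\<lambda>z. \<sigma>0 z * (indicator Box z * g z)) \<in> borel_measurable borel" using m by measurable
    fix z
    have "\<bar>\<sigma>0 z * (indicator Box z * g z)\<bar> \<le> (4 * indicator Box z) * (B * indicator Box z)"
      unfolding abs_mult[of "\<sigma>0 z"] using \<sigma>0_bounds(2)[of z] B(2)[of z] by (intro mult_mono) auto
    then show "\<bar>\<sigma>0 z * (indicator Box z * g z)\<bar> \<le> 4 * B * indicator Box z" by (cases "z \<in> Box") auto
  qed
qed

text \<open>Integrating \<open>1 / y\<close> from \<open>2 * e n\<close> to \<open>1/2\<close>
  produces the logarithm. The factor \<open>4\<close> inside it changes the bound only by a multiple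
  of \<open>(e n)\<^sup>2\<close>, which is summable.\<close>

lemma bump_integral_ge:
  assumes n: "1 \<le> n"
  shows "integrable (leb 2) (\<lambda>z. \<sigma>0 z * bump_x n (z 0) (z 1))"
    "(e n)\<^sup>2 / 12 * ln (1 / (4 * e n)) \<le> (\<integral>z. \<sigma>0 z * bump_x n (z 0) (z 1) \<partial>leb 2)"
proof -
  show i: "integrable (leb 2) (\<lambda>z. \<sigma>0 z * bump_x n (z 0) (z 1))"
    by (rule integrable_\<sigma>0_times) (rule continuous_on_subset[OF bump_cont(2)], simp)
  note I = integral_leb2[OF i, simplified]
  have e: "0 < e n" "2 * e n \<le> 1/2" using e_pos[of n] e_le[of n] by auto
  have ci: "integrable lborel (\<lambda>y. 1 / y * indicator {2 * e n..1/2} y)"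
    by (rule borel_integrable_atLeastAtMost) (use e in \<open>auto intro!: continuous_intros\<close>)
  have "(\<integral>y. 1 / y * indicator {2 * e n..1/2} y \<partial>lborel) = ln (1/2) - ln (2 * e n)"
    by (rule integral_FTC_Icc_real[where F=ln]) (use e in \<open>auto intro!: derivative_eq_intros continuous_intros\<close>)
  also have "\<dots> = ln (1/2 / (2 * e n))" using ln_div[of "1/2" "2 * e n"] e by simp
  also have "1/2 / (2 * e n) = 1 / (4 * e n)" by simp
  finally have I0: "(\<integral>y. 1 / y * indicator {2 * e n..1/2} y \<partial>lborel) = ln (1 / (4 * e n))" .
  have "(e n)\<^sup>2 / 12 * ln (1 / (4 * e n)) = (\<integral>y. (e n)\<^sup>2 / 12 * (1 / y * indicator {2 * e n..1/2} y) \<partial>lborel)"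
    unfolding I0[symmetric] by (rule integral_mult_right_zero[symmetric])
  also have "\<dots> \<le> (\<integral>y. \<integral>x. \<sigma>0 (pt x y) * bump_x n x y \<partial>lborel \<partial>lborel)"
  proof (rule integral_mono_AE)
    show "integrable lborel (\<lambda>y. (e n)\<^sup>2 / 12 * (1 / y * indicator {2 * e n..1/2} y))" using ci by (rule integrable_mult_right)
    show "AE y in lborel. (e n)\<^sup>2 / 12 * (1 / y * indicator {2 * e n..1/2} y) \<le> (\<integral>x. \<sigma>0 (pt x y) * bump_x n x y \<partial>lborel)"
      using I(3) by eventually_elim (rule slice_ge[OF n])
  qed (rule I(2))
  finally show "(e n)\<^sup>2 / 12 * ln (1 / (4 * e n)) \<le> (\<integral>z. \<sigma>0 z * bump_x n (z 0) (z 1) \<partial>leb 2)" using I(1) by simp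
qed

text \<open>Bumps of the first \<open>N\<close> pairs form one admissible field, so finite variation
  would bound all partial sums of a nonnegative divergent series.\<close>

lemma transport_density_not_BV:
  assumes s: "is_transport_density 2 Box fp fm \<sigma>"
  shows "\<sigma> \<notin> BV 2 Box"
proof
  assume "\<sigma> \<in> BV 2 Box"
  then have "variation 2 (int_of 2 Box) \<sigma> < \<infinity>" by (simp add: BV_def)
  then obtain v where v: "variation 2 (int_of 2 Box) \<sigma> \<le> ereal v"
    by (cases "variation 2 (int_of 2 Box) \<sigma>") auto
  have c: "continuous_on Box (bumps_x N)" for N
    unfolding bumps_x_def[abs_def]
    by (rule continuous_on_subset[OF continuous_on_sum[OF bump_cont(2)]]) simp
  have le: "(\<Sum>n\<in>{1..N}. (e n)\<^sup>2 / 12 * ln (1 / (4 * e n))) \<le> v" for N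
  proof -
    have "(\<Sum>n\<in>{1..N}. (e n)\<^sup>2 / 12 * ln (1 / (4 * e n))) \<le> (\<Sum>n\<in>{1..N}. \<integral>z. \<sigma>0 z * bump_x n (z 0) (z 1) \<partial>leb 2)"
      by (rule sum_mono) (rule bump_integral_ge, simp)
    also have "\<dots> = (\<integral>z. \<sigma>0 z * bumps_x N z \<partial>leb 2)"
      unfolding bumps_x_def sum_distrib_left using bump_integral_ge(1)
      by (intro Bochner_Integration.integral_sum[symmetric]) auto
    \<comment> \<open>Here \<open>\<sigma>\<close> replaces \<open>\<sigma>0\<close>: the divergence
      is a continuous test function, and against such functions all transport densities
      agree.\<close>
    also have "\<dots> = (LINT z:int_of 2 Box|leb 2. \<sigma> z * divergence 2 (test_field N) z)"
      unfolding test_field_div by (rule transport_density_unique[OF s c, symmetric])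
    finally have "ereal (\<Sum>n\<in>{1..N}. (e n)\<^sup>2 / 12 * ln (1 / (4 * e n))) \<le> ereal (LINT z:int_of 2 Box|leb 2. \<sigma> z * divergence 2 (test_field N) z)"
      by simp
    also have "\<dots> \<le> variation 2 (int_of 2 Box) \<sigma>"
      unfolding variation_def by (rule SUP_upper) (rule test_field_admissible)
    also have "\<dots> \<le> ereal v" by (rule v)
    finally show ?thesis by simp
  qed
  define a where "a n = (e n)\<^sup>2 / 12 * ln (1 / (4 * e n))" for n
  \<comment> \<open>\<open>4 * e n \<le> 1\<close> makes the logarithm nonnegative, so bounded
    partial sums give convergence.\<close>
  have a0: "0 \<le> a n" for n using e_pos[of n] e_le[of n] by (simp add: a_def)
  have "summable (\<lambda>n. a (Suc n))"
  proof (rule summableI_nonneg_bounded)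
    fix N
    have "(\<Sum>n<N. a (Suc n)) = (\<Sum>n\<in>{1..N}. a n)"
      by (rule sum.reindex_bij_witness[of _ "\<lambda>n. n - 1" Suc]) auto
    then show "(\<Sum>n<N. a (Suc n)) \<le> v" using le[of N] by (simp add: a_def)
  qed (rule a0)
  then have sa: "summable a" by (simp only: summable_Suc_iff)
  have "(e n)\<^sup>2 * ln (1 / e n) = 12 * a n + ln 4 * (e n)\<^sup>2" for n
  proof -
    have "ln (1 / e n) = ln (1 / (4 * e n)) + ln 4" using e_pos[of n] by (simp add: ln_div ln_mult)
    then show ?thesis by (simp add: a_def algebra_simps)
  qed
  then have "summable (\<lambda>n. (e n)\<^sup>2 * ln (1 / e n))"
    using sa e_sum by (auto intro!: summable_add summable_mult)
  then show False using e_div by blast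
qed

end

section \<open>A sequence at the borderline between the two series\<close>

definition stepsize :: "nat \<Rightarrow> real" where
  "stepsize n = 1 / (sqrt (real (Suc n)) * (4 + ln (real (Suc n))))"

lemma stepsize_sq: "(stepsize n)\<^sup>2 = 1 / (real (Suc n) * (4 + ln (real (Suc n)))\<^sup>2)"
  by (simp add: stepsize_def power_divide power_mult_distrib del: of_nat_Suc)

text \<open>With \<open>M = n + 1\<close> and \<open>L = 4 + ln M\<close> the squares are
  \<open>1 / (M * L\<^sup>2)\<close>, while the logarithm of the reciprocal is at least
  \<open>L / 4\<close>; the weighted terms are then at least \<open>1 / (4 * M * L)\<close>. Cauchy
  condensation separates the two series. The summand \<open>4\<close> also gives
  \<open>e n \<le> 1/4\<close>.\<close>

lemma steps_stepsize: "steps stepsize"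
proof
  have l0: "0 \<le> ln (real (Suc n))" for n by simp
  have den: "1 * 4 \<le> sqrt (real (Suc n)) * (4 + ln (real (Suc n)))" for n
    using l0[of n] by (intro mult_mono) (auto simp del: of_nat_Suc)
  show pos: "0 < stepsize n" for n using den[of n] by (simp add: stepsize_def del: of_nat_Suc)
  show "stepsize n \<le> 1 / 4" for n unfolding stepsize_def using den[of n] by (intro divide_left_mono) (auto simp del: of_nat_Suc)
  show "decseq stepsize"
  proof (rule decseq_SucI)
    fix n
    have "sqrt (real (Suc n)) * (4 + ln (real (Suc n))) \<le> sqrt (real (Suc (Suc n))) * (4 + ln (real (Suc (Suc n))))"
      by (intro mult_mono add_left_mono) (auto simp: add_nonneg_nonneg)
    moreover have P: "0 < sqrt (real (Suc n)) * (4 + ln (real (Suc n)))" for n using den[of n] by linarith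
    ultimately show "stepsize (Suc n) \<le> stepsize n" unfolding stepsize_def
      by (intro divide_left_mono mult_pos_pos[OF P P]) simp_all
  qed
  have lp: "ln ((2::real) ^ n) = real n * ln 2" for n by (simp add: ln_realpow)
  have l2: "1/2 \<le> ln (2::real)" "ln (2::real) \<le> 1" using ln2_ge_two_thirds ln_le_minus_one[of 2] by auto
  \<comment> \<open>Condensation turns \<open>ln m\<close> into \<open>n * ln 2\<close>; these
    linear bounds compare the condensed series with the sums of \<open>1 / n^2\<close> and of
    \<open>1 / n\<close>.\<close>
  have low: "real (Suc n) / 2 \<le> 4 + real n * ln 2" for n
    using mult_left_mono[OF l2(1), of "real n"] by simp
  have up: "4 + real n * ln 2 \<le> 4 * real (Suc n)" for n
    using mult_left_mono[OF l2(2), of "real n"] by simp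
  define f g where "f m = 1 / (real m * (4 + ln (real m))\<^sup>2)" and "g m = 1 / (real m * (4 + ln (real m)))" for m :: nat
  have f0: "0 \<le> f m" and g0: "0 \<le> g m" for m
    by (cases "m = 0"; simp add: f_def g_def)+
  have mon: "4 + ln (real m) \<le> 4 + ln (real (Suc m))" "0 < 4 + ln (real m)" "0 < 4 + ln (real (Suc m))" if "0 < m" for m :: nat
    using that by (auto simp: add_pos_nonneg)
  have "summable f"
  proof (subst condensation_test)
    show "f (Suc m) \<le> f m" if "0 < m" for m
      unfolding f_def using mon[OF that] that by (intro divide_left_mono mult_mono power_mono mult_pos_pos) auto
    have "summable (\<lambda>n. 4 * inverse (real (Suc n) ^ 2))"
      using inverse_power_summable[of 2, where 'a=real] by (intro summable_mult) (subst summable_Suc_iff, simp)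
    then show "summable (\<lambda>n. 2 ^ n * f (2 ^ n))"
    proof (rule summable_comparison_test'[where N=0])
      fix n :: nat
      have "2 ^ n * f (2 ^ n) = 1 / (4 + real n * ln 2)\<^sup>2" by (simp add: f_def lp)
      also have "\<dots> \<le> 1 / (real (Suc n) / 2)\<^sup>2"
      proof (rule divide_left_mono)
        have p: "0 < real (Suc n) / 2" by simp
        then show "(real (Suc n) / 2)\<^sup>2 \<le> (4 + real n * ln 2)\<^sup>2" using low[of n] by (intro power_mono) linarith+
        show "0 < (4 + real n * ln 2)\<^sup>2 * (real (Suc n) / 2)\<^sup>2"
          using p low[of n] by (intro mult_pos_pos zero_less_power) linarith+
      qed simp
      also have "\<dots> = 4 * inverse (real (Suc n) ^ 2)" by (simp add: power_divide inverse_eq_divide del: of_nat_Suc)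
      finally show "norm (2 ^ n * f (2 ^ n)) \<le> 4 * inverse (real (Suc n) ^ 2)" using f0[of "2 ^ n"] by simp
    qed
  qed (rule f0)
  then have "summable (\<lambda>n. f (Suc n))" by (simp only: summable_Suc_iff)
  then show "summable (\<lambda>n. (stepsize n)\<^sup>2)" unfolding stepsize_sq f_def .
  have ng: "\<not> summable g"
  proof (subst condensation_test)
    show "g (Suc m) \<le> g m" if "0 < m" for m
      unfolding g_def using mon[OF that] that by (intro divide_left_mono mult_mono mult_pos_pos) auto
    show "\<not> summable (\<lambda>n. 2 ^ n * g (2 ^ n))"
    proof
      assume "summable (\<lambda>n. 2 ^ n * g (2 ^ n))"
      then have "summable (\<lambda>n. 4 * (2 ^ n * g (2 ^ n)))" by (rule summable_mult)
      then have "summable (\<lambda>n. inverse (real (Suc n)))"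
      proof (rule summable_comparison_test'[where N=0])
        fix n :: nat
        have "inverse (real (Suc n)) = 4 * (1 / (4 * real (Suc n)))" by (simp add: field_simps)
        also have "\<dots> \<le> 4 * (1 / (4 + real n * ln 2))"
          using up[of n] by (intro mult_left_mono divide_left_mono mult_pos_pos) (auto simp: add_pos_nonneg)
        also have "\<dots> = 4 * (2 ^ n * g (2 ^ n))" by (simp add: g_def lp)
        finally show "norm (inverse (real (Suc n))) \<le> 4 * (2 ^ n * g (2 ^ n))" by simp
      qed
      then show False using not_summable_harmonic[where 'a=real] summable_Suc_iff[of "\<lambda>n. inverse (real n)"] by blast
    qed
  qed (rule g0)
  show "\<not> summable (\<lambda>n. (stepsize n)\<^sup>2 * ln (1 / stepsize n))"
  proof
    assume "summable (\<lambda>n. (stepsize n)\<^sup>2 * ln (1 / stepsize n))"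
    then have "summable (\<lambda>n. 4 * ((stepsize n)\<^sup>2 * ln (1 / stepsize n)))" by (rule summable_mult)
    then have "summable (\<lambda>n. g (Suc n))"
    proof (rule summable_comparison_test'[where N=0])
      fix n :: nat
      define M where "M = real (Suc n)"
      define L where "L = 4 + ln M"
      have M: "1 \<le> M" "0 \<le> ln M" by (auto simp: M_def)
      have L: "4 \<le> L" using M by (simp add: L_def)
      \<comment> \<open>Hence \<open>ln L \<ge> 1\<close>, and \<open>L / 4 = 1 + ln M / 4\<close>
        is at most \<open>ln L + ln M / 2\<close>.\<close>
      have "exp 1 \<le> L" using exp_le L by linarith
      then have "1 \<le> ln L" using L by (subst ln_ge_iff) auto
      moreover have "ln (1 / stepsize n) = ln M / 2 + ln L"
        using M L unfolding stepsize_def M_def[symmetric] L_def[symmetric] by (simp add: ln_mult ln_sqrt)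
      ultimately have "L / 4 \<le> ln (1 / stepsize n)" using M L_def by linarith
      then have "4 * ((stepsize n)\<^sup>2 * (L / 4)) \<le> 4 * ((stepsize n)\<^sup>2 * ln (1 / stepsize n))"
        by (intro mult_left_mono) auto
      moreover have "4 * ((stepsize n)\<^sup>2 * (L / 4)) = g (Suc n)"
        unfolding stepsize_sq g_def M_def[symmetric] L_def[symmetric] using L M by (simp add: power2_eq_square)
      ultimately show "norm (g (Suc n)) \<le> 4 * ((stepsize n)\<^sup>2 * ln (1 / stepsize n))" using g0[of "Suc n"] by simp
    qed
    then show False using ng by (simp only: summable_Suc_iff)
  qed
qed

text \<open>Since a transport density may be changed on null sets and may come from any optimal
  plan, failure of BV is asserted for all of them; the existence clause keeps this from being
  vacuous.\<close>

theorem mainTheorem2: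
  shows "\<exists>(d::nat) (\<Omega> :: (nat \<Rightarrow> real) set) (fp :: (nat \<Rightarrow> real) \<Rightarrow> real) (fm :: (nat \<Rightarrow> real) \<Rightarrow> real).
    d \<ge> 1 \<and>
    compactin (Euclidean_space d) \<Omega> \<and> convex_set \<Omega> \<and> int_of d \<Omega> \<noteq> {} \<and>
    fp \<in> BV d \<Omega> \<and> (\<forall>x\<in>int_of d \<Omega>. 0 \<le> fp x) \<and>
    fm \<in> BV d \<Omega> \<and> (\<forall>x\<in>int_of d \<Omega>. 0 \<le> fm x) \<and>
    (LINT x:int_of d \<Omega>|leb d. fp x) = (LINT x:int_of d \<Omega>|leb d. fm x) \<and>
    (\<exists>\<sigma>. is_transport_density d \<Omega> fp fm \<sigma>) \<and>
    (\<forall>\<sigma>. is_transport_density d \<Omega> fp fm \<sigma> \<longrightarrow> \<sigma> \<notin> BV d \<Omega>)"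
proof -
  interpret steps stepsize by (rule steps_stepsize)
  show ?thesis
  proof (intro exI conjI)
    show "(1::nat) \<le> 2" by simp
    show "compactin (Euclidean_space 2) Box" by (rule compactin_Box)
    show "convex_set Box" by (rule convex_Box)
    show "int_of 2 Box \<noteq> {}" by (rule int_Box_nonempty)
    show "fp \<in> BV 2 Box" by (rule fp_BV)
    show "\<forall>x\<in>int_of 2 Box. 0 \<le> fp x" using fp_nonneg by blast
    show "fm \<in> BV 2 Box" by (rule fm_BV)
    show "\<forall>x\<in>int_of 2 Box. 0 \<le> fm x" using fm_nonneg by blast
    show "(LINT x:int_of 2 Box|leb 2. fp x) = (LINT x:int_of 2 Box|leb 2. fm x)" by (rule equal_mass)
    show "is_transport_density 2 Box fp fm \<sigma>0" by (rule transport_density_\<sigma>0)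
    show "\<forall>\<sigma>. is_transport_density 2 Box fp fm \<sigma> \<longrightarrow> \<sigma> \<notin> BV 2 Box" using transport_density_not_BV by blast
  qed
qed

end
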